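(* Let $x\in D_1$, $\nu\in\mathbb{C}$, $\mu\in\mathbb{C}\setminus\mathbb{Z}$ with $\nu+\mu\notin-\mathbb{N}$. Then $$\mathsf{Q}_\nu^\mu(x)=-\frac12\Bigg[\cos(\pi\nu)\Gamma(\mu)\left(\frac{1-x}{1+x}\right)^{\frac12\mu}{}_2F_1\!\left(-\nu,\nu+1;1-\mu;\frac{1+x}{2}\right)+\cos(\pi(\nu+\mu))\Gamma(-\mu)\frac{\Gamma(\nu+\mu+1)}{\Gamma(\nu-\mu+1)}\left(\frac{1+x}{1-x}\right)^{\frac12\mu}{}_2F_1\!\left(-\nu,\nu+1;1+\mu;\frac{1+x}{2}\right)\Bigg].$$
   Context: $\mathbb{N}=\{1,2,3,\dots\}$, $-\mathbb{N}=\{-1,-2,\dots\}$. $D_1=\mathbb{C}\setminus((-\infty,-1]\cup[1,\infty))$, $D_2=\mathbb{C}\setminus(-\infty,1]$. Complex powers are principal values. ${}_2F_1(a,b;c;w)$ is the Gauss hypergeometric function, principal branch on $\mathbb{C}\setminus[1,\infty)$ (the analytic continuation of $\sum_{n\ge0}\frac{(a)_n(b)_n}{(c)_n}\frac{w^n}{n!}$). $1/\Gamma$ is read as the entire function (zero at the poles of $\Gamma$), and a quotient ${}_2F_1(a,b;c;w)/\Gamma(c)$ with $c\in\{0,-1,-2,\dots\}$ is read as the regularized function (continuous in $c$). Associated Legendre function of the second kind: for $z\in D_2$, $\nu+\mu\in\mathbb{C}\setminus-\mathbb{N}$, $$Q_\nu^\mu(z)=\frac{\sqrt{\pi}\,e^{i\pi\mu}\Gamma(\nu+\mu+1)(z^2-1)^{\frac12\mu}}{2^{\nu+1}\Gamma(\nu+\frac32)z^{\nu+\mu+1}}\,{}_2F_1\!\left(\tfrac{\nu+\mu+2}{2},\tfrac{\nu+\mu+1}{2};\nu+\tfrac32;\tfrac1{z^2}\right),$$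 where $(z^2-1)^\alpha:=(z+1)^\alpha(z-1)^\alpha$. Ferrers function of the second kind: for $x\in(-1,1)$, $$\mathsf{Q}_\nu^\mu(x)=\tfrac12\big[e^{-\frac12 i\pi\mu}\,e^{-i\pi\mu}Q_\nu^\mu(x+i0)+e^{\frac12 i\pi\mu}\,e^{-i\pi\mu}Q_\nu^\mu(x-i0)\big],$$ where $x\pm i0$ denotes the limit from the upper/lower half-plane, and $\mathsf{Q}_\nu^\mu$ is extended analytically to $D_1$. *)

theory Defs
  imports "HOL-Complex_Analysis.Complex_Analysis"
begin

definition D1 :: "complex set" where
  "D1 = - complex_of_real ` ({..-1} \<union> {1..})"

definition slit_plane :: "complex set" where
  "slit_plane = - complex_of_real ` {1..}"

(* Only values at points of S are meaningful: there the choice is unique whenever a holomorphic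
   extension exists, S is open and connected, and A has a limit point in S. *)
definition analytic_continuation ::
    "(complex \<Rightarrow> complex) \<Rightarrow> complex set \<Rightarrow> complex set \<Rightarrow> complex \<Rightarrow> complex" where
  "analytic_continuation f A S =
     (SOME g. g holomorphic_on S \<and> (\<forall>z\<in>A. g z = f z))"

(* Intended for c not in {0,-1,-2,...} and w in the slit plane. *)
definition hyp2F1 :: "complex \<Rightarrow> complex \<Rightarrow> complex \<Rightarrow> complex \<Rightarrow> complex" where
  "hyp2F1 a b c =
     analytic_continuation
       (\<lambda>w. \<Sum>n. pochhammer a n * pochhammer b n / pochhammer c n * w ^ n / fact n)
       (ball 0 1) slit_plane"

(* The regularized function 2F1(a,b;c;w) / Gamma(c), entire in c: (c)_n Gamma(c) = Gamma(c+n), and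
   rGamma = 1 / Gamma is the entire function. *)
definition hyp2F1_reg :: "complex \<Rightarrow> complex \<Rightarrow> complex \<Rightarrow> complex \<Rightarrow> complex" where
  "hyp2F1_reg a b c =
     analytic_continuation
       (\<lambda>w. \<Sum>n. pochhammer a n * pochhammer b n * rGamma (c + of_nat n) * w ^ n / fact n)
       (ball 0 1) slit_plane"

lemma hyp2F1_reg_coeff:
  fixes a b c w :: complex
  assumes "c \<notin> \<int>\<^sub>\<le>\<^sub>0"
  shows "pochhammer a n * pochhammer b n * rGamma (c + of_nat n) * w ^ n / fact n =
         (pochhammer a n * pochhammer b n / pochhammer c n * w ^ n / fact n) / Gamma c"
proof -
  have "pochhammer c n \<noteq> 0"
    using assms by (auto simp: pochhammer_eq_0_iff)
  then show ?thesis
    by (simp add: pochhammer_rGamma[of c n] rGamma_inverse_Gamma[symmetric] divide_inverse)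
qed

(* Associated Legendre function of the second kind, for z outside (-infinity, 1]. The factor
   (z^2 - 1)^(mu/2) means (z+1)^(mu/2) (z-1)^(mu/2). *)
definition legendre_Q :: "complex \<Rightarrow> complex \<Rightarrow> complex \<Rightarrow> complex" where
  "legendre_Q \<nu> \<mu> z =
     of_real (sqrt pi) * exp (\<i> * of_real pi * \<mu>) * Gamma (\<nu> + \<mu> + 1)
       * ((z + 1) powr (\<mu> / 2) * (z - 1) powr (\<mu> / 2))
     / (2 powr (\<nu> + 1) * z powr (\<nu> + \<mu> + 1))
     * hyp2F1_reg ((\<nu> + \<mu> + 2) / 2) ((\<nu> + \<mu> + 1) / 2) (\<nu> + 3 / 2) (1 / z\<^sup>2)"

definition upper_limit :: "(complex \<Rightarrow> complex) \<Rightarrow> complex \<Rightarrow> complex" where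
  "upper_limit f x = Lim (at x within {z. Im z > 0}) f"

definition lower_limit :: "(complex \<Rightarrow> complex) \<Rightarrow> complex \<Rightarrow> complex" where
  "lower_limit f x = Lim (at x within {z. Im z < 0}) f"

definition ferrers_Q_cut :: "complex \<Rightarrow> complex \<Rightarrow> complex \<Rightarrow> complex" where
  "ferrers_Q_cut \<nu> \<mu> x =
     1 / 2 *
      (exp (- (\<i> * of_real pi * \<mu> / 2)) * exp (- (\<i> * of_real pi * \<mu>))
         * upper_limit (legendre_Q \<nu> \<mu>) x
       + exp (\<i> * of_real pi * \<mu> / 2) * exp (- (\<i> * of_real pi * \<mu>))
         * lower_limit (legendre_Q \<nu> \<mu>) x)"

definition ferrers_Q :: "complex \<Rightarrow> complex \<Rightarrow> complex \<Rightarrow> complex" where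
  "ferrers_Q \<nu> \<mu> =
     analytic_continuation (ferrers_Q_cut \<nu> \<mu>) (complex_of_real ` {-1<..<1}) D1"

end

theory Submission
  imports Defs "HOL-Real_Asymp.Real_Asymp"
begin

text \<open>
  The formula is a connection formula for Gauss's equation. Put \<open>w = 1/z\<^sup>2\<close>. In the upper and in the lower
  half-plane, near \<open>z = -1\<close>, the point \<open>w\<close> is close to \<open>1\<close>, and the connection formula from \<open>w = 0\<close>
  to \<open>w = 1\<close> writes \<open>Q\<close> as a combination of two series in \<open>1 - w\<close>. A quadratic transformation turns these
  into \<open>F(-\<nu>, \<nu> + 1; 1 \<plusminus> \<mu>; (1 + z)/2)\<close>, with phases that depend on the half-plane; by the identity
  theorem the resulting formula holds in the whole half-plane, and the mean of the two boundary values
  on \<open>(-1, 1)\<close> produces the cosines.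

  The connection coefficients exist because the Wronskian of two solutions is explicit up to a constant.
  The operator \<open>c + w d/dw\<close> lowers \<open>c\<close> by one and acts on all three solutions, so that the
  coefficients satisfy a first-order recurrence in \<open>c\<close>; their values follow from the limit
  \<open>c \<rightarrow> \<infinity>\<close>, where \<open>F(a, b; c; w) \<rightarrow> 1\<close> uniformly in the disc. All of this is done for the
  regularized series, since \<open>\<nu> + 3/2\<close> may be a nonpositive integer.
\<close>

section \<open>The hypergeometric equation near the origin\<close>

text \<open>Near \<open>z = -1\<close> with \<open>|z| > 1\<close> everything converges at once:
  \<open>w\<close> lies in the unit discs about both 0 and 1, and \<open>(1 + z) / 2\<close>, the
  variable of the target series, is small. With \<open>a = (\<nu> + \<mu> + 2) / 2\<close>,
  \<open>b = (\<nu> + \<mu> + 1) / 2\<close> and \<open>c = \<nu> + 3 / 2\<close> one has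
  \<open>c - a - b = - \<mu>\<close>, so a noninteger \<open>\<mu>\<close> is the nonresonance
  condition at \<open>w = 1\<close>. Only one connection coefficient needs the limit in
  \<open>c\<close>. Once \<open>Re (c - a - b) > 0\<close>, the second solution at
  \<open>w = 1\<close> vanishes there, and the boundary value of F reads off the first coefficient.
  The other one follows from Euler's transformation, which interchanges the two solutions. Since
  \<open>hyp2F1\<close>, \<open>hyp2F1_reg\<close> and \<open>ferrers_Q\<close> are chosen by
  \<open>SOME\<close>, nothing is known about them until an extension is exhibited. This is why F
  has to be continued to the slit plane explicitly, and why the right-hand side of the formula is
  first shown to be holomorphic on \<open>D1\<close>.\<close>

lemma conv_radius_ge_1_if_ratio_bound:
  fixes T :: "nat \<Rightarrow> complex" and M :: "nat \<Rightarrow> real"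
  assumes "\<And>n. norm (T n) \<le> M n"
    and ratio: "\<And>R. R > 1 \<Longrightarrow> eventually (\<lambda>n. M (Suc n) \<le> R * M n) sequentially"
  shows "conv_radius T \<ge> 1"
proof (rule conv_radius_geI_ex')
  fix r :: real assume r: "0 < r" "ereal r < 1"
  then have r1: "r < 1" by simp
  have Mnn: "M n \<ge> 0" for n
    using assms(1)[of n] norm_ge_zero order_trans by blast
  \<comment> \<open>Halfway between 1 and \<open>1 / r\<close>, so that \<open>R > 1\<close> while
    \<open>R * r < 1\<close>.\<close>
  define R where "R = (1 + 1 / r) / 2"
  have R: "R > 1" "R * r < 1"
    using r r1 by (auto simp: R_def field_simps)
  from ratio[OF R(1)] obtain N where N: "\<And>n. n \<ge> N \<Longrightarrow> M (Suc n) \<le> R * M n"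
    by (auto simp: eventually_sequentially)
  have "summable (\<lambda>n. M n * r ^ n)"
  proof (rule summable_ratio_test[of "R * r" N])
    fix n assume "n \<ge> N"
    then have "M (Suc n) * r ^ Suc n \<le> (R * M n) * r ^ Suc n"
      using N r by (intro mult_right_mono) auto
    then show "norm (M (Suc n) * r ^ Suc n) \<le> R * r * norm (M n * r ^ n)"
      using Mnn r by (simp add: mult_ac abs_mult)
  qed (use R in auto)
  then show "summable (\<lambda>n. T n * of_real r ^ n)"
    by (rule summable_comparison_test'[where N = 0])
       (use assms(1) r in \<open>auto simp: norm_mult norm_power intro!: mult_right_mono\<close>)
qed

definition hgf_fps :: "complex \<Rightarrow> complex \<Rightarrow> complex \<Rightarrow> complex fps" where
  "hgf_fps a b c = Abs_fps (\<lambda>n. pochhammer a n * pochhammer b n * rGamma (c + of_nat n) / fact n)"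

abbreviation hgf :: "complex \<Rightarrow> complex \<Rightarrow> complex \<Rightarrow> complex \<Rightarrow> complex" where
  "hgf a b c \<equiv> eval_fps (hgf_fps a b c)"

text \<open>Kept free of division: where \<open>c + n = 0\<close>, both sides vanish and the
  recurrence does not determine the next coefficient.\<close>

lemma hgf_fps_Suc:
  "of_nat (Suc n) * (c + of_nat n) * fps_nth (hgf_fps a b c) (Suc n) =
   (a + of_nat n) * (b + of_nat n) * fps_nth (hgf_fps a b c) n"
proof -
  have "rGamma (c + of_nat n) = (c + of_nat n) * rGamma (c + of_nat (Suc n))"
    using rGamma_plus1[of "c + of_nat n"] by (simp add: add_ac)
  then show ?thesis
    by (simp add: hgf_fps_def pochhammer_Suc field_simps del: of_nat_Suc)
qed

text \<open>The ratio of consecutive coefficients has an upper bound tending to 1. Only an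
  inequality can hold, since the series terminates when \<open>a\<close> or \<open>b\<close> is a
  nonpositive integer.\<close>

lemma fps_conv_radius_hgf: "fps_conv_radius (hgf_fps a b c) \<ge> 1"
  unfolding fps_conv_radius_def
proof (rule conv_radius_ge_1_if_ratio_bound)
  fix R :: real assume "R > 1"
  let ?g = "fps_nth (hgf_fps a b c)"
  have "(\<lambda>n. (norm a + real n) * (norm b + real n) / ((real n - norm c) * real (Suc n))) \<longlonglongrightarrow> 1"
    by real_asymp
  from order_tendstoD(2)[OF this \<open>R > 1\<close>]
  have "eventually (\<lambda>n. (norm a + real n) * (norm b + real n) / ((real n - norm c) * real (Suc n)) < R) sequentially" .
  moreover have "eventually (\<lambda>n. real n > norm c) sequentially"
    by real_asymp
  ultimately show "eventually (\<lambda>n. norm (?g (Suc n)) \<le> R * norm (?g n)) sequentially"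
  proof eventually_elim
    case (elim n)
    have pos: "(real n - norm c) * real (Suc n) > 0"
      using elim by (intro mult_pos_pos) auto
    have cn: "norm (c + of_nat n) \<ge> real n - norm c"
      using norm_triangle_ineq2[of "of_nat n" "- c"] by (simp add: add_ac)
    have "((real n - norm c) * real (Suc n)) * norm (?g (Suc n))
        \<le> (norm (c + of_nat n) * real (Suc n)) * norm (?g (Suc n))"
      using cn by (intro mult_right_mono) auto
    also have "\<dots> = norm (of_nat (Suc n) * (c + of_nat n) * ?g (Suc n))"
      by (simp add: norm_mult mult_ac del: of_nat_Suc)
    also have "\<dots> = norm (a + of_nat n) * norm (b + of_nat n) * norm (?g n)"
      by (simp only: hgf_fps_Suc norm_mult)
    also have "\<dots> \<le> (norm a + real n) * (norm b + real n) * norm (?g n)"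
      using norm_triangle_ineq[of a "of_nat n"] norm_triangle_ineq[of b "of_nat n"]
      by (intro mult_right_mono mult_mono) auto
    also have "\<dots> \<le> (R * ((real n - norm c) * real (Suc n))) * norm (?g n)"
      using elim pos by (intro mult_right_mono) (auto simp: pos_divide_less_eq)
    also have "\<dots> = ((real n - norm c) * real (Suc n)) * (R * norm (?g n))"
      by (simp add: mult_ac)
    finally show ?case
      using pos by (simp only: mult_le_cancel_left_pos)
  qed
qed simp

lemma fps_conv_radius_deriv_ge: "fps_conv_radius (F :: complex fps) \<ge> r \<Longrightarrow> fps_conv_radius (fps_deriv F) \<ge> r"
  using fps_conv_radius_deriv[of F] order_trans by blast

lemma fps_conv_radius_mult_ge:
  fixes F G :: "complex fps"
  shows "fps_conv_radius F \<ge> r \<Longrightarrow> fps_conv_radius G \<ge> r \<Longrightarrow> fps_conv_radius (F * G) \<ge> r"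
  using fps_conv_radius_mult[of F G] by (metis min_le_iff_disj order_trans min.bounded_iff)

lemma hgf_deriv:
  assumes "norm w < 1"
  shows "(hgf a b c has_field_derivative eval_fps (fps_deriv (hgf_fps a b c)) w) (at w)"
    and "(eval_fps (fps_deriv (hgf_fps a b c)) has_field_derivative
           eval_fps (fps_deriv (fps_deriv (hgf_fps a b c))) w) (at w)"
proof -
  have "ereal (norm w) < 1" using assms by (simp add: one_ereal_def)
  then have "ereal (norm w) < fps_conv_radius (hgf_fps a b c)"
    "ereal (norm w) < fps_conv_radius (fps_deriv (hgf_fps a b c))"
    using fps_conv_radius_hgf[of a b c] fps_conv_radius_deriv_ge[OF fps_conv_radius_hgf[of a b c]]
    by order+
  then show "(hgf a b c has_field_derivative eval_fps (fps_deriv (hgf_fps a b c)) w) (at w)"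
    "(eval_fps (fps_deriv (hgf_fps a b c)) has_field_derivative
           eval_fps (fps_deriv (fps_deriv (hgf_fps a b c))) w) (at w)"
    by (auto intro!: has_field_derivative_eval_fps)
qed

lemma hgf_holomorphic: "hgf a b c holomorphic_on ball 0 1"
  by (subst holomorphic_on_open) (use hgf_deriv(1) in force)+

lemma hgf_0: "hgf a b c 0 = rGamma c"
  by (simp add: eval_fps_at_0 hgf_fps_def)

text \<open>Gauss's equation. The derivatives are explicit arguments, so that a substitution
  transforms the triple by a formula and the equation becomes an algebraic identity.\<close>

definition hgf_solution ::
    "complex \<Rightarrow> complex \<Rightarrow> complex \<Rightarrow> (complex \<Rightarrow> complex) \<Rightarrow> (complex \<Rightarrow> complex)
      \<Rightarrow> (complex \<Rightarrow> complex) \<Rightarrow> complex set \<Rightarrow> bool" where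
  "hgf_solution a b c f f' f'' S \<longleftrightarrow>
     (\<forall>w\<in>S. (f has_field_derivative f' w) (at w) \<and> (f' has_field_derivative f'' w) (at w) \<and>
        w * (1 - w) * f'' w + (c - (a + b + 1) * w) * f' w - a * b * f w = 0)"

lemma hgf_solution_subset:
  "hgf_solution a b c f f' f'' S \<Longrightarrow> T \<subseteq> S \<Longrightarrow> hgf_solution a b c f f' f'' T"
  unfolding hgf_solution_def by blast

text \<open>The coefficient recurrence in differential form. The factor \<open>w * (1 - w)\<close>
  is expanded into nested multiplications by \<open>fps_X\<close>, so that every coefficient is a
  mere shift.\<close>

lemma hgf_fps_ode:
  fixes a b c :: complex
  defines "g \<equiv> hgf_fps a b c"
  shows "fps_X * fps_deriv (fps_deriv g) - fps_X * (fps_X * fps_deriv (fps_deriv g))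
         + (fps_const c * fps_deriv g - fps_const (a + b + 1) * (fps_X * fps_deriv g))
         - fps_const (a * b) * g = 0"
proof (rule fps_ext)
  fix n
  show "fps_nth (fps_X * fps_deriv (fps_deriv g) - fps_X * (fps_X * fps_deriv (fps_deriv g))
         + (fps_const c * fps_deriv g - fps_const (a + b + 1) * (fps_X * fps_deriv g))
         - fps_const (a * b) * g) n = fps_nth 0 n"
    using hgf_fps_Suc[of n c a b] unfolding g_def[symmetric]
    by (cases n; cases "n - 1") (auto simp: algebra_simps)
qed

lemma hgf_solution_hgf:
  "hgf_solution a b c (hgf a b c) (eval_fps (fps_deriv (hgf_fps a b c)))
      (eval_fps (fps_deriv (fps_deriv (hgf_fps a b c)))) (ball 0 1)"
  unfolding hgf_solution_def
proof (intro ballI conjI)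
  fix w :: complex assume "w \<in> ball 0 1"
  then have w: "norm w < 1" and w': "ereal (norm w) < 1"
    by (auto simp: one_ereal_def)
  let ?g = "hgf_fps a b c"
  show "(hgf a b c has_field_derivative eval_fps (fps_deriv ?g) w) (at w)"
    "(eval_fps (fps_deriv ?g) has_field_derivative eval_fps (fps_deriv (fps_deriv ?g)) w) (at w)"
    using hgf_deriv[OF w] by auto
  have g: "fps_conv_radius ?g \<ge> 1" "fps_conv_radius (fps_deriv ?g) \<ge> 1"
    "fps_conv_radius (fps_deriv (fps_deriv ?g)) \<ge> 1"
    by (intro fps_conv_radius_deriv_ge fps_conv_radius_hgf)+
  have conv: "ereal (norm w) < fps_conv_radius F" if "fps_conv_radius F \<ge> 1" for F :: "complex fps"
    using that w' by order
  have add: "fps_conv_radius (F + G) \<ge> 1" "fps_conv_radius (F - G) \<ge> 1"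
    if "fps_conv_radius F \<ge> 1" "fps_conv_radius G \<ge> 1" for F G :: "complex fps"
    using fps_conv_radius_add[of F G] fps_conv_radius_diff[of F G] that
    by (metis min.bounded_iff order_trans)+
  let ?E = "fps_X * fps_deriv (fps_deriv ?g) - fps_X * (fps_X * fps_deriv (fps_deriv ?g))
         + (fps_const c * fps_deriv ?g - fps_const (a + b + 1) * (fps_X * fps_deriv ?g))
         - fps_const (a * b) * ?g"
  have "eval_fps ?E w = 0"
    unfolding hgf_fps_ode by simp
  also have "eval_fps ?E w = w * eval_fps (fps_deriv (fps_deriv ?g)) w
      - w * (w * eval_fps (fps_deriv (fps_deriv ?g)) w)
      + (c * eval_fps (fps_deriv ?g) w - (a + b + 1) * (w * eval_fps (fps_deriv ?g) w))
      - a * b * eval_fps ?g w"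
    using g by (simp add: eval_fps_add eval_fps_diff eval_fps_mult conv add
                  fps_conv_radius_mult_ge del: fps_const_add fps_const_mult)
  finally show "w * (1 - w) * eval_fps (fps_deriv (fps_deriv ?g)) w
     + (c - (a + b + 1) * w) * eval_fps (fps_deriv ?g) w - a * b * eval_fps ?g w = 0"
    by (simp add: algebra_simps)
qed

text \<open>On coefficients this is \<open>rGamma (c + n) = (c + n) * rGamma (c + 1 + n)\<close>:
  with the regularized normalization, \<open>c + w d/dw\<close> lowers \<open>c\<close> without a
  constant factor.\<close>

lemma hgf_shift:
  assumes "norm w < 1"
  shows "hgf a b c w = c * hgf a b (c + 1) w + w * eval_fps (fps_deriv (hgf_fps a b (c + 1))) w"
proof -
  have w': "ereal (norm w) < 1" using assms by (simp add: one_ereal_def)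
  let ?g = "hgf_fps a b (c + 1)"
  have g: "fps_conv_radius ?g \<ge> 1" "fps_conv_radius (fps_deriv ?g) \<ge> 1"
    by (intro fps_conv_radius_deriv_ge fps_conv_radius_hgf)+
  have conv: "ereal (norm w) < fps_conv_radius F" if "fps_conv_radius F \<ge> 1" for F :: "complex fps"
    using that w' by order
  have "hgf_fps a b c = fps_const c * ?g + fps_X * fps_deriv ?g"
  proof (rule fps_ext)
    fix n
    have "rGamma (c + of_nat n) = (c + of_nat n) * rGamma (c + 1 + of_nat n)"
      using rGamma_plus1[of "c + of_nat n"] by (simp add: add_ac)
    then show "fps_nth (hgf_fps a b c) n = fps_nth (fps_const c * ?g + fps_X * fps_deriv ?g) n"
      by (cases n) (auto simp: hgf_fps_def field_simps simp del: of_nat_Suc)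
  qed
  then show ?thesis
    using g by (simp add: eval_fps_add eval_fps_mult conv fps_conv_radius_mult_ge)
qed

text \<open>The Taylor coefficients of a solution regular at 0 obey the recurrence, whose factor
  \<open>c + n\<close> never vanishes here, so \<open>f 0\<close> determines them all.
  \<open>Gamma c\<close> compensates for the value \<open>rGamma c\<close> of the regularized series
  at 0.\<close>

lemma hgf_solution_unique:
  assumes sol: "hgf_solution a b c f f' f'' (ball 0 r)" and r: "r > 0"
    and c: "c \<notin> \<int>\<^sub>\<le>\<^sub>0" and w: "norm w < r"
  shows "f w = eval_fps (fps_const (f 0 * Gamma c) * hgf_fps a b c) w"
proof -
  let ?F = "fps_expansion f 0"
  have hol: "f holomorphic_on ball 0 r" "f' holomorphic_on ball 0 r"
    using sol by (auto simp: hgf_solution_def holomorphic_on_open)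
  have exp: "f has_fps_expansion ?F"
    using hol r by (intro has_fps_expansion_fps_expansion[of "ball 0 r"]) auto
  have ev: "eventually (\<lambda>w. w \<in> ball 0 r) (nhds 0)"
    using r by (intro eventually_nhds_in_open) auto
  have f': "deriv f w = f' w" "deriv f' w = f'' w" if "w \<in> ball 0 r" for w
    using sol that by (auto simp: hgf_solution_def intro: DERIV_imp_deriv)
  have exp': "f' has_fps_expansion fps_deriv ?F"
    using has_fps_expansion_deriv[OF exp]
    by (rule has_fps_expansion_cong[THEN iffD1, rotated 2])
       (use ev f' in \<open>auto elim!: eventually_mono\<close>)
  have exp'': "f'' has_fps_expansion fps_deriv (fps_deriv ?F)"
    using has_fps_expansion_deriv[OF exp']
    by (rule has_fps_expansion_cong[THEN iffD1, rotated 2])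
       (use ev f' in \<open>auto elim!: eventually_mono\<close>)
  have "(\<lambda>w. w * (1 - w) * f'' w + (c - (a + b + 1) * w) * f' w - a * b * f w) has_fps_expansion
     (fps_X * (1 - fps_X) * fps_deriv (fps_deriv ?F)
       + (fps_const c - fps_const (a + b + 1) * fps_X) * fps_deriv ?F - fps_const (a * b) * ?F)"
    by (intro fps_expansion_intros exp exp' exp'')
  moreover have "(\<lambda>w. w * (1 - w) * f'' w + (c - (a + b + 1) * w) * f' w - a * b * f w) has_fps_expansion 0"
    unfolding has_fps_expansion_0_iff
    using ev by eventually_elim (use sol in \<open>auto simp: hgf_solution_def\<close>)
  ultimately have E: "fps_X * (1 - fps_X) * fps_deriv (fps_deriv ?F)
       + (fps_const c - fps_const (a + b + 1) * fps_X) * fps_deriv ?F - fps_const (a * b) * ?F = 0"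
    by (rule fps_expansion_unique_complex)
  have rec: "of_nat (Suc n) * (c + of_nat n) * fps_nth ?F (Suc n) =
      (a + of_nat n) * (b + of_nat n) * fps_nth ?F n" for n
  proof -
    have *: "fps_X * (1 - fps_X) * D2 + (fps_const c - fps_const (a + b + 1) * fps_X) * D1 - fps_const (a * b) * F
      = fps_X * D2 - fps_X * (fps_X * D2)
         + (fps_const c * D1 - fps_const (a + b + 1) * (fps_X * D1))
         - fps_const (a * b) * F" for D2 D1 F :: "complex fps"
      by (simp add: algebra_simps)
    show ?thesis
      using E[unfolded *, THEN arg_cong, of "\<lambda>F. fps_nth F n"]
      by (cases n; cases "n - 1") (auto simp: algebra_simps)
  qed
  have "?F = fps_const (f 0 * Gamma c) * hgf_fps a b c"
  proof (rule fps_ext)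
    fix n
    show "fps_nth ?F n = fps_nth (fps_const (f 0 * Gamma c) * hgf_fps a b c) n"
    proof (induction n)
      case 0
      have "Gamma c * rGamma c = 1"
        using c by (simp add: Gamma_def rGamma_eq_zero_iff)
      then show ?case by (simp add: fps_expansion_def hgf_fps_def)
    next
      case (Suc n)
      have nz: "of_nat (Suc n) * (c + of_nat n) \<noteq> 0"
        using c plus_of_nat_eq_0_imp[of c n] by (auto simp del: of_nat_Suc)
      have "of_nat (Suc n) * (c + of_nat n) * fps_nth ?F (Suc n) = 
         of_nat (Suc n) * (c + of_nat n) * fps_nth (fps_const (f 0 * Gamma c) * hgf_fps a b c) (Suc n)"
        unfolding rec Suc fps_mult_left_const_nth
        using hgf_fps_Suc[of n c a b] by (simp add: mult_ac)
      then show ?case using nz by (metis mult_cancel_left)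
    qed
  qed
  then show ?thesis
    using has_fps_expansion_imp_eval_fps_eq[OF exp w hol(1)] by simp
qed

section \<open>Transformations and fundamental systems\<close>

lemma hgf_fps_commute: "hgf_fps a b c = hgf_fps b a c"
  by (simp add: hgf_fps_def mult.commute)

lemma hgf_solution_unique_unit_ball:
  assumes "hgf_solution a b c f f' f'' (ball 0 r)" "r > 0" "c \<notin> \<int>\<^sub>\<le>\<^sub>0" "norm w < r" "norm w < 1"
  shows "f w = f 0 * Gamma c * hgf a b c w"
proof -
  have "ereal (norm w) < 1" using assms by (simp add: one_ereal_def)
  then have "ereal (norm w) < fps_conv_radius (hgf_fps a b c)"
    using fps_conv_radius_hgf[of a b c] by order
  then show ?thesis
    using hgf_solution_unique[OF assms(1-4)] by (simp add: eval_fps_mult)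
qed

text \<open>The substitution \<open>1 - w\<close> exchanges the singular points 0 and 1 together
  with their exponents.\<close>

lemma hgf_solution_reflect:
  assumes "hgf_solution a b c f f' f'' S" "\<And>w. w \<in> T \<Longrightarrow> 1 - w \<in> S" "c' = a + b + 1 - c"
  shows "hgf_solution a b c' (\<lambda>w. f (1 - w)) (\<lambda>w. - f' (1 - w)) (\<lambda>w. f'' (1 - w)) T"
  unfolding hgf_solution_def
proof (intro ballI conjI)
  fix w assume "w \<in> T"
  then have *: "(f has_field_derivative f' (1 - w)) (at (1 - w))"
    "(f' has_field_derivative f'' (1 - w)) (at (1 - w))"
    "(1 - w) * (1 - (1 - w)) * f'' (1 - w) + (c - (a + b + 1) * (1 - w)) * f' (1 - w) - a * b * f (1 - w) = 0"
    using assms unfolding hgf_solution_def by blast+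
  have d: "((\<lambda>w. 1 - w) has_field_derivative -1) (at w)"
    by (auto intro!: derivative_eq_intros)
  show "((\<lambda>w. f (1 - w)) has_field_derivative - f' (1 - w)) (at w)"
    "((\<lambda>w. - f' (1 - w)) has_field_derivative f'' (1 - w)) (at w)"
    using DERIV_chain2[OF *(1) d] DERIV_minus[OF DERIV_chain2[OF *(2) d]] by simp_all
  show "w * (1 - w) * f'' (1 - w) + (c' - (a + b + 1) * w) * - f' (1 - w) - a * b * f (1 - w) = 0"
    using *(3) unfolding assms(3) by (simp add: algebra_simps)
qed

text \<open>The multiplier \<open>w powr (1 - c)\<close> realizes the second exponent at 0. Both
  derivatives are written with the lowest power \<open>w powr (-c - 1)\<close> pulled out, which
  leaves polynomial identities.\<close>

lemma hgf_solution_powr_mult: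
  assumes "hgf_solution (a - c + 1) (b - c + 1) (2 - c) g g' g'' S"
    and S: "\<And>w. w \<in> S \<Longrightarrow> Re w > 0"
  shows "hgf_solution a b c (\<lambda>w. w powr (1 - c) * g w)
     (\<lambda>w. w powr (-c - 1) * ((1 - c) * w * g w + w\<^sup>2 * g' w))
     (\<lambda>w. w powr (-c - 1) * ((1 - c) * (-c) * g w + 2 * (1 - c) * w * g' w + w\<^sup>2 * g'' w)) S"
  unfolding hgf_solution_def
proof (intro ballI conjI)
  fix w assume w: "w \<in> S"
  then have *: "(g has_field_derivative g' w) (at w)"
    "(g' has_field_derivative g'' w) (at w)"
    "w * (1 - w) * g'' w + ((2 - c) - ((a - c + 1) + (b - c + 1) + 1) * w) * g' w
       - (a - c + 1) * (b - c + 1) * g w = 0"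
    using assms unfolding hgf_solution_def by blast+
  have w0: "w \<noteq> 0" "w \<notin> \<real>\<^sub>\<le>\<^sub>0"
    using S[OF w] by (auto simp: complex_nonpos_Reals_iff)
  define P where "P = w powr (-c - 1)"
  have P: "w powr (1 - c) = w\<^sup>2 * P" "w powr (-c) = w * P"
  proof -
    have "w powr (1 - c) = w powr (2 + (-c - 1))" by simp
    also have "\<dots> = w powr 2 * P" unfolding P_def by (rule powr_add)
    finally show "w powr (1 - c) = w\<^sup>2 * P" using w0 powr_nat'[of w 2] by simp
    have "w powr (- c) = w powr (1 + (-c - 1))" by simp
    also have "\<dots> = w powr 1 * P" unfolding P_def by (rule powr_add)
    finally show "w powr (-c) = w * P" using w0 by simp
  qed
  have P': "w powr (-c - 2) * w = P"
  proof -
    have "w powr ((-c - 2) + 1) = w powr (-c - 2) * w"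
      by (simp only: powr_add) (use w0 in simp)
    moreover have "(-c - 2) + 1 = -c - 1" by simp
    ultimately show ?thesis by (simp only: P_def)
  qed
  have d1: "((\<lambda>w. w powr (1 - c)) has_field_derivative (1 - c) * (w * P)) (at w)"
    using has_field_derivative_powr[OF w0(2), of "1 - c"] P by simp
  have d2: "((\<lambda>w. w powr (-c - 1)) has_field_derivative (-c - 1) * w powr (-c - 2)) (at w)"
  proof -
    have "(-c - 1) - 1 = -c - 2" by simp
    then show ?thesis
      using has_field_derivative_powr[OF w0(2), of "-c - 1"] by (simp only:)
  qed
  show "((\<lambda>w. w powr (1 - c) * g w) has_field_derivative
      w powr (-c - 1) * ((1 - c) * w * g w + w\<^sup>2 * g' w)) (at w)"
    by (rule DERIV_cong[OF DERIV_mult[OF d1 *(1)]])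
       (simp add: P P_def[symmetric] power2_eq_square algebra_simps)
  show "((\<lambda>w. w powr (-c - 1) * ((1 - c) * w * g w + w\<^sup>2 * g' w)) has_field_derivative
      w powr (-c - 1) * ((1 - c) * (-c) * g w + 2 * (1 - c) * w * g' w + w\<^sup>2 * g'' w)) (at w)"
    by (rule DERIV_cong[OF DERIV_mult[OF d2 DERIV_add[OF
            DERIV_mult[OF DERIV_cmult[OF DERIV_ident] *(1)] DERIV_mult[OF DERIV_power[OF DERIV_ident, of 2] *(2)]]]])
       (simp add: P_def[symmetric] P'[symmetric] power2_eq_square algebra_simps)
  have "w * (1 - w) * (w powr (-c - 1) * ((1 - c) * (-c) * g w + 2 * (1 - c) * w * g' w + w\<^sup>2 * g'' w))
     + (c - (a + b + 1) * w) * (w powr (-c - 1) * ((1 - c) * w * g w + w\<^sup>2 * g' w))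
     - a * b * (w powr (1 - c) * g w)
     = P * w\<^sup>2 * (w * (1 - w) * g'' w + ((2 - c) - ((a - c + 1) + (b - c + 1) + 1) * w) * g' w
       - (a - c + 1) * (b - c + 1) * g w)"
    unfolding P P_def[symmetric] by (simp add: algebra_simps power2_eq_square)
  then show "w * (1 - w) * (w powr (-c - 1) * ((1 - c) * (-c) * g w + 2 * (1 - c) * w * g' w + w\<^sup>2 * g'' w))
     + (c - (a + b + 1) * w) * (w powr (-c - 1) * ((1 - c) * w * g w + w\<^sup>2 * g' w))
     - a * b * (w powr (1 - c) * g w) = 0"
    using *(3) by simp
qed

text \<open>The multiplier at the singular point 1 is the one at 0 conjugated by the reflection. On
  the way \<open>a\<close> and \<open>b\<close> change places, which the symmetry of the equation
  undoes.\<close>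

lemma hgf_solution_euler:
  assumes "hgf_solution (c - a) (c - b) c g g' g'' S" and S: "\<And>w. w \<in> S \<Longrightarrow> Re w < 1"
  shows "\<exists>h' h''. hgf_solution a b c (\<lambda>w. (1 - w) powr (c - a - b) * g w) h' h'' S"
proof -
  let ?T = "{w. 1 - w \<in> S}"
  have "hgf_solution (c - a) (c - b) (c - a - b + 1)
          (\<lambda>w. g (1 - w)) (\<lambda>w. - g' (1 - w)) (\<lambda>w. g'' (1 - w)) ?T"
    by (rule hgf_solution_reflect[OF assms(1)]) auto
  then have "hgf_solution (b - (a + b + 1 - c) + 1) (a - (a + b + 1 - c) + 1) (2 - (a + b + 1 - c))
          (\<lambda>w. g (1 - w)) (\<lambda>w. - g' (1 - w)) (\<lambda>w. g'' (1 - w)) ?T"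
    by (simp add: algebra_simps)
  from hgf_solution_powr_mult[OF this] S
  obtain k' k'' where "hgf_solution b a (a + b + 1 - c) (\<lambda>w. w powr (1 - (a + b + 1 - c)) * g (1 - w)) k' k'' ?T"
    by fastforce
  then have "hgf_solution b a c (\<lambda>w. (1 - w) powr (1 - (a + b + 1 - c)) * g (1 - (1 - w)))
     (\<lambda>w. - k' (1 - w)) (\<lambda>w. k'' (1 - w)) S"
    by (rule hgf_solution_reflect) auto
  then show ?thesis
    unfolding hgf_solution_def by (intro exI[of _ "\<lambda>w. - k' (1 - w)"] exI[of _ "\<lambda>w. k'' (1 - w)"])
      (simp add: algebra_simps)
qed

text \<open>Euler's transformation: both sides solve the same equation, are regular at 0 and have
  the value \<open>rGamma c\<close> there.\<close>

lemma hgf_euler: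
  assumes c: "c \<notin> \<int>\<^sub>\<le>\<^sub>0" and w: "norm w < 1"
  shows "(1 - w) powr (c - a - b) * hgf (c - a) (c - b) c w = hgf a b c w"
proof -
  have "Re w < 1" if "w \<in> ball 0 1" for w :: complex
    using that complex_Re_le_cmod[of w] by simp
  from hgf_solution_euler[OF hgf_solution_hgf this] obtain h' h'' where
    "hgf_solution a b c (\<lambda>w. (1 - w) powr (c - a - b) * hgf (c - a) (c - b) c w) h' h'' (ball 0 1)"
    by blast
  from hgf_solution_unique_unit_ball[OF this _ c w w] show ?thesis
    using c by (simp add: hgf_0 Gamma_def rGamma_eq_zero_iff)
qed

section \<open>Wronskians on the common domain of the expansions at 0 and 1\<close>

text \<open>The series at 0 and those at 1 all converge here. Convexity makes a function with zero
  derivative constant, and \<open>0 < Re w < 1\<close> keeps the powers of \<open>w\<close> and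
  \<open>1 - w\<close> off their branch cuts.\<close>

definition lens :: "complex set" where
  "lens = ball 0 1 \<inter> ball 1 1"

lemma lens_memD:
  assumes "w \<in> lens"
  shows "norm w < 1" "norm (1 - w) < 1" "Re w > 0" "Re w < 1" "1 - w \<in> lens"
  using assms complex_Re_le_cmod[of w] complex_Re_le_cmod[of "1 - w"]
  by (auto simp: lens_def dist_norm norm_minus_commute)

lemma open_lens: "open lens" and convex_lens: "convex lens"
  by (auto simp: lens_def intro: convex_Int)

text \<open>Abel's identity: \<open>w powr c * (1 - w) powr (a + b + 1 - c)\<close> is the
  integrating factor of the first-order equation for the Wronskian.\<close>

lemma wronskian_const:
  assumes f: "hgf_solution a b c f f' f'' lens" and g: "hgf_solution a b c g g' g'' lens"
  shows "\<exists>K. \<forall>w\<in>lens. (f w * g' w - f' w * g w) * (w powr c * (1 - w) powr (a + b + 1 - c)) = K"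
proof -
  let ?d = "a + b + 1 - c"
  let ?W = "\<lambda>w. (f w * g' w - f' w * g w) * (w powr c * (1 - w) powr ?d)"
  show "\<exists>K. \<forall>w\<in>lens. ?W w = K"
  proof (rule has_field_derivative_zero_constant[OF convex_lens])
    fix w assume w: "w \<in> lens"
    have F: "(f has_field_derivative f' w) (at w)" "(f' has_field_derivative f'' w) (at w)"
        "w * (1 - w) * f'' w + (c - (a + b + 1) * w) * f' w - a * b * f w = 0"
      and G: "(g has_field_derivative g' w) (at w)" "(g' has_field_derivative g'' w) (at w)"
        "w * (1 - w) * g'' w + (c - (a + b + 1) * w) * g' w - a * b * g w = 0"
      using f g w by (auto simp: hgf_solution_def)
    have w': "w \<notin> \<real>\<^sub>\<le>\<^sub>0" "1 - w \<notin> \<real>\<^sub>\<le>\<^sub>0" "w \<noteq> 0" "1 - w \<noteq> 0"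
      using lens_memD[OF w] by (auto simp: complex_nonpos_Reals_iff)
    define P where "P = w powr (c - 1)"
    define Q where "Q = (1 - w) powr (?d - 1)"
    have PQ: "w powr c = w * P" "(1 - w) powr ?d = (1 - w) * Q"
    proof -
      have "w powr ((c - 1) + 1) = w powr (c - 1) * w"
        "(1 - w) powr ((?d - 1) + 1) = (1 - w) powr (?d - 1) * (1 - w)"
        by (simp_all only: powr_add) (use w' in simp_all)
      moreover have "(c - 1) + 1 = c" "(?d - 1) + 1 = ?d" by simp_all
      ultimately show "w powr c = w * P" "(1 - w) powr ?d = (1 - w) * Q"
        by (simp_all only: P_def Q_def mult.commute)
    qed
    have dP: "((\<lambda>w. w powr c) has_field_derivative c * P) (at w)"
      unfolding P_def by (rule has_field_derivative_powr[OF w'(1)])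
    have dQ: "((\<lambda>w. (1 - w) powr ?d) has_field_derivative - (?d * Q)) (at w)"
    proof -
      have "((\<lambda>w. 1 - w) has_field_derivative -1) (at w)"
        by (auto intro!: derivative_eq_intros)
      from DERIV_chain2[OF has_field_derivative_powr[OF w'(2), of ?d] this]
      show ?thesis by (simp add: Q_def)
    qed
    have "(?W has_field_derivative (f w * g'' w - f'' w * g w) * (w * P * ((1 - w) * Q))
       + (f w * g' w - f' w * g w) * (c * P * ((1 - w) * Q) - w * P * (?d * Q))) (at w)"
      by (rule DERIV_cong[OF DERIV_mult[OF DERIV_diff[OF DERIV_mult[OF F(1) G(2)] DERIV_mult[OF F(2) G(1)]]
             DERIV_mult[OF dP dQ]]])
         (simp only: PQ, simp add: algebra_simps)
    also have "(f w * g'' w - f'' w * g w) * (w * P * ((1 - w) * Q))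
       + (f w * g' w - f' w * g w) * (c * P * ((1 - w) * Q) - w * P * (?d * Q))
       = P * Q * (f w * (w * (1 - w) * g'' w + (c - (a + b + 1) * w) * g' w - a * b * g w)
           - g w * (w * (1 - w) * f'' w + (c - (a + b + 1) * w) * f' w - a * b * f w))"
      by (simp add: algebra_simps)
    also have "\<dots> = 0" using F(3) G(3) by simp
    finally show "(?W has_field_derivative 0) (at w within lens)"
      by (rule DERIV_subset) auto
  qed
qed

text \<open>Limits at the boundary point 1, taken inside the lens, are therefore unique.\<close>

lemma at_1_within_lens: "at 1 within lens \<noteq> bot"
proof -
  have "1 islimpt lens"
  proof (rule islimptI)
    fix T :: "complex set" assume "1 \<in> T" "open T"
    then obtain e where e: "e > 0" "ball 1 e \<subseteq> T" by (auto simp: open_contains_ball)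
    define d where "d = min (e / 2) (1 / 2)"
    have d: "d > 0" "d < e" "d \<le> 1 / 2" using e by (auto simp: d_def min_def)
    have "norm (1 - complex_of_real d) = 1 - d"
      using d by (metis abs_of_nonneg diff_ge_0_iff_ge field_sum_of_halves
          half_gt_zero_iff le_add_same_cancel2 less_eq_real_def norm_of_real of_real_1 of_real_diff
          order_trans)
    then show "\<exists>y\<in>lens. y \<in> T \<and> y \<noteq> 1"
      using d e by (intro bexI[of _ "1 - complex_of_real d"]) (auto simp: lens_def dist_norm norm_minus_commute)
  qed
  then show ?thesis by (simp add: trivial_limit_within)
qed

text \<open>\<open>hgf1\<close> and \<open>hgf2\<close> are the regularized local solutions at
  \<open>w = 1\<close> with exponents 0 and \<open>c - a - b\<close>.\<close>

definition hgf1 :: "complex \<Rightarrow> complex \<Rightarrow> complex \<Rightarrow> complex \<Rightarrow> complex" where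
  "hgf1 a b c w = hgf a b (a + b - c + 1) (1 - w)"

definition hgf2 :: "complex \<Rightarrow> complex \<Rightarrow> complex \<Rightarrow> complex \<Rightarrow> complex" where
  "hgf2 a b c w = (1 - w) powr (c - a - b) * hgf (c - a) (c - b) (c - a - b + 1) (1 - w)"

text \<open>The constant of Abel's identity is computed by letting \<open>w\<close> tend to 1. It is
  \<open>- (s * rGamma (1 - s) * rGamma (1 + s))\<close> with \<open>s = c - a - b\<close>, and
  vanishes for no noninteger \<open>s\<close>.\<close>

lemma fundamental_system:
  assumes s: "c - a - b \<notin> \<int>"
  obtains f1' f1'' f2' f2'' where
    "hgf_solution a b c (hgf1 a b c) f1' f1'' lens"
    "hgf_solution a b c (hgf2 a b c) f2' f2'' lens"
    "\<And>w. w \<in> lens \<Longrightarrow> hgf1 a b c w * f2' w - f1' w * hgf2 a b c w \<noteq> 0"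
proof -
  define s where "s = c - a - b"
  have sub: "hgf_solution a b c f f' f'' lens" if "hgf_solution a b c f f' f'' (ball 1 1)" for a b c f f' f''
    using that by (rule hgf_solution_subset) (auto simp: lens_def)
  define G where "G = hgf a b (1 - s)"
  define G' where "G' = eval_fps (fps_deriv (hgf_fps a b (1 - s)))"
  define G'' where "G'' = eval_fps (fps_deriv (fps_deriv (hgf_fps a b (1 - s))))"
  define K where "K = hgf (c - a) (c - b) (1 + s)"
  define K' where "K' = eval_fps (fps_deriv (hgf_fps (c - a) (c - b) (1 + s)))"
  define K'' where "K'' = eval_fps (fps_deriv (fps_deriv (hgf_fps (c - a) (c - b) (1 + s))))"
  have G: "hgf_solution a b (1 - s) G G' G'' (ball 0 1)"
    unfolding G_def G'_def G''_def by (rule hgf_solution_hgf)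
  have K: "hgf_solution (c - a) (c - b) (1 + s) K K' K'' (ball 0 1)"
    unfolding K_def K'_def K''_def by (rule hgf_solution_hgf)
  have sol1: "hgf_solution a b c (\<lambda>w. G (1 - w)) (\<lambda>w. - G' (1 - w)) (\<lambda>w. G'' (1 - w)) lens"
    by (rule hgf_solution_reflect[OF G]) (auto simp: lens_memD s_def)
  have "hgf_solution (b - (1 - s) + 1) (a - (1 - s) + 1) (2 - (1 - s)) K K' K'' lens"
    using hgf_solution_subset[OF K, of lens] by (simp add: s_def lens_def algebra_simps)
  from hgf_solution_powr_mult[OF this lens_memD(3)]
  have K2: "hgf_solution b a (1 - s) (\<lambda>w. w powr s * K w)
     (\<lambda>w. w powr (s - 2) * (s * w * K w + w\<^sup>2 * K' w))
     (\<lambda>w. w powr (s - 2) * (s * (s - 1) * K w + 2 * s * w * K' w + w\<^sup>2 * K'' w)) lens"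
    by (simp add: algebra_simps)
  have sol2: "hgf_solution a b c (\<lambda>w. (1 - w) powr s * K (1 - w))
     (\<lambda>w. - ((1 - w) powr (s - 2) * (s * (1 - w) * K (1 - w) + (1 - w)\<^sup>2 * K' (1 - w))))
     (\<lambda>w. (1 - w) powr (s - 2) * (s * (s - 1) * K (1 - w) + 2 * s * (1 - w) * K' (1 - w) + (1 - w)\<^sup>2 * K'' (1 - w)))
     lens"
    using hgf_solution_reflect[OF K2, of lens c]
    by (simp add: s_def lens_memD hgf_solution_def add.commute mult.commute)
  have eq1: "(\<lambda>w. G (1 - w)) = hgf1 a b c"
    by (simp add: G_def hgf1_def fun_eq_iff s_def algebra_simps)
  have eq2: "(\<lambda>w. (1 - w) powr s * K (1 - w)) = hgf2 a b c"
    by (simp add: K_def hgf2_def fun_eq_iff s_def algebra_simps)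
  let ?f2' = "\<lambda>w. - ((1 - w) powr (s - 2) * (s * (1 - w) * K (1 - w) + (1 - w)\<^sup>2 * K' (1 - w)))"
  let ?W = "\<lambda>w. G (1 - w) * ?f2' w - - G' (1 - w) * ((1 - w) powr s * K (1 - w))"
  obtain C where C: "\<And>w. w \<in> lens \<Longrightarrow>
      ?W w * (w powr c * (1 - w) powr (a + b + 1 - c)) = C"
    using wronskian_const[OF sol1 sol2] by blast
  \<comment> \<open>The weighted Wronskian after the powers of \<open>1 - w\<close> have cancelled;
    unlike the original expression it is visibly continuous at 1.\<close>
  let ?V = "\<lambda>w. - (w powr c) * (s * G (1 - w) * K (1 - w) + (1 - w) * (G (1 - w) * K' (1 - w) - G' (1 - w) * K (1 - w)))"
  have V: "?V w = C" if w: "w \<in> lens" for w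
  proof -
    have nz: "1 - w \<noteq> 0" using lens_memD[OF w] by auto
    define P where "P = (1 - w) powr (s - 2)"
    have P1: "(1 - w) powr s = (1 - w)\<^sup>2 * P"
      using nz powr_add[of "1 - w" 2 "s - 2"] powr_nat'[of "1 - w" 2] by (simp add: P_def)
    have "P * (1 - w) * (1 - w) powr (a + b + 1 - c) = (1 - w) powr ((s - 2) + 1 + (1 - s))"
      using nz by (simp only: powr_add P_def) (simp add: s_def algebra_simps)
    also have "\<dots> = 1" using nz by simp
    finally have P2: "P * (1 - w) * (1 - w) powr (a + b + 1 - c) = 1" .
    have "?W w * (w powr c * (1 - w) powr (a + b + 1 - c))
       = ?V w * (P * (1 - w) * (1 - w) powr (a + b + 1 - c))"
      unfolding P1 P_def[symmetric] by (simp add: algebra_simps power2_eq_square)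
    with C[OF w] P2 show ?thesis by simp
  qed
  have "C = - (s * G 0 * K 0)"
  proof (rule tendsto_unique)
    show "at 1 within lens \<noteq> bot"
      by (rule at_1_within_lens)
    show "(?V \<longlongrightarrow> C) (at 1 within lens)"
      by (rule tendsto_eventually, simp only: eventually_at_filter, intro always_eventually allI impI V)
    have cont: "isCont G 0" "isCont G' 0" "isCont K 0" "isCont K' 0"
      using G K by (auto simp: hgf_solution_def intro!: DERIV_isCont)
    have sub: "isCont (\<lambda>w. h (1 - w)) 1" if "isCont h 0" for h :: "complex \<Rightarrow> complex"
      by (rule isCont_o2[where f = "\<lambda>w. 1 - w"]) (use that in auto)
    have "isCont (\<lambda>w. w powr c) 1"
      by (rule DERIV_isCont[OF has_field_derivative_powr]) auto
    then have "isCont ?V 1"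
      by (intro isCont_minus isCont_mult isCont_add isCont_diff cont[THEN sub] continuous_const continuous_ident)
    then have "(?V \<longlongrightarrow> ?V 1) (at 1)" by (simp only: isCont_def)
    then have "(?V \<longlongrightarrow> ?V 1) (at 1 within lens)" by (rule tendsto_within_subset) simp
    then show "(?V \<longlongrightarrow> - (s * G 0 * K 0)) (at 1 within lens)" by simp
  qed
  moreover have "G 0 = rGamma (1 - s)" "K 0 = rGamma (1 + s)"
    by (simp_all add: G_def K_def hgf_0)
  ultimately have C0: "C = - (s * rGamma (1 - s) * rGamma (1 + s))" by simp
  have "C \<noteq> 0"
  proof -
    have "s \<notin> \<int>" using s by (simp add: s_def)
    then have "1 - s \<notin> \<int>" "1 + s \<notin> \<int>" "s \<noteq> 0"
      by (metis Ints_1 Ints_diff diff_diff_eq2 add_diff_cancel_left', metis Ints_1 Ints_diff add_diff_cancel_left', auto)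
    then show ?thesis
      unfolding C0 using nonpos_Ints_subset_Ints by (auto simp: rGamma_eq_zero_iff)
  qed
  show ?thesis
  proof (rule that[OF sol1[unfolded eq1] sol2[unfolded eq2]])
    fix w assume "w \<in> lens"
    from C[OF this] \<open>C \<noteq> 0\<close> show "hgf1 a b c w * ?f2' w - - G' (1 - w) * hgf2 a b c w \<noteq> 0"
      unfolding eq1[symmetric] eq2[symmetric] by auto
  qed
qed

text \<open>Cramer's rule: after multiplication by the common weight \<open>E\<close>, the three
  Wronskians are constants, and their quotients are the coefficients.\<close>

lemma connection_exists:
  assumes "c - a - b \<notin> \<int>"
  shows "\<exists>A B. \<forall>w\<in>lens. hgf a b c w = A * hgf1 a b c w + B * hgf2 a b c w"
proof -
  obtain f1' f1'' f2' f2'' where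
    sol: "hgf_solution a b c (hgf1 a b c) f1' f1'' lens" "hgf_solution a b c (hgf2 a b c) f2' f2'' lens"
    and nz: "\<And>w. w \<in> lens \<Longrightarrow> hgf1 a b c w * f2' w - f1' w * hgf2 a b c w \<noteq> 0"
    using fundamental_system[OF assms] by metis
  define f0' where "f0' = eval_fps (fps_deriv (hgf_fps a b c))"
  have sol0: "hgf_solution a b c (hgf a b c) f0' (eval_fps (fps_deriv (fps_deriv (hgf_fps a b c)))) lens"
    unfolding f0'_def by (rule hgf_solution_subset[OF hgf_solution_hgf]) (auto simp: lens_def)
  define E where "E = (\<lambda>w. w powr c * (1 - w) powr (a + b + 1 - c))"
  obtain K12 K02 K01 where
      K12: "\<forall>w\<in>lens. (hgf1 a b c w * f2' w - f1' w * hgf2 a b c w) * E w = K12" and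
      K02: "\<forall>w\<in>lens. (hgf a b c w * f2' w - f0' w * hgf2 a b c w) * E w = K02" and
      K01: "\<forall>w\<in>lens. (hgf a b c w * f1' w - f0' w * hgf1 a b c w) * E w = K01"
    unfolding E_def using wronskian_const[OF sol(1) sol(2)] wronskian_const[OF sol0 sol(2)]
      wronskian_const[OF sol0 sol(1)] by blast
  have E: "E w \<noteq> 0" if "w \<in> lens" for w
    using lens_memD[OF that] by (auto simp: E_def)
  have half: "1 / 2 \<in> lens" by (auto simp: lens_def dist_norm)
  have "K12 \<noteq> 0" using bspec[OF K12 half] nz[OF half] E[OF half] by auto
  have "hgf a b c w = K02 / K12 * hgf1 a b c w + (- K01 / K12) * hgf2 a b c w" if w: "w \<in> lens" for w
  proof -
    have "hgf a b c w * K12 = K02 * hgf1 a b c w - K01 * hgf2 a b c w"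
      unfolding bspec[OF K12 w, symmetric] bspec[OF K02 w, symmetric] bspec[OF K01 w, symmetric]
      by (simp add: algebra_simps)
    then show ?thesis using \<open>K12 \<noteq> 0\<close> by (simp add: field_simps)
  qed
  then show ?thesis by blast
qed

text \<open>A linear relation can be differentiated in the open lens; at \<open>1 / 2\<close> the
  relation and its derivative form a system whose determinant is the nonzero Wronskian.\<close>

lemma connection_unique:
  assumes "c - a - b \<notin> \<int>"
    and eq: "\<And>w. w \<in> lens \<Longrightarrow> A * hgf1 a b c w + B * hgf2 a b c w = A' * hgf1 a b c w + B' * hgf2 a b c w"
  shows "A = A'" "B = B'"
proof -
  obtain f1' f1'' f2' f2'' where
    sol: "hgf_solution a b c (hgf1 a b c) f1' f1'' lens" "hgf_solution a b c (hgf2 a b c) f2' f2'' lens"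
    and nz: "\<And>w. w \<in> lens \<Longrightarrow> hgf1 a b c w * f2' w - f1' w * hgf2 a b c w \<noteq> 0"
    using fundamental_system[OF assms(1)] by metis
  define \<alpha> \<beta> where "\<alpha> = A - A'" and "\<beta> = B - B'"
  have zero: "\<alpha> * hgf1 a b c w + \<beta> * hgf2 a b c w = 0" if "w \<in> lens" for w
    using eq[OF that] by (simp add: \<alpha>_def \<beta>_def algebra_simps)
  define w :: complex where "w = 1 / 2"
  have w: "w \<in> lens" by (auto simp: w_def lens_def dist_norm)
  have "((\<lambda>w. \<alpha> * hgf1 a b c w + \<beta> * hgf2 a b c w) has_field_derivative \<alpha> * f1' w + \<beta> * f2' w) (at w)"
    using sol w unfolding hgf_solution_def by (intro DERIV_add DERIV_cmult) auto
  moreover have "((\<lambda>w. \<alpha> * hgf1 a b c w + \<beta> * hgf2 a b c w) has_field_derivative 0) (at w)"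
    by (rule has_field_derivative_transform_within_open[OF DERIV_const open_lens w, of 0])
       (use zero in auto)
  ultimately have d: "\<alpha> * f1' w + \<beta> * f2' w = 0"
    by (rule DERIV_unique)
  have "\<alpha> * (hgf1 a b c w * f2' w - f1' w * hgf2 a b c w)
      = f2' w * (\<alpha> * hgf1 a b c w + \<beta> * hgf2 a b c w) - hgf2 a b c w * (\<alpha> * f1' w + \<beta> * f2' w)"
    by (simp add: algebra_simps)
  then have "\<alpha> = 0" using zero[OF w] d nz[OF w] by simp
  moreover have "\<beta> * (hgf1 a b c w * f2' w - f1' w * hgf2 a b c w)
      = hgf1 a b c w * (\<alpha> * f1' w + \<beta> * f2' w) - f1' w * (\<alpha> * hgf1 a b c w + \<beta> * hgf2 a b c w)"
    by (simp add: algebra_simps)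
  then have "\<beta> = 0" using zero[OF w] d nz[OF w] by simp
  ultimately show "A = A'" "B = B'" by (simp_all add: \<alpha>_def \<beta>_def)
qed

section \<open>Lowering c in the connection formula\<close>

lemma hgf1_shift:
  assumes "norm (1 - w) < 1"
  shows "\<exists>D. (hgf1 a b (c + 1) has_field_derivative D) (at w) \<and>
     c * hgf1 a b (c + 1) w + w * D = - ((c - a) * (c - b)) * hgf1 a b c w"
proof -
  define v where "v = 1 - w"
  have v: "norm v < 1" and v': "ereal (norm v) < 1" using assms by (simp_all add: v_def one_ereal_def)
  define g where "g = hgf_fps a b (a + b - c)"
  have g: "fps_conv_radius g \<ge> 1" "fps_conv_radius (fps_deriv g) \<ge> 1"
    unfolding g_def by (intro fps_conv_radius_deriv_ge fps_conv_radius_hgf)+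
  have conv: "ereal (norm v) < fps_conv_radius F" if "fps_conv_radius F \<ge> 1" for F :: "complex fps"
    using that v' by order
  have h1: "hgf1 a b (c + 1) = (\<lambda>w. eval_fps g (1 - w))"
    by (simp add: hgf1_def fun_eq_iff g_def diff_add_eq)
  have d: "((\<lambda>w. 1 - w) has_field_derivative -1) (at w)"
    by (auto intro!: derivative_eq_intros)
  have D: "(hgf1 a b (c + 1) has_field_derivative - eval_fps (fps_deriv g) v) (at w)"
    using DERIV_chain2[OF _ d, of "eval_fps g" "eval_fps (fps_deriv g) v"] hgf_deriv(1)[OF v, of a b "a + b - c"]
    by (simp add: h1 v_def g_def)
  \<comment> \<open>In \<open>v = 1 - w\<close> the operator \<open>c + w d/dw\<close> reads
    \<open>c - (1 - v) d/dv\<close>; the term \<open>d/dv\<close> has been moved to the right-hand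
    side.\<close>
  have id: "fps_const c * g + fps_X * fps_deriv g
     = fps_deriv g + fps_const (- ((c - a) * (c - b))) * hgf_fps a b (a + b - c + 1)"
  proof (rule fps_ext)
    fix n
    define R where "R = rGamma (a + b - c + 1 + of_nat n)"
    have R: "rGamma (a + b - c + of_nat n) = (a + b - c + of_nat n) * R"
      "rGamma (a + b - c + of_nat (Suc n)) = R"
      using rGamma_plus1[of "a + b - c + of_nat n"] by (simp_all add: R_def add_ac)
    define P where "P = pochhammer a n * pochhammer b n / fact n"
    have gn: "fps_nth g n = P * (a + b - c + of_nat n) * R"
      by (simp add: g_def hgf_fps_def R P_def)
    have gSn: "of_nat (Suc n) * fps_nth g (Suc n) = P * (a + of_nat n) * (b + of_nat n) * R"
      unfolding g_def hgf_fps_def fps_nth_Abs_fps R(2)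
      by (simp add: P_def pochhammer_Suc field_simps del: of_nat_Suc)
    have hn: "fps_nth (hgf_fps a b (a + b - c + 1)) n = P * R"
      by (simp add: hgf_fps_def P_def R_def)
    have X: "fps_nth (fps_X * fps_deriv g) n = of_nat n * fps_nth g n"
      by (cases n) auto
    show "fps_nth (fps_const c * g + fps_X * fps_deriv g) n
       = fps_nth (fps_deriv g + fps_const (- ((c - a) * (c - b))) * hgf_fps a b (a + b - c + 1)) n"
      unfolding fps_add_nth X fps_deriv_nth Suc_eq_plus1[symmetric] gSn fps_mult_left_const_nth gn
      using hn by (simp add: algebra_simps)
  qed
  have "eval_fps (fps_const c * g + fps_X * fps_deriv g) v = c * eval_fps g v + v * eval_fps (fps_deriv g) v"
    using g by (simp add: eval_fps_add eval_fps_mult conv fps_conv_radius_mult_ge)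
  moreover have "eval_fps (fps_deriv g + fps_const (- ((c - a) * (c - b))) * hgf_fps a b (a + b - c + 1)) v
      = eval_fps (fps_deriv g) v - ((c - a) * (c - b)) * hgf a b (a + b - c + 1) v"
    using g fps_conv_radius_hgf[of a b "a + b - c + 1"]
    by (subst eval_fps_add) (auto simp: eval_fps_mult conv fps_conv_radius_mult_ge)
  ultimately have "c * eval_fps g v + v * eval_fps (fps_deriv g) v
      = eval_fps (fps_deriv g) v - ((c - a) * (c - b)) * hgf a b (a + b - c + 1) v"
    using id by simp
  then have "c * hgf1 a b (c + 1) w + w * (- eval_fps (fps_deriv g) v) = - ((c - a) * (c - b)) * hgf1 a b c w"
    unfolding h1 hgf1_def v_def by (simp add: algebra_simps)
  with D show ?thesis by blast
qed

lemma hgf2_shift: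
  assumes "norm (1 - w) < 1" "Re w < 1"
  shows "\<exists>D. (hgf2 a b (c + 1) has_field_derivative D) (at w) \<and>
     c * hgf2 a b (c + 1) w + w * D = - hgf2 a b c w"
proof -
  define v where "v = 1 - w"
  have v: "norm v < 1" and v': "ereal (norm v) < 1" using assms by (simp_all add: v_def one_ereal_def)
  define s where "s = c - a - b"
  define \<alpha> \<beta> where "\<alpha> = c - a" and "\<beta> = c - b"
  define g where "g = hgf_fps (\<alpha> + 1) (\<beta> + 1) (s + 2)"
  have g: "fps_conv_radius g \<ge> 1" "fps_conv_radius (fps_deriv g) \<ge> 1"
    unfolding g_def by (intro fps_conv_radius_deriv_ge fps_conv_radius_hgf)+
  have conv: "ereal (norm v) < fps_conv_radius F" if "fps_conv_radius F \<ge> 1" for F :: "complex fps"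
    using that v' by order
  have h2: "hgf2 a b (c + 1) = (\<lambda>w. (1 - w) powr (s + 1) * eval_fps g (1 - w))"
    by (simp add: hgf2_def fun_eq_iff g_def s_def \<alpha>_def \<beta>_def algebra_simps)
  have d: "((\<lambda>w. 1 - w) has_field_derivative -1) (at w)"
    by (auto intro!: derivative_eq_intros)
  have v0: "v \<notin> \<real>\<^sub>\<le>\<^sub>0" "v \<noteq> 0" using assms by (auto simp: v_def complex_nonpos_Reals_iff)
  have pw: "v powr (s + 1) = v * v powr s"
    using v0 by (simp add: powr_add)
  have D1: "((\<lambda>w. eval_fps g (1 - w)) has_field_derivative - eval_fps (fps_deriv g) v) (at w)"
    using DERIV_chain2[OF _ d, of "eval_fps g" "eval_fps (fps_deriv g) v"] hgf_deriv(1)[OF v, of "\<alpha> + 1" "\<beta> + 1" "s + 2"]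
    by (simp add: v_def g_def)
  have D2: "((\<lambda>w. (1 - w) powr (s + 1)) has_field_derivative - ((s + 1) * v powr s)) (at w)"
    using DERIV_chain2[OF has_field_derivative_powr[OF v0(1)[unfolded v_def], of "s + 1"] d]
    by (simp add: v_def)
  have D: "(hgf2 a b (c + 1) has_field_derivative
      (- (v powr s) * ((s + 1) * eval_fps g v + v * eval_fps (fps_deriv g) v))) (at w)"
    unfolding h2 by (rule DERIV_cong[OF DERIV_mult[OF D2 D1]])
      (simp only: v_def[symmetric] pw, simp add: algebra_simps)
  \<comment> \<open>The claimed relation with the factor \<open>v powr s\<close> divided out,
    arranged so that no term is negative; \<open>D\<close> supplies
    \<open>(1 - v) * ((s + 1) * g + v * g')\<close>.\<close>
  have id: "fps_const c * (fps_X * g) + fps_const (s + 1) * (fps_X * g) + fps_X * (fps_X * fps_deriv g)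
       + hgf_fps \<alpha> \<beta> (s + 1)
     = fps_const (s + 1) * g + fps_X * fps_deriv g"
  proof (rule fps_ext)
    fix n
    show "fps_nth (fps_const c * (fps_X * g) + fps_const (s + 1) * (fps_X * g) + fps_X * (fps_X * fps_deriv g)
       + hgf_fps \<alpha> \<beta> (s + 1)) n
     = fps_nth (fps_const (s + 1) * g + fps_X * fps_deriv g) n"
    proof (cases n)
      case 0
      have "rGamma (s + 1) = (s + 1) * rGamma (s + 2)"
        using rGamma_plus1[of "s + 1"] by (simp add: add_ac)
      then show ?thesis by (simp add: 0 g_def hgf_fps_def)
    next
      case (Suc m)
      define R where "R = rGamma (s + 2 + of_nat m)"
      have R: "rGamma (s + 1 + of_nat (Suc m)) = R" "R = (s + 2 + of_nat m) * rGamma (s + 2 + of_nat (Suc m))"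
        using rGamma_plus1[of "s + 2 + of_nat m"] by (simp_all add: R_def add_ac)
      define P where "P = pochhammer (\<alpha> + 1) m * pochhammer (\<beta> + 1) m / fact m"
      have gm: "fps_nth g m = P * R"
        by (simp add: g_def hgf_fps_def R_def P_def)
      have gSm: "of_nat (Suc m) * (s + 2 + of_nat m) * fps_nth g (Suc m)
           = P * (\<alpha> + 1 + of_nat m) * (\<beta> + 1 + of_nat m) * R"
        unfolding R(2) g_def hgf_fps_def fps_nth_Abs_fps
        by (simp add: P_def pochhammer_Suc field_simps del: of_nat_Suc)
      have h: "of_nat (Suc m) * fps_nth (hgf_fps \<alpha> \<beta> (s + 1)) (Suc m) = P * \<alpha> * \<beta> * R"
        unfolding hgf_fps_def fps_nth_Abs_fps R(1)
        by (simp add: P_def pochhammer_rec field_simps del: of_nat_Suc)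
      have X: "fps_nth (fps_X * fps_deriv g) k = of_nat k * fps_nth g k" for k
        by (cases k) auto
      \<comment> \<open>The factor \<open>Suc m\<close> clears the denominator by which
        \<open>fact (Suc m)\<close> differs from the \<open>fact m\<close> inside
        \<open>P\<close>.\<close>
      have "of_nat (Suc m) * fps_nth (fps_const c * (fps_X * g) + fps_const (s + 1) * (fps_X * g) + fps_X * (fps_X * fps_deriv g)
            + hgf_fps \<alpha> \<beta> (s + 1)) (Suc m)
          = of_nat (Suc m) * (c + (s + 1) + of_nat m) * (P * R) + P * \<alpha> * \<beta> * R"
        unfolding fps_add_nth distrib_left h
        by (simp add: X gm algebra_simps)
      also have "\<dots> = of_nat (Suc m) * (s + 2 + of_nat m) * fps_nth g (Suc m)"
        unfolding gSm by (simp add: \<alpha>_def \<beta>_def s_def algebra_simps)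
      also have "\<dots> = of_nat (Suc m) * fps_nth (fps_const (s + 1) * g + fps_X * fps_deriv g) (Suc m)"
        by (simp add: X algebra_simps)
      finally show ?thesis unfolding Suc by (simp del: of_nat_Suc fps_add_nth fps_mult_left_const_nth fps_X_mult_nth)
    qed
  qed
  have "c * (v * eval_fps g v) + (s + 1) * (v * eval_fps g v) + v * (v * eval_fps (fps_deriv g) v) + hgf \<alpha> \<beta> (s + 1) v
      = (s + 1) * eval_fps g v + v * eval_fps (fps_deriv g) v"
  proof -
    have add: "fps_conv_radius (F + G) \<ge> 1"
      if "fps_conv_radius F \<ge> 1" "fps_conv_radius G \<ge> 1" for F G :: "complex fps"
      using fps_conv_radius_add[of F G] that by (metis min.bounded_iff order_trans)
    have e1: "eval_fps (fps_const c * (fps_X * g) + fps_const (s + 1) * (fps_X * g) + fps_X * (fps_X * fps_deriv g)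
       + hgf_fps \<alpha> \<beta> (s + 1)) v = c * (v * eval_fps g v) + (s + 1) * (v * eval_fps g v) + v * (v * eval_fps (fps_deriv g) v) + hgf \<alpha> \<beta> (s + 1) v"
      using g fps_conv_radius_hgf[of \<alpha> \<beta> "s + 1"]
      by (simp add: eval_fps_add eval_fps_mult conv fps_conv_radius_mult_ge add del: fps_const_add)
    have e2: "eval_fps (fps_const (s + 1) * g + fps_X * fps_deriv g) v = (s + 1) * eval_fps g v + v * eval_fps (fps_deriv g) v"
      using g by (simp add: eval_fps_add eval_fps_mult conv fps_conv_radius_mult_ge add del: fps_const_add)
    show ?thesis using e1 e2 id by simp
  qed
  then have e: "hgf \<alpha> \<beta> (s + 1) v = (s + 1) * eval_fps g v + v * eval_fps (fps_deriv g) v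
      - c * (v * eval_fps g v) - (s + 1) * (v * eval_fps g v) - v * (v * eval_fps (fps_deriv g) v)"
    by (simp add: algebra_simps)
  have h2c: "hgf2 a b c w = v powr s * hgf \<alpha> \<beta> (s + 1) v"
    by (simp add: hgf2_def v_def s_def \<alpha>_def \<beta>_def)
  have h2c1: "hgf2 a b (c + 1) w = v * v powr s * eval_fps g v"
    by (simp only: h2 v_def[symmetric] pw)
  have "c * hgf2 a b (c + 1) w + (1 - v) * (- (v powr s) * ((s + 1) * eval_fps g v + v * eval_fps (fps_deriv g) v)) = - hgf2 a b c w"
    unfolding h2c h2c1 e by (simp add: algebra_simps)
  moreover have "1 - v = w" by (simp add: v_def)
  ultimately have "c * hgf2 a b (c + 1) w + w * (- (v powr s) * ((s + 1) * eval_fps g v + v * eval_fps (fps_deriv g) v)) = - hgf2 a b c w"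
    by (simp only:)
  with D show ?thesis by blast
qed

text \<open>The operator \<open>c + w d/dw\<close> is applied to the relation at
  \<open>c + 1\<close>. It sends each of the three solutions to a constant multiple of its
  counterpart at \<open>c\<close>.\<close>

lemma connection_shift:
  assumes "\<forall>w\<in>lens. hgf a b (c + 1) w = A * hgf1 a b (c + 1) w + B * hgf2 a b (c + 1) w"
  shows "\<forall>w\<in>lens. hgf a b c w = - ((c - a) * (c - b)) * A * hgf1 a b c w - B * hgf2 a b c w"
proof
  fix w assume w: "w \<in> lens"
  note w' = lens_memD[OF w]
  obtain D1 where D1: "(hgf1 a b (c + 1) has_field_derivative D1) (at w)"
     "c * hgf1 a b (c + 1) w + w * D1 = - ((c - a) * (c - b)) * hgf1 a b c w"
    using hgf1_shift[OF w'(2)] by blast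
  obtain D2 where D2: "(hgf2 a b (c + 1) has_field_derivative D2) (at w)"
     "c * hgf2 a b (c + 1) w + w * D2 = - hgf2 a b c w"
    using hgf2_shift[OF w'(2,4)] by blast
  have "((\<lambda>w. A * hgf1 a b (c + 1) w + B * hgf2 a b (c + 1) w) has_field_derivative A * D1 + B * D2) (at w)"
    by (intro DERIV_add DERIV_cmult D1 D2)
  then have "(hgf a b (c + 1) has_field_derivative A * D1 + B * D2) (at w)"
    by (rule has_field_derivative_transform_within_open[OF _ open_lens w]) (use assms in auto)
  then have "eval_fps (fps_deriv (hgf_fps a b (c + 1))) w = A * D1 + B * D2"
    using hgf_deriv(1)[OF w'(1), of a b "c + 1"] DERIV_unique by blast
  then have "hgf a b c w = A * (c * hgf1 a b (c + 1) w + w * D1) + B * (c * hgf2 a b (c + 1) w + w * D2)"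
    using hgf_shift[OF w'(1), of a b c] bspec[OF assms w] by (simp add: algebra_simps)
  then show "hgf a b c w = - ((c - a) * (c - b)) * A * hgf1 a b c w - B * hgf2 a b c w"
    unfolding D1 D2 by (simp add: algebra_simps)
qed

lemma connection_shift_n:
  assumes "\<forall>w\<in>lens. hgf a b (c + of_nat n) w = A * hgf1 a b (c + of_nat n) w + B * hgf2 a b (c + of_nat n) w"
  shows "\<forall>w\<in>lens. hgf a b c w = (-1) ^ n * pochhammer (c - a) n * pochhammer (c - b) n * A * hgf1 a b c w
            + (-1) ^ n * B * hgf2 a b c w"
  using assms
proof (induction n arbitrary: c)
  case (Suc n)
  have "c + of_nat (Suc n) = (c + 1) + of_nat n" by simp
  from Suc.IH[of "c + 1", OF Suc.prems[unfolded this]]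
  have "\<forall>w\<in>lens. hgf a b (c + 1) w = ((-1) ^ n * pochhammer (c + 1 - a) n * pochhammer (c + 1 - b) n * A) * hgf1 a b (c + 1) w
            + ((-1) ^ n * B) * hgf2 a b (c + 1) w" .
  from connection_shift[OF this] show ?case
    by (simp add: pochhammer_rec algebra_simps)
qed simp

section \<open>The limit of large c\<close>

text \<open>The bound does not depend on \<open>w\<close>, so it survives the passage to
  \<open>w = 1\<close> that precedes the limit in \<open>c\<close>. This requires a summable
  majorant of the coefficients themselves, here of order \<open>1 / n^2\<close>.\<close>

lemma hgf_bound:
  assumes m: "norm a \<le> m" "norm b \<le> m" and c: "Re c \<ge> 1 + 4 * m + 4 * m\<^sup>2" and w: "norm w < 1"
  shows "norm (Gamma c * hgf a b c w - 1) \<le> 4 * m\<^sup>2 / Re c * (\<Sum>n. 1 / real (Suc n) ^ 2)"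
proof -
  have m0: "m \<ge> 0" using m(1) norm_ge_zero order_trans by blast
  define x where "x = Re c"
  have x: "x \<ge> 1 + 4 * m + 4 * m\<^sup>2" "x > 0" using c m0 
    by (smt (verit) x_def zero_le_power2)+
  have cn: "norm (c + of_nat k) \<ge> x + real k" for k
    using complex_Re_le_cmod[of "c + of_nat k"] by (simp add: x_def)
  have c0: "c \<notin> \<int>\<^sub>\<le>\<^sub>0" using x by (auto simp: x_def elim!: nonpos_Ints_cases)
  define t where "t n = Gamma c * fps_nth (hgf_fps a b c) n" for n
  have t0: "t 0 = 1" using c0 by (simp add: t_def hgf_fps_def Gamma_def rGamma_eq_zero_iff)
  have rec: "of_nat (Suc n) * (c + of_nat n) * t (Suc n) = (a + of_nat n) * (b + of_nat n) * t n" for n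
    using arg_cong[OF hgf_fps_Suc[of n c a b], of "\<lambda>u. Gamma c * u"] by (simp only: t_def mult_ac)
  have step: "norm (t (Suc k)) * ((x + real k) * real (Suc k)) \<le> (m + real k)\<^sup>2 * norm (t k)" for k
  proof -
    have "norm (t (Suc k)) * ((x + real k) * real (Suc k)) \<le> norm (t (Suc k)) * (norm (c + of_nat k) * real (Suc k))"
      using cn by (intro mult_left_mono mult_right_mono) auto
    also have "\<dots> = norm (of_nat (Suc k) * (c + of_nat k) * t (Suc k))"
      by (simp add: norm_mult mult_ac del: of_nat_Suc)
    also have "\<dots> = norm (a + of_nat k) * norm (b + of_nat k) * norm (t k)"
      by (simp only: rec norm_mult)
    also have "\<dots> \<le> (m + real k) * (m + real k) * norm (t k)"
      using norm_triangle_ineq[of a "of_nat k"] norm_triangle_ineq[of b "of_nat k"] m m0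
      by (intro mult_right_mono mult_mono) auto
    finally show ?thesis by (simp add: power2_eq_square)
  qed
  have bound: "norm (t (Suc n)) \<le> 4 * m\<^sup>2 / x * (1 / real (Suc (Suc n)) ^ 2)" for n
  proof (induction n)
    case 0
    show ?case using step[of 0] t0 x by (simp add: field_simps)
  next
    case (Suc n)
    \<comment> \<open>\<open>step\<close> at \<open>k = j - 1\<close> yields the ratio
      \<open>(m + j - 1)^2 / ((x + j - 1) * j)\<close>. The threshold on \<open>Re c\<close> is what
      makes it at most \<open>j^2 / (j + 1)^2\<close>, which carries the majorant from
      \<open>n\<close> to \<open>n + 1\<close>.\<close>
    define j where "j = real (Suc (Suc n))"
    have j: "j \<ge> 1" by (simp add: j_def)
    have "(m + j - 1) * (j + 1) \<le> j\<^sup>2 + 2 * m * j"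
      using mult_right_mono[OF j m0] by (simp add: algebra_simps power2_eq_square)
    then have "((m + j - 1) * (j + 1))\<^sup>2 \<le> (j\<^sup>2 + 2 * m * j)\<^sup>2"
      using m0 j by (intro power_mono) auto
    also have "\<dots> = j ^ 4 + 4 * m * j ^ 3 + 4 * m\<^sup>2 * j\<^sup>2"
      by (simp add: power2_eq_square algebra_simps eval_nat_numeral)
    also have "\<dots> \<le> j ^ 4 + 4 * m * j ^ 3 + 4 * m\<^sup>2 * j ^ 3"
      using m0 j by (intro add_left_mono mult_left_mono power_increasing) auto
    also have "\<dots> = (j + 4 * m + 4 * m\<^sup>2) * j ^ 3"
      by (simp add: algebra_simps eval_nat_numeral)
    also have "\<dots> \<le> (x + j - 1) * j ^ 3"
      using x j by (intro mult_right_mono) auto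
    finally have key: "(m + j - 1)\<^sup>2 * (j + 1)\<^sup>2 \<le> ((x + j - 1) * j) * j\<^sup>2"
      by (simp add: power_mult_distrib eval_nat_numeral algebra_simps)
    have pos: "(x + j - 1) * j > 0" using x j by (intro mult_pos_pos) auto
    have "norm (t (Suc (Suc n))) * ((x + j - 1) * j) \<le> (m + j - 1)\<^sup>2 * norm (t (Suc n))"
      using step[of "Suc n"] by (simp add: j_def algebra_simps)
    also have "\<dots> \<le> (((x + j - 1) * j) * j\<^sup>2 / (j + 1)\<^sup>2) * (4 * m\<^sup>2 / x * (1 / j\<^sup>2))"
    proof (rule mult_mono)
      show "(m + j - 1)\<^sup>2 \<le> ((x + j - 1) * j) * j\<^sup>2 / (j + 1)\<^sup>2"
        using key j by (subst pos_le_divide_eq) auto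
      show "norm (t (Suc n)) \<le> 4 * m\<^sup>2 / x * (1 / j\<^sup>2)"
        using Suc by (simp only: j_def)
    qed (use pos in auto)
    also have "\<dots> = (4 * m\<^sup>2 / x * (1 / (j + 1)\<^sup>2)) * ((x + j - 1) * j)"
    proof -
      have "(U * J / V) * (W * (1 / J)) = (W * (1 / V)) * U" if "J \<noteq> 0" for U J V W :: real
        using that by simp
      then show ?thesis using j by (simp add: mult_ac)
    qed
    finally have "norm (t (Suc (Suc n))) \<le> 4 * m\<^sup>2 / x * (1 / (j + 1)\<^sup>2)"
      using pos by (simp only: mult_le_cancel_right_pos)
    then show ?case by (simp add: j_def add_ac)
  qed
  have sm: "summable (\<lambda>n. 1 / real (Suc n) ^ 2)"
    using inverse_squares_sums by (auto simp: sums_iff)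
  have "ereal (norm w) < 1" using w by (simp add: one_ereal_def)
  then have "ereal (norm w) < fps_conv_radius (hgf_fps a b c)"
    using fps_conv_radius_hgf[of a b c] by order
  from sums_mult[OF sums_eval_fps[OF this], of "Gamma c"]
  have ts: "(\<lambda>n. t n * w ^ n) sums (Gamma c * hgf a b c w)"
    by (simp add: t_def mult_ac)
  then have "(\<lambda>n. t (Suc n) * w ^ Suc n) sums (Gamma c * hgf a b c w - 1)"
    using sums_Suc_iff[of "\<lambda>n. t n * w ^ n" "Gamma c * hgf a b c w - 1"] t0 by simp
  then have eq: "Gamma c * hgf a b c w - 1 = (\<Sum>n. t (Suc n) * w ^ Suc n)"
    by (simp add: sums_iff)
  have le: "norm (t (Suc n) * w ^ Suc n) \<le> 4 * m\<^sup>2 / x * (1 / real (Suc n) ^ 2)" for n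
  proof -
    have "norm (t (Suc n) * w ^ Suc n) = norm (t (Suc n)) * norm w ^ Suc n"
      by (simp add: norm_mult norm_power)
    also have "\<dots> \<le> norm (t (Suc n)) * 1"
      using w by (intro mult_left_mono power_le_one) auto
    also have "\<dots> \<le> 4 * m\<^sup>2 / x * (1 / real (Suc (Suc n)) ^ 2)"
      using bound by simp
    also have "\<dots> \<le> 4 * m\<^sup>2 / x * (1 / real (Suc n) ^ 2)"
      using x by (intro mult_left_mono divide_left_mono power_mono) auto
    finally show ?thesis .
  qed
  have "norm (\<Sum>n. t (Suc n) * w ^ Suc n) \<le> (\<Sum>n. 4 * m\<^sup>2 / x * (1 / real (Suc n) ^ 2))"
    using le by (intro norm_suminf_le summable_mult sm)
  also have "\<dots> = 4 * m\<^sup>2 / x * (\<Sum>n. 1 / real (Suc n) ^ 2)"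
    by (rule suminf_mult[OF sm])
  finally show ?thesis using eq by (simp add: x_def)
qed

section \<open>Connection between the singular points 0 and 1\<close>

lemma sin_pi_add_nat: "sin (of_real pi * (s + of_nat n)) = (-1) ^ n * sin (of_real pi * s :: complex)"
proof -
  have "sin (of_real pi * s + of_nat n * of_real pi) = sin (of_real pi * s) * (-1) ^ n"
    by (simp add: sin_add)
  then show ?thesis by (simp add: algebra_simps)
qed

lemma sin_pi_ne_0:
  fixes s :: complex
  assumes "s \<notin> \<int>"
  shows "sin (of_real pi * s) \<noteq> 0"
proof -
  have "1 - s \<notin> \<int>" using assms by (metis Ints_1 Ints_diff diff_diff_eq2 add_diff_cancel_left')
  then have "rGamma s * rGamma (1 - s) \<noteq> 0"
    using assms nonpos_Ints_subset_Ints by (auto simp: rGamma_eq_zero_iff)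
  then show ?thesis by (auto simp: rGamma_reflection_complex)
qed

lemma Ints_add_of_nat_iff: "(s + of_nat n :: complex) \<in> \<int> \<longleftrightarrow> s \<in> \<int>"
  by (metis Ints_add Ints_diff Ints_of_nat add_diff_cancel_right')

text \<open>The power \<open>(1 - w) powr (c - a - b)\<close> tends to 0, so the second solution
  disappears and \<open>hgf1\<close> contributes its value
  \<open>rGamma (a + b - c + 1)\<close>.\<close>

lemma hgf_tendsto_1:
  assumes conn: "\<forall>w\<in>lens. hgf a b c w = A * hgf1 a b c w + B * hgf2 a b c w" and s: "Re (c - a - b) > 0"
  shows "(hgf a b c \<longlongrightarrow> A * rGamma (a + b - c + 1)) (at 1 within lens)"
proof -
  have lim: "((\<lambda>w. hgf a' b' c' (1 - w)) \<longlongrightarrow> rGamma c') (at 1 within lens)" for a' b' c'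
  proof -
    have "isCont (hgf a' b' c') 0"
      by (rule DERIV_isCont[OF hgf_deriv(1)]) simp
    then have "isCont (\<lambda>w. hgf a' b' c' (1 - w)) 1"
      using isCont_o2[of 1 "\<lambda>w. 1 - w" "hgf a' b' c'"] by simp
    then have "((\<lambda>w. hgf a' b' c' (1 - w)) \<longlongrightarrow> rGamma c') (at 1)"
      by (simp add: isCont_def hgf_0)
    then show ?thesis by (rule tendsto_within_subset) simp
  qed
  have "((\<lambda>w. 1 - w) \<longlongrightarrow> 1 - 1) (at (1 :: complex) within lens)"
    by (intro tendsto_diff tendsto_const tendsto_ident_at)
  then have p: "((\<lambda>w. (1 - w) powr (c - a - b)) \<longlongrightarrow> 0) (at 1 within lens)"
    using tendsto_powr_complex_0[OF _ tendsto_const s] by simp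
  have "((\<lambda>w. A * hgf1 a b c w + B * hgf2 a b c w) \<longlongrightarrow>
       A * rGamma (a + b - c + 1) + B * (0 * rGamma (c - a - b + 1))) (at 1 within lens)"
    unfolding hgf1_def hgf2_def
    by (rule tendsto_add[OF tendsto_mult[OF tendsto_const lim] tendsto_mult[OF tendsto_const tendsto_mult[OF p lim]]])
  then have "((\<lambda>w. A * hgf1 a b c w + B * hgf2 a b c w) \<longlongrightarrow> A * rGamma (a + b - c + 1)) (at 1 within lens)"
    by simp
  moreover have "eventually (\<lambda>w. A * hgf1 a b c w + B * hgf2 a b c w = hgf a b c w) (at 1 within lens)"
    unfolding eventually_at_filter using conn by (intro always_eventually) auto
  ultimately show ?thesis by (rule Lim_transform_eventually)
qed

text \<open>Raising \<open>c\<close> by \<open>n\<close> expresses \<open>A\<close> through the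
  coefficient \<open>A' n\<close>, which is known asymptotically because F tends to 1. Euler's limit
  for \<open>1 / Gamma\<close> evaluates the resulting product; the sine comes from the reflection
  formula for \<open>rGamma (1 - s)\<close>, the value of \<open>hgf1\<close> at 1.\<close>

lemma connection_coeff:
  assumes s: "c - a - b \<notin> \<int>" and c: "c \<notin> \<int>\<^sub>\<le>\<^sub>0"
    and conn: "\<forall>w\<in>lens. hgf a b c w = A * hgf1 a b c w + B * hgf2 a b c w"
  shows "A * (sin (of_real pi * (c - a - b)) / of_real pi) = rGamma (c - a) * rGamma (c - b)"
proof -
  define s where "s = c - a - b"
  define \<sigma> where "\<sigma> = sin (of_real pi * s) / of_real pi"
  have sZ: "s + of_nat n \<notin> \<int>" for n
    using assms(1) by (simp add: s_def Ints_add_of_nat_iff)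
  have "\<forall>n. \<exists>A' B'. \<forall>w\<in>lens. hgf a b (c + of_nat n) w
      = A' * hgf1 a b (c + of_nat n) w + B' * hgf2 a b (c + of_nat n) w"
  proof
    fix n
    have "c + of_nat n - a - b \<notin> \<int>" using sZ[of n] by (simp add: s_def algebra_simps)
    then show "\<exists>A' B'. \<forall>w\<in>lens. hgf a b (c + of_nat n) w
      = A' * hgf1 a b (c + of_nat n) w + B' * hgf2 a b (c + of_nat n) w"
      by (rule connection_exists)
  qed
  from choice[OF this] obtain A' where "\<forall>n. \<exists>B'. \<forall>w\<in>lens. hgf a b (c + of_nat n) w
      = A' n * hgf1 a b (c + of_nat n) w + B' * hgf2 a b (c + of_nat n) w"
    by blast
  from choice[OF this] obtain B' where conn': "\<And>n. \<forall>w\<in>lens. hgf a b (c + of_nat n) w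
      = A' n * hgf1 a b (c + of_nat n) w + B' n * hgf2 a b (c + of_nat n) w"
    by blast
  have A: "A = (-1) ^ n * pochhammer (c - a) n * pochhammer (c - b) n * A' n" for n
  proof (rule connection_unique(1)[OF assms(1), where B = B and B' = "(-1) ^ n * B' n"])
    fix w assume "w \<in> lens"
    then show "A * hgf1 a b c w + B * hgf2 a b c w =
        (-1) ^ n * pochhammer (c - a) n * pochhammer (c - b) n * A' n * hgf1 a b c w + (-1) ^ n * B' n * hgf2 a b c w"
      using bspec[OF connection_shift_n[OF conn'[of n]]] bspec[OF conn] by (simp only:)
  qed
  \<comment> \<open>For large \<open>n\<close> this is the limit of the unregularized F(a, b; c + n;
    w) as \<open>w\<close> tends to 1.\<close>
  define X where "X n = Gamma (c + of_nat n) * (A' n * rGamma (1 - (s + of_nat n)))" for n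
  define m where "m = max (norm a) (norm b)"
  have "eventually (\<lambda>n. norm (X n - 1) \<le> 4 * m\<^sup>2 / (Re c + real n) * (\<Sum>n. 1 / real (Suc n) ^ 2)) sequentially"
  proof -
    have "eventually (\<lambda>n. Re c + real n \<ge> 1 + 4 * m + 4 * m\<^sup>2) sequentially"
      by real_asymp
    moreover have "eventually (\<lambda>n. Re s + real n > 0) sequentially"
      by real_asymp
    ultimately show ?thesis
    proof eventually_elim
      case (elim n)
      have "(hgf a b (c + of_nat n) \<longlongrightarrow> A' n * rGamma (a + b - (c + of_nat n) + 1)) (at 1 within lens)"
        using elim by (intro hgf_tendsto_1[OF conn']) (simp add: s_def)
      also have "a + b - (c + of_nat n) + 1 = 1 - (s + of_nat n)"
        by (simp add: s_def)
      finally have "((\<lambda>w. norm (Gamma (c + of_nat n) * hgf a b (c + of_nat n) w - 1)) \<longlongrightarrow> norm (X n - 1)) (at 1 within lens)"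
        unfolding X_def by (intro tendsto_norm tendsto_diff tendsto_mult tendsto_const)
      moreover have "eventually (\<lambda>w. norm (Gamma (c + of_nat n) * hgf a b (c + of_nat n) w - 1)
          \<le> 4 * m\<^sup>2 / Re (c + of_nat n) * (\<Sum>n. 1 / real (Suc n) ^ 2)) (at 1 within lens)"
        unfolding eventually_at_filter
        using elim by (intro always_eventually allI impI hgf_bound) (auto simp: m_def lens_memD)
      ultimately have "norm (X n - 1) \<le> 4 * m\<^sup>2 / Re (c + of_nat n) * (\<Sum>n. 1 / real (Suc n) ^ 2)"
        by (rule tendsto_upperbound[OF _ _ at_1_within_lens])
      then show ?case by simp
    qed
  qed
  moreover have "(\<lambda>n. 4 * m\<^sup>2 / (Re c + real n) * C) \<longlonglongrightarrow> 0" for C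
    by real_asymp
  ultimately have "(\<lambda>n. X n - 1) \<longlonglongrightarrow> 0"
    by (rule Lim_null_comparison)
  then have X: "(\<lambda>n. X n) \<longlonglongrightarrow> 1" by (simp add: LIM_zero_iff)
  have rs: "rGamma s \<noteq> 0" using sZ[of 0] nonpos_Ints_subset_Ints by (auto simp: rGamma_eq_zero_iff)
  have rc: "rGamma c \<noteq> 0" using c by (auto simp: rGamma_eq_zero_iff)
  \<comment> \<open>The reflection formula at \<open>s + n\<close> produces a sign
    \<open>(-1)^n\<close> that cancels the one in \<open>A\<close>, so the right-hand side is
    independent of \<open>n\<close> and may be evaluated in the limit.\<close>
  have eq: "A * \<sigma> = pochhammer (c - a) n * pochhammer (c - b) n / (pochhammer s n * pochhammer c n)
       * (rGamma s * rGamma c) * X n" for n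
  proof -
    have ps: "rGamma s = pochhammer s n * rGamma (s + of_nat n)" "rGamma c = pochhammer c n * rGamma (c + of_nat n)"
      by (rule pochhammer_rGamma)+
    have nz: "pochhammer s n \<noteq> 0" "pochhammer c n \<noteq> 0" "rGamma (c + of_nat n) \<noteq> 0"
      using ps rs rc by auto
    have "Gamma (c + of_nat n) * rGamma (c + of_nat n) = 1"
      using nz(3) by (simp add: Gamma_def)
    then have "rGamma (s + of_nat n) * rGamma (c + of_nat n) * X n
        = A' n * (rGamma (s + of_nat n) * rGamma (1 - (s + of_nat n)))"
      by (simp add: X_def mult_ac)
    also have "\<dots> = A' n * (-1) ^ n * \<sigma>"
      unfolding rGamma_reflection_complex sin_pi_add_nat by (simp add: \<sigma>_def)
    finally have e: "rGamma (s + of_nat n) * rGamma (c + of_nat n) * X n = A' n * (-1) ^ n * \<sigma>" .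
    have "pochhammer (c - a) n * pochhammer (c - b) n / (pochhammer s n * pochhammer c n)
       * (rGamma s * rGamma c) * X n = pochhammer (c - a) n * pochhammer (c - b) n *
         (rGamma (s + of_nat n) * rGamma (c + of_nat n) * X n)"
      unfolding ps using nz by simp
    also have "\<dots> = A * \<sigma>"
      unfolding e A[of n] by simp
    finally show ?thesis by simp
  qed
  \<comment> \<open>The exponential factors of the four Euler products cancel because
    \<open>(c - a) + (c - b) = s + c\<close>. The product with index \<open>n\<close> contains
    Pochhammer symbols of length \<open>n + 1\<close>, hence \<open>X (Suc n)\<close> below.\<close>
  define Y where "Y n = rGamma_series (c - a) n * rGamma_series (c - b) n / (rGamma_series s n * rGamma_series c n)" for n
  have Ylim: "Y \<longlonglongrightarrow> rGamma (c - a) * rGamma (c - b) / (rGamma s * rGamma c)"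
    unfolding Y_def using rs rc by (intro tendsto_divide tendsto_mult rGamma_series_LIMSEQ) auto
  have Y: "Y n = pochhammer (c - a) (Suc n) * pochhammer (c - b) (Suc n) / (pochhammer s (Suc n) * pochhammer c (Suc n))" for n
  proof -
    define L where "L = complex_of_real (ln (real n))"
    have "exp ((c - a) * L) * exp ((c - b) * L) = exp (s * L) * exp (c * L)"
      by (simp add: exp_add[symmetric] s_def algebra_simps)
    then show ?thesis
      unfolding Y_def rGamma_series_def L_def[symmetric] Suc_eq_plus1[symmetric]
      by (simp add: divide_simps mult_ac)
  qed
  have "(\<lambda>n. Y n * (rGamma s * rGamma c) * X (Suc n)) \<longlonglongrightarrow>
      rGamma (c - a) * rGamma (c - b) / (rGamma s * rGamma c) * (rGamma s * rGamma c) * 1"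
    by (intro tendsto_mult tendsto_const Ylim filterlim_compose[OF X filterlim_Suc])
  moreover have "(\<lambda>n. Y n * (rGamma s * rGamma c) * X (Suc n)) = (\<lambda>n. A * \<sigma>)"
    unfolding Y using eq[symmetric] by simp
  ultimately have "(\<lambda>n::nat. A * \<sigma>) \<longlonglongrightarrow> rGamma (c - a) * rGamma (c - b)"
    using rs rc by simp
  then show ?thesis unfolding \<sigma>_def s_def by (simp add: LIMSEQ_const_iff)
qed

text \<open>Euler's transformation turns the expansion for \<open>c - a\<close>,
  \<open>c - b\<close> into the one for \<open>a\<close>, \<open>b\<close> with the two solutions
  interchanged. So \<open>B\<close> is a first coefficient, but for the opposite exponent
  difference; the odd sine gives the minus sign.\<close>

lemma hgf_connection_aux:
  assumes s: "c - a - b \<notin> \<int>" and c: "c \<notin> \<int>\<^sub>\<le>\<^sub>0" and w: "w \<in> lens"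
  shows "sin (of_real pi * (c - a - b)) / of_real pi * hgf a b c w
     = rGamma (c - a) * rGamma (c - b) * hgf1 a b c w - rGamma a * rGamma b * hgf2 a b c w"
proof -
  obtain A B where AB: "\<forall>w\<in>lens. hgf a b c w = A * hgf1 a b c w + B * hgf2 a b c w"
    using connection_exists[OF s] by blast
  have s': "c - (c - a) - (c - b) \<notin> \<int>"
    using s minus_in_Ints_iff[of "c - a - b"] by (simp add: algebra_simps)
  obtain A' B' where AB': "\<forall>w\<in>lens. hgf (c - a) (c - b) c w = A' * hgf1 (c - a) (c - b) c w + B' * hgf2 (c - a) (c - b) c w"
    using connection_exists[OF s'] by blast
  have "B = A'"
  proof (rule connection_unique(2)[OF s])
    fix w assume w: "w \<in> lens"
    have nz: "1 - w \<noteq> 0" using lens_memD[OF w] by auto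
    have "(1 - w) powr (c - a - b) * (1 - w) powr (a + b - c) = (1 - w) powr 0"
      by (simp only: powr_add[symmetric]) simp
    then have 1: "(1 - w) powr (c - a - b) * (1 - w) powr (a + b - c) = 1" using nz by simp
    have e1: "hgf1 (c - a) (c - b) c w = hgf (c - a) (c - b) (c - a - b + 1) (1 - w)"
      by (simp add: hgf1_def algebra_simps)
    have e2: "hgf2 (c - a) (c - b) c w = (1 - w) powr (a + b - c) * hgf1 a b c w"
      by (simp add: hgf1_def hgf2_def algebra_simps)
    have "hgf a b c w = (1 - w) powr (c - a - b) * hgf (c - a) (c - b) c w"
      using hgf_euler[OF c lens_memD(1)[OF w]] by simp
    also have "\<dots> = A' * hgf2 a b c w + B' * hgf1 a b c w * ((1 - w) powr (c - a - b) * (1 - w) powr (a + b - c))"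
      unfolding bspec[OF AB' w] e1 e2 by (simp add: hgf2_def algebra_simps)
    finally show "A * hgf1 a b c w + B * hgf2 a b c w = B' * hgf1 a b c w + A' * hgf2 a b c w"
      unfolding 1 using bspec[OF AB w] by simp
  qed
  have "A' * (sin (of_real pi * (c - (c - a) - (c - b))) / of_real pi) = rGamma a * rGamma b"
    using connection_coeff[OF s' c AB'] by simp
  also have "of_real pi * (c - (c - a) - (c - b)) = - (of_real pi * (c - a - b))"
    by (simp add: algebra_simps)
  finally have "B * (sin (of_real pi * (c - a - b)) / of_real pi) = - rGamma a * rGamma b"
    unfolding \<open>B = A'\<close> by (simp add: minus_equation_iff eq_commute)
  moreover have "A * (sin (of_real pi * (c - a - b)) / of_real pi) = rGamma (c - a) * rGamma (c - b)"
    by (rule connection_coeff[OF s c AB])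
  moreover have "sin (of_real pi * (c - a - b)) / of_real pi * hgf a b c w
     = (A * (sin (of_real pi * (c - a - b)) / of_real pi)) * hgf1 a b c w
       + (B * (sin (of_real pi * (c - a - b)) / of_real pi)) * hgf2 a b c w"
    unfolding bspec[OF AB w] by (simp only: distrib_left mult_ac)
  ultimately show ?thesis by simp
qed

text \<open>For arbitrary \<open>c\<close>, the formula is taken at \<open>c + n\<close> with
  positive real part and lowered \<open>n\<close> times; \<open>rGamma (c - a)\<close> and
  \<open>rGamma (c - b)\<close> absorb the Pochhammer factors.\<close>

theorem hgf_connection:
  assumes s: "c - a - b \<notin> \<int>" and w: "w \<in> lens"
  shows "sin (of_real pi * (c - a - b)) / of_real pi * hgf a b c w
     = rGamma (c - a) * rGamma (c - b) * hgf1 a b c w - rGamma a * rGamma b * hgf2 a b c w"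
proof -
  obtain n :: nat where n: "real n > - Re c"
    using reals_Archimedean2 by blast
  have cn: "c + of_nat n \<notin> \<int>\<^sub>\<le>\<^sub>0"
    using n by (auto elim!: nonpos_Ints_cases simp: complex_eq_iff)
  define \<sigma> where "\<sigma> = sin (of_real pi * (c - a - b)) / complex_of_real pi"
  have sn: "c + of_nat n - a - b = (c - a - b) + of_nat n" by simp
  have sZ: "c + of_nat n - a - b \<notin> \<int>" unfolding sn using s by (simp add: Ints_add_of_nat_iff)
  have \<sigma>0: "\<sigma> \<noteq> 0" using sin_pi_ne_0[OF s] by (simp add: \<sigma>_def)
  have "sin (of_real pi * (c + of_nat n - a - b)) / complex_of_real pi = (-1) ^ n * \<sigma>"
    unfolding sn sin_pi_add_nat by (simp add: \<sigma>_def)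
  then have "\<forall>w\<in>lens. (-1) ^ n * \<sigma> * hgf a b (c + of_nat n) w
     = rGamma (c + of_nat n - a) * rGamma (c + of_nat n - b) * hgf1 a b (c + of_nat n) w
        - rGamma a * rGamma b * hgf2 a b (c + of_nat n) w"
    using hgf_connection_aux[OF sZ cn] by simp
  then have "\<forall>w\<in>lens. hgf a b (c + of_nat n) w
     = (rGamma (c + of_nat n - a) * rGamma (c + of_nat n - b) * (-1) ^ n / \<sigma>) * hgf1 a b (c + of_nat n) w
        + (- (rGamma a * rGamma b * (-1) ^ n / \<sigma>)) * hgf2 a b (c + of_nat n) w"
    using \<sigma>0 by (cases "even n") (auto simp: field_simps)
  from bspec[OF connection_shift_n[OF this] w] have
    "\<sigma> * hgf a b c w = (pochhammer (c - a) n * rGamma (c - a + of_nat n)) * (pochhammer (c - b) n * rGamma (c - b + of_nat n)) * hgf1 a b c w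
      - rGamma a * rGamma b * hgf2 a b c w"
    using \<sigma>0 by (cases "even n") (auto simp: field_simps)
  then show ?thesis
    unfolding pochhammer_rGamma[symmetric] by (simp add: \<sigma>_def)
qed

section \<open>Continuation to the slit plane\<close>

lemma slit_plane_iff: "w \<in> slit_plane \<longleftrightarrow> 1 - w \<notin> \<real>\<^sub>\<le>\<^sub>0"
proof -
  have "w \<in> complex_of_real ` {1..} \<longleftrightarrow> 1 - w \<in> \<real>\<^sub>\<le>\<^sub>0"
  proof
    assume "1 - w \<in> \<real>\<^sub>\<le>\<^sub>0"
    then have "w = complex_of_real (Re w)" "Re w \<ge> 1"
      by (auto simp: complex_nonpos_Reals_iff complex_eq_iff)
    then show "w \<in> complex_of_real ` {1..}" by force
  qed (auto simp: complex_nonpos_Reals_iff)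
  then show ?thesis by (simp add: slit_plane_def)
qed

lemma open_slit_plane: "open slit_plane"
proof -
  have "slit_plane = (\<lambda>w. 1 - w) -` (- \<real>\<^sub>\<le>\<^sub>0)"
    by (auto simp: slit_plane_iff)
  moreover have "open ((\<lambda>w :: complex. 1 - w) -` (- \<real>\<^sub>\<le>\<^sub>0))"
    by (intro open_vimage continuous_intros) (simp add: open_Compl)
  ultimately show ?thesis by (simp only:)
qed

lemma ball_subset_slit_plane: "ball 0 1 \<subseteq> slit_plane"
proof
  fix w :: complex assume "w \<in> ball 0 1"
  then have "Re w < 1" using complex_Re_le_cmod[of w] by simp
  then show "w \<in> slit_plane" by (auto simp: slit_plane_iff complex_nonpos_Reals_iff)
qed

text \<open>The map \<open>u \<mapsto> 4u/(1 + u)\<^sup>2\<close> is a bijection from the unit disc onto the slit plane. In the variable \<open>u\<close>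
  the hypergeometric equation has its singularities at \<open>0\<close> and \<open>\<plusminus>1\<close>, so the power series in \<open>u\<close>
  converges in the whole disc.\<close>

lemma hgf_pullback:
  obtains H where "fps_conv_radius H \<ge> 1"
    and "eventually (\<lambda>u. eval_fps H u = hgf a b c (4 * u / (1 + u)\<^sup>2)) (nhds 0)"
proof -
  define \<phi> where "\<phi> u = 4 * u / (1 + u)\<^sup>2" for u :: complex
  define f where "f = hgf a b c"
  define f' where "f' = eval_fps (fps_deriv (hgf_fps a b c))"
  define f'' where "f'' = eval_fps (fps_deriv (fps_deriv (hgf_fps a b c)))"
  define h where "h u = f (\<phi> u)" for u
  \<comment> \<open>\<open>y\<close> is \<open>w dF/dw\<close>. With it Gauss's equation becomes the
    first-order system \<open>id1\<close>, \<open>id2\<close>, whose leading coefficients vanish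
    only at 0, 1 and -1.\<close>
  define y where "y u = \<phi> u * f' (\<phi> u)" for u
  define \<phi>' where "\<phi>' u = 4 * (1 - u) / (1 + u) ^ 3" for u :: complex
  \<comment> \<open>The radius \<open>1 / 8\<close> gives
    \<open>4 * |u| < 1 / 2 < (7 / 8)^2\<close>, so \<open>\<phi> u\<close> stays in the disc of the
    original series.\<close>
  have u1: "1 + u \<noteq> 0" if "norm u < 1 / 8" for u :: complex
    using that by (metis add_eq_0_iff norm_minus_cancel norm_one not_less_iff_gr_or_eq
        order_less_trans divide_less_eq_1_pos one_less_numeral_iff semiring_norm(76) zero_less_numeral)
  have \<phi>1: "norm (\<phi> u) < 1" if "norm u < 1 / 8" for u
  proof -
    have "norm (1 + u) \<ge> 7 / 8"
      using norm_diff_ineq[of 1 u] that by simp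
    then have "norm (1 + u) ^ 2 \<ge> (7 / 8) ^ 2" by (intro power_mono) auto
    then have "norm (1 + u) ^ 2 > 4 * norm u" using that by (simp add: power2_eq_square)
    then show ?thesis
      using u1[OF that] by (simp add: \<phi>_def norm_divide norm_mult norm_power divide_less_eq)
  qed
  have d\<phi>: "(\<phi> has_field_derivative \<phi>' u) (at u)" if "norm u < 1 / 8" for u
  proof -
    have "(\<phi> has_field_derivative (4 * (1 + u)\<^sup>2 - 4 * u * (2 * (1 + u))) / ((1 + u)\<^sup>2)\<^sup>2) (at u)"
      unfolding \<phi>_def using u1[OF that]
      by (auto intro!: derivative_eq_intros simp: power2_eq_square)
    also have "(4 * (1 + u)\<^sup>2 - 4 * u * (2 * (1 + u))) / ((1 + u)\<^sup>2)\<^sup>2 = \<phi>' u"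
    proof -
      have "(4 * p\<^sup>2 - 4 * (p - 1) * (2 * p)) / (p\<^sup>2)\<^sup>2 = 4 * (2 - p) / p ^ 3" if "p \<noteq> 0" for p :: complex
        using that by (simp add: divide_simps) (simp add: algebra_simps eval_nat_numeral)
      from this[of "1 + u"] show ?thesis using u1[OF that] by (simp add: \<phi>'_def)
    qed
    finally show ?thesis .
  qed
  have sol: "hgf_solution a b c f f' f'' (ball 0 1)"
    unfolding f_def f'_def f''_def by (rule hgf_solution_hgf)
  have F: "(f has_field_derivative f' (\<phi> u)) (at (\<phi> u))" "(f' has_field_derivative f'' (\<phi> u)) (at (\<phi> u))"
     "\<phi> u * (1 - \<phi> u) * f'' (\<phi> u) + (c - (a + b + 1) * \<phi> u) * f' (\<phi> u) - a * b * f (\<phi> u) = 0"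
    if "norm u < 1 / 8" for u
    using sol \<phi>1[OF that] by (auto simp: hgf_solution_def)
  have dh: "(h has_field_derivative f' (\<phi> u) * \<phi>' u) (at u)" if "norm u < 1 / 8" for u
    unfolding h_def by (rule DERIV_chain2[OF F(1)[OF that] d\<phi>[OF that]])
  have dy: "(y has_field_derivative \<phi>' u * (f' (\<phi> u) + \<phi> u * f'' (\<phi> u))) (at u)" if "norm u < 1 / 8" for u
    unfolding y_def
    by (rule DERIV_cong[OF DERIV_mult[OF d\<phi>[OF that] DERIV_chain2[OF F(2)[OF that] d\<phi>[OF that]]]])
       (simp add: algebra_simps)
  have id1: "(1 + u) * (u * deriv h u) = (1 - u) * y u" if u: "norm u < 1 / 8" for u
  proof -
    have "p * (u * (D * (4 * (1 - u) / p ^ 3))) = (1 - u) * (4 * u / p\<^sup>2 * D)" if "p \<noteq> 0" for p D :: complex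
      using that by (simp add: divide_simps eval_nat_numeral)
    from this[OF u1[OF u]] show ?thesis
      unfolding DERIV_imp_deriv[OF dh[OF u]] by (simp add: y_def \<phi>_def \<phi>'_def)
  qed
  have id2: "(1 - u\<^sup>2) * (u * deriv y u) = (4 * (a + b) * u - (c - 1) * (1 + u)\<^sup>2) * y u + 4 * a * b * u * h u"
    if u: "norm u < 1 / 8" for u
  proof -
    define p where "p = 1 + u"
    have p: "p \<noteq> 0" using u1[OF u] by (simp add: p_def)
    have up: "u = p - 1" by (simp add: p_def)
    define P where "P = \<phi> u"
    define D1 where "D1 = f' P"
    define D2 where "D2 = f'' P"
    have P: "p\<^sup>2 * P = 4 * u" using p by (simp add: P_def \<phi>_def p_def[symmetric])
    have e1: "(1 - u\<^sup>2) * (u * \<phi>' u) = (1 - u)\<^sup>2 * P"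
    proof -
      have "(1 - (q - 1)\<^sup>2) * ((q - 1) * (4 * (1 - (q - 1)) / q ^ 3)) = (1 - (q - 1))\<^sup>2 * (4 * (q - 1) / q\<^sup>2)"
        if "q \<noteq> 0" for q :: complex
        using that by (simp add: divide_simps) (simp add: algebra_simps eval_nat_numeral)
      from this[OF p] show ?thesis
        by (simp add: \<phi>'_def P_def \<phi>_def p_def)
    qed
    \<comment> \<open>That is, \<open>1 - w = ((1 - u) / (1 + u))^2\<close>. This supplies the
      factor \<open>1 - P\<close> needed to eliminate the second derivative by Gauss's
      equation.\<close>
    have e2: "(1 - u)\<^sup>2 = p\<^sup>2 * (1 - P)"
      using P unfolding right_diff_distrib by (simp add: p_def power2_eq_square algebra_simps)
    have "(1 - u\<^sup>2) * (u * deriv y u) = ((1 - u\<^sup>2) * (u * \<phi>' u)) * (D1 + P * D2)"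
      unfolding DERIV_imp_deriv[OF dy[OF u]] by (simp add: D1_def D2_def P_def)
    also have "\<dots> = (1 - u)\<^sup>2 * P * D1 + (1 - u)\<^sup>2 * P * P * D2"
      unfolding e1 by (simp add: algebra_simps)
    also have "(1 - u)\<^sup>2 * P * P * D2 = (p\<^sup>2 * P) * (P * (1 - P) * D2)"
      unfolding e2 by (simp add: algebra_simps)
    also have "P * (1 - P) * D2 = ((a + b + 1) * P - c) * D1 + a * b * h u"
      using F(3)[OF u] by (simp add: P_def D1_def D2_def h_def algebra_simps)
    also have "(1 - u)\<^sup>2 * P * D1 + p\<^sup>2 * P * (((a + b + 1) * P - c) * D1 + a * b * h u)
        = ((1 - u)\<^sup>2 + (p\<^sup>2 * P) * (a + b + 1) - c * p\<^sup>2) * (P * D1) + a * b * (p\<^sup>2 * P) * h u"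
      by (simp add: algebra_simps)
    also have "\<dots> = (4 * (a + b) * u - (c - 1) * (1 + u)\<^sup>2) * (P * D1) + 4 * a * b * u * h u"
      by (simp only: P) (simp add: p_def algebra_simps power2_eq_square)
    also have "P * D1 = y u" by (simp add: y_def P_def D1_def)
    finally show ?thesis .
  qed
  define H where "H = fps_expansion h 0"
  define Y where "Y = fps_expansion y 0"
  have hol: "h holomorphic_on ball 0 (1 / 8)" "y holomorphic_on ball 0 (1 / 8)"
    by (subst holomorphic_on_open; use dh dy in force)+
  have expH: "h has_fps_expansion H" and expY: "y has_fps_expansion Y"
    unfolding H_def Y_def by (rule has_fps_expansion_fps_expansion[of "ball 0 (1 / 8)"]; use hol in simp)+
  have ev: "eventually (\<lambda>u :: complex. u \<in> ball 0 (1 / 8)) (nhds 0)"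
    by (intro eventually_nhds_in_open) auto
  have "(\<lambda>u. (1 + u) * (u * deriv h u) - (1 - u) * y u) has_fps_expansion
      ((1 + fps_X) * (fps_X * fps_deriv H) - (1 - fps_X) * Y)"
    by (intro fps_expansion_intros expH expY)
  moreover have "(\<lambda>u. (1 + u) * (u * deriv h u) - (1 - u) * y u) has_fps_expansion 0"
    unfolding has_fps_expansion_0_iff using ev by eventually_elim (use id1 in auto)
  ultimately have E1: "(1 + fps_X) * (fps_X * fps_deriv H) - (1 - fps_X) * Y = 0"
    by (rule fps_expansion_unique_complex)
  have "(\<lambda>u. (1 - u\<^sup>2) * (u * deriv y u) - ((4 * (a + b) * u - (c - 1) * (1 + u)\<^sup>2) * y u + 4 * a * b * u * h u))
      has_fps_expansion
      ((1 - fps_X\<^sup>2) * (fps_X * fps_deriv Y) - ((fps_const (4 * (a + b)) * fps_X - fps_const (c - 1) * (1 + fps_X)\<^sup>2) * Y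
         + fps_const (4 * a * b) * fps_X * H))"
    by (intro fps_expansion_intros expH expY)
  moreover have "(\<lambda>u. (1 - u\<^sup>2) * (u * deriv y u) - ((4 * (a + b) * u - (c - 1) * (1 + u)\<^sup>2) * y u + 4 * a * b * u * h u))
      has_fps_expansion 0"
    unfolding has_fps_expansion_0_iff using ev by eventually_elim (use id2 in auto)
  ultimately have E2: "(1 - fps_X\<^sup>2) * (fps_X * fps_deriv Y) - ((fps_const (4 * (a + b)) * fps_X - fps_const (c - 1) * (1 + fps_X)\<^sup>2) * Y
         + fps_const (4 * a * b) * fps_X * H) = 0"
    by (rule fps_expansion_unique_complex)
  have X: "fps_nth (fps_X * fps_deriv G) n = of_nat n * fps_nth G n" for G :: "complex fps" and n
    by (cases n) auto
  have X1: "fps_nth (fps_X * G) (n + 2) = fps_nth G (n + 1)" "fps_nth (fps_X * G) (n + 1) = fps_nth G n"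
    for G :: "complex fps" and n by simp_all
  have XD: "fps_nth (fps_deriv G) (n + 1) = of_nat (n + 2) * fps_nth G (n + 2)"
    for G :: "complex fps" and n by simp
  have r1: "of_nat (n + 2) * fps_nth H (n + 2) = fps_nth Y (n + 2) - fps_nth Y (n + 1) - of_nat (n + 1) * fps_nth H (n + 1)" for n
  proof -
    have "(1 + fps_X) * (fps_X * fps_deriv H) - (1 - fps_X) * Y
       = fps_X * fps_deriv H + fps_X * (fps_X * fps_deriv H) - Y + fps_X * Y"
      by (simp add: algebra_simps)
    from E1[unfolded this, THEN arg_cong, of "\<lambda>F. fps_nth F (n + 2)"]
    show ?thesis by (simp add: X algebra_simps del: fps_X_mult_nth) (simp add: X algebra_simps)
  qed
  have r2: "(of_nat (n + 2) + (c - 1)) * fps_nth Y (n + 2) = of_nat n * fps_nth Y n + 4 * (a + b) * fps_nth Y (n + 1)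
      - (c - 1) * (2 * fps_nth Y (n + 1) + fps_nth Y n) + 4 * a * b * fps_nth H (n + 1)" for n
  proof -
    have "(1 - fps_X\<^sup>2) * (fps_X * fps_deriv Y) - ((fps_const (4 * (a + b)) * fps_X - fps_const (c - 1) * (1 + fps_X)\<^sup>2) * Y
         + fps_const (4 * a * b) * fps_X * H)
       = fps_X * fps_deriv Y - fps_X * (fps_X * (fps_X * fps_deriv Y)) - fps_const (4 * (a + b)) * (fps_X * Y)
         + fps_const (c - 1) * (Y + (fps_X * Y + fps_X * Y) + fps_X * (fps_X * Y)) - fps_const (4 * a * b) * (fps_X * H)"
      by (simp add: algebra_simps power2_eq_square)
    from E2[unfolded this, THEN arg_cong, of "\<lambda>F. fps_nth F (n + 2)"]
    have "of_nat (n + 2) * fps_nth Y (n + 2) - of_nat n * fps_nth Y n - 4 * (a + b) * fps_nth Y (n + 1)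
      + (c - 1) * (fps_nth Y (n + 2) + (fps_nth Y (n + 1) + fps_nth Y (n + 1)) + fps_nth Y n)
      - 4 * a * b * fps_nth H (n + 1) = 0"
      by (simp only: fps_add_nth fps_sub_nth fps_mult_left_const_nth X X1 XD fps_zero_nth)
    then show ?thesis by (simp add: algebra_simps)
  qed
  \<comment> \<open>The recurrences \<open>r1\<close> and \<open>r2\<close> couple the two series
    and reach back two indices. A running maximum over both series makes the previous terms bounded
    by one number.\<close>
  define M where "M n = Max ((\<lambda>i. max (norm (fps_nth H i)) (norm (fps_nth Y i))) ` {..n})" for n
  have Mge: "norm (fps_nth H i) \<le> M n" "norm (fps_nth Y i) \<le> M n" if "i \<le> n" for i n
  proof -
    have "max (norm (fps_nth H i)) (norm (fps_nth Y i)) \<le> M n"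
      unfolding M_def using that by (intro Max_ge) auto
    then show "norm (fps_nth H i) \<le> M n" "norm (fps_nth Y i) \<le> M n" by auto
  qed
  have MSuc: "M (Suc n) = max (max (norm (fps_nth H (Suc n))) (norm (fps_nth Y (Suc n)))) (M n)" for n
    unfolding M_def atMost_Suc image_insert by (rule Max_insert) auto
  have M0: "M n \<ge> 0" for n using Mge(1)[of n n] norm_ge_zero order_trans by blast
  have "conv_radius (fps_nth H) \<ge> 1"
  proof (rule conv_radius_ge_1_if_ratio_bound)
    show "norm (fps_nth H n) \<le> M n" for n by (rule Mge) simp
    fix R :: real assume R: "R > 1"
    \<comment> \<open>The sum of the norms of the constant coefficients in \<open>r2\<close>; the 3
      is 2 + 1 from the two terms multiplied by \<open>c - 1\<close>.\<close>
    define K where "K = 4 * norm (a + b) + 3 * norm (c - 1) + norm (4 * a * b)"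
    have "(\<lambda>n. (real n + K) / (real n + 2 - norm (c - 1))) \<longlonglongrightarrow> 1" by real_asymp
    from order_tendstoD(2)[OF this R]
    have "eventually (\<lambda>n. (real n + K) / (real n + 2 - norm (c - 1)) < R) sequentially" .
    moreover have "eventually (\<lambda>n. real n + 2 - norm (c - 1) > 0) sequentially" by real_asymp
    \<comment> \<open>\<open>R\<close> appears in the numerator because the estimate of
      \<open>H\<close> at \<open>n + 2\<close> uses the bound \<open>R * m\<close> for
      \<open>Y\<close> at the same index.\<close>
    moreover have "(\<lambda>n. (real n + 2 + R) / (real n + 2)) \<longlonglongrightarrow> 1" by real_asymp
    from order_tendstoD(2)[OF this R]
    have "eventually (\<lambda>n. (real n + 2 + R) / (real n + 2) < R) sequentially" .
    ultimately have "eventually (\<lambda>n. M (Suc (Suc n)) \<le> R * M (Suc n)) sequentially"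
    proof eventually_elim
      case (elim n)
      define m where "m = M (n + 1)"
      have m: "m \<ge> 0" "norm (fps_nth Y n) \<le> m" "norm (fps_nth Y (n + 1)) \<le> m" "norm (fps_nth H (n + 1)) \<le> m"
        using M0 Mge by (auto simp: m_def)
      have "(real n + 2 - norm (c - 1)) * norm (fps_nth Y (n + 2))
          \<le> norm (of_nat (n + 2) + (c - 1)) * norm (fps_nth Y (n + 2))"
      proof (rule mult_right_mono)
        have "norm (of_nat (n + 2) :: complex) = real n + 2" by (simp only: norm_of_nat)
        then show "real n + 2 - norm (c - 1) \<le> norm (of_nat (n + 2) + (c - 1))"
          using norm_diff_ineq[of "of_nat (n + 2)" "c - 1"] by (simp only:)
      qed simp
      also have "\<dots> = norm (of_nat n * fps_nth Y n + 4 * (a + b) * fps_nth Y (n + 1)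
           - (c - 1) * (2 * fps_nth Y (n + 1) + fps_nth Y n) + 4 * a * b * fps_nth H (n + 1))"
        by (simp only: r2 norm_mult[symmetric])
      also have "\<dots> \<le> real n * norm (fps_nth Y n) + 4 * norm (a + b) * norm (fps_nth Y (n + 1))
           + norm (c - 1) * (2 * norm (fps_nth Y (n + 1)) + norm (fps_nth Y n)) + norm (4 * a * b) * norm (fps_nth H (n + 1))"
      proof -
        have 1: "norm ((c - 1) * (2 * fps_nth Y (n + 1) + fps_nth Y n)) \<le> norm (c - 1) * (2 * norm (fps_nth Y (n + 1)) + norm (fps_nth Y n))"
          unfolding norm_mult by (intro mult_left_mono order_trans[OF norm_triangle_ineq]) (auto simp: norm_mult)
        have "norm (A + B - C + D) \<le> norm A + norm B + norm C + norm D" for A B C D :: complex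
          by (meson add_mono norm_triangle_ineq norm_triangle_ineq4 order_refl order_trans)
        from this[of "of_nat n * fps_nth Y n" "4 * (a + b) * fps_nth Y (n + 1)"
            "(c - 1) * (2 * fps_nth Y (n + 1) + fps_nth Y n)" "4 * a * b * fps_nth H (n + 1)"]
        have "norm (of_nat n * fps_nth Y n + 4 * (a + b) * fps_nth Y (n + 1)
           - (c - 1) * (2 * fps_nth Y (n + 1) + fps_nth Y n) + 4 * a * b * fps_nth H (n + 1))
          \<le> norm (of_nat n * fps_nth Y n) + norm (4 * (a + b) * fps_nth Y (n + 1))
            + norm (c - 1) * (2 * norm (fps_nth Y (n + 1)) + norm (fps_nth Y n)) + norm (4 * a * b * fps_nth H (n + 1))"
          using 1 by linarith
        moreover have "norm (of_nat n * fps_nth Y n) = real n * norm (fps_nth Y n)"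
          "norm (4 * (a + b) * fps_nth Y (n + 1)) = 4 * norm (a + b) * norm (fps_nth Y (n + 1))"
          "norm (4 * a * b * fps_nth H (n + 1)) = norm (4 * a * b) * norm (fps_nth H (n + 1))"
          by (simp_all only: norm_mult norm_of_nat norm_numeral)
        ultimately show ?thesis by (simp only:)
      qed
      also have "\<dots> \<le> real n * m + 4 * norm (a + b) * m + norm (c - 1) * (2 * m + m) + norm (4 * a * b) * m"
        using m by (intro add_mono mult_left_mono) auto
      also have "\<dots> = (real n + K) * m" by (simp add: K_def algebra_simps)
      also have "\<dots> \<le> ((real n + 2 - norm (c - 1)) * R) * m"
        using elim m by (intro mult_right_mono) (auto simp: divide_less_eq mult_ac)
      finally have Yb: "norm (fps_nth Y (n + 2)) \<le> R * m"
        using elim by (simp add: mult.assoc)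
      have "(real n + 2) * norm (fps_nth H (n + 2)) = norm (of_nat (n + 2) * fps_nth H (n + 2))"
        by (simp only: norm_mult norm_of_nat) simp
      also have "\<dots> \<le> norm (fps_nth Y (n + 2)) + norm (fps_nth Y (n + 1)) + real (n + 1) * norm (fps_nth H (n + 1))"
      proof -
        have "norm (A - B - C) \<le> norm A + norm B + norm C" for A B C :: complex
          by (meson add_mono norm_triangle_ineq4 order_refl order_trans)
        from this[of "fps_nth Y (n + 2)" "fps_nth Y (n + 1)" "of_nat (n + 1) * fps_nth H (n + 1)"]
        show ?thesis unfolding r1 by (simp only: norm_mult norm_of_nat)
      qed
      also have "\<dots> \<le> R * m + m + real (n + 1) * m"
        using m Yb by (intro add_mono mult_left_mono) auto
      also have "\<dots> = (real n + 2 + R) * m" by (simp add: algebra_simps)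
      also have "\<dots> \<le> ((real n + 2) * R) * m"
        using elim m by (intro mult_right_mono) (auto simp: divide_less_eq mult_ac)
      finally have Hb: "norm (fps_nth H (n + 2)) \<le> R * m" by (simp add: mult.assoc)
      have "m \<le> R * m" using R m mult_right_mono[of 1 R m] by simp
      then show ?case using Yb Hb by (simp add: MSuc[of "Suc n"] m_def)
    qed
    then show "eventually (\<lambda>n. M (Suc n) \<le> R * M n) sequentially"
      by (subst (asm) eventually_sequentially_Suc)
  qed
  then have "fps_conv_radius H \<ge> 1" by (simp add: fps_conv_radius_def)
  moreover have "eventually (\<lambda>u. eval_fps H u = hgf a b c (4 * u / (1 + u)\<^sup>2)) (nhds 0)"
    using expH by (simp add: has_fps_expansion_def h_def f_def \<phi>_def)
  ultimately show ?thesis using that by blast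
qed

text \<open>The inverse of \<open>w = 4 * u / (1 + u)^2\<close> is \<open>(1 - r) / (1 + r)\<close>
  with \<open>r\<close> the principal root of \<open>1 - w\<close>. On the slit plane
  \<open>Re r > 0\<close>, which is the same as \<open>|u| < 1\<close>, so the series in
  \<open>u\<close> can be composed with it.\<close>

lemma hgf_continuation:
  "\<exists>g. g holomorphic_on slit_plane \<and> (\<forall>w\<in>ball 0 1. g w = hgf a b c w)"
proof -
  obtain H where H: "fps_conv_radius H \<ge> 1"
    and ev: "eventually (\<lambda>u. eval_fps H u = hgf a b c (4 * u / (1 + u)\<^sup>2)) (nhds 0)"
    by (rule hgf_pullback)
  define r where "r w = csqrt (1 - w)" for w
  define u where "u w = (1 - r w) / (1 + r w)" for w
  have r: "Re (r w) > 0" if "w \<in> slit_plane" for w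
  proof -
    have "1 - w \<notin> \<real>\<^sub>\<le>\<^sub>0" using that by (simp add: slit_plane_iff)
    moreover have "Re (r w) = 0 \<Longrightarrow> 1 - w \<in> \<real>\<^sub>\<le>\<^sub>0"
    proof -
      assume "Re (r w) = 0"
      moreover have "(r w)\<^sup>2 = 1 - w" unfolding r_def by (rule power2_csqrt)
      ultimately show "1 - w \<in> \<real>\<^sub>\<le>\<^sub>0"
        using zero_le_square[of "Im (r w)"] unfolding complex_nonpos_Reals_iff complex_eq_iff power2_eq_square
        by (simp, linarith)
    qed
    ultimately show ?thesis using csqrt_principal[of "1 - w"] unfolding r_def by force
  qed
  have r1: "1 + r w \<noteq> 0" if "w \<in> slit_plane" for w
    using r[OF that] by (auto simp: complex_eq_iff)
  have u: "norm (u w) < 1" if "w \<in> slit_plane" for w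
  proof -
    have "norm (1 - r w) ^ 2 < norm (1 + r w) ^ 2"
      using r[OF that] unfolding cmod_power2 by (simp add: power2_eq_square algebra_simps)
    then have "norm (1 - r w) < norm (1 + r w)"
      by (rule power_less_imp_less_base) simp
    then show ?thesis using r1[OF that] by (simp add: u_def norm_divide)
  qed
  have uw: "4 * u w / (1 + u w)\<^sup>2 = w" if "w \<in> slit_plane" for w
  proof -
    have "4 * ((1 - q) / (1 + q)) / (1 + (1 - q) / (1 + q))\<^sup>2 = 1 - q\<^sup>2" if "1 + q \<noteq> 0" for q :: complex
    proof -
      have e: "1 + (1 - q) / (1 + q) = 2 / (1 + q)" using that by (simp add: divide_simps)
      show ?thesis unfolding e using that by (simp add: power_divide power2_eq_square divide_simps) (simp add: algebra_simps)
    qed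
    from this[OF r1[OF that]] show ?thesis by (simp add: u_def r_def)
  qed
  have holu: "u holomorphic_on slit_plane"
    unfolding u_def r_def
    by (intro holomorphic_intros) (use r1 in \<open>auto simp: slit_plane_iff r_def\<close>)
  define g where "g = eval_fps H \<circ> u"
  have holg: "g holomorphic_on slit_plane"
    unfolding g_def
  proof (rule holomorphic_on_compose_gen[OF holu])
    show "eval_fps H holomorphic_on ball 0 1"
      using H ball_eball_mono[of 1 "fps_conv_radius H" 0]
      by (intro holomorphic_on_eval_fps) (simp add: one_ereal_def)
  qed (use u in auto)
  have z0: "0 \<in> slit_plane" using ball_subset_slit_plane by force
  have "isCont u 0"
    using holomorphic_on_imp_continuous_on[OF holu] open_slit_plane z0
    by (simp add: continuous_on_eq_continuous_at)
  moreover have "u 0 = 0" by (simp add: u_def r_def)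
  ultimately have "filterlim u (nhds 0) (nhds 0)"
    by (metis isCont_def tendsto_at_iff_tendsto_nhds)
  from filterlim_iff[THEN iffD1, OF this, rule_format, OF ev]
  have "eventually (\<lambda>w. eval_fps H (u w) = hgf a b c (4 * u w / (1 + u w)\<^sup>2)) (nhds 0)" .
  moreover have "eventually (\<lambda>w. w \<in> ball 0 1) (nhds (0::complex))"
    by (intro eventually_nhds_in_open) auto
  ultimately have "eventually (\<lambda>w. w \<in> ball 0 1 \<and> g w = hgf a b c w) (nhds 0)"
    by eventually_elim (use uw ball_subset_slit_plane in \<open>auto simp: g_def\<close>)
  then obtain S where S: "open S" "0 \<in> S" "\<And>w. w \<in> S \<Longrightarrow> w \<in> ball 0 1 \<and> g w = hgf a b c w"
    by (auto simp: eventually_nhds)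
  have "g w = hgf a b c w" if "w \<in> ball 0 1" for w
    by (rule analytic_continuation_open[of S "ball 0 1" g "hgf a b c"])
       (use S that hgf_holomorphic holomorphic_on_subset[OF holg ball_subset_slit_plane] in auto)
  with holg show ?thesis by blast
qed

lemma analytic_continuation_works:
  assumes "\<exists>g. g holomorphic_on S \<and> (\<forall>z\<in>A. g z = f z)"
  shows "analytic_continuation f A S holomorphic_on S" "\<And>z. z \<in> A \<Longrightarrow> analytic_continuation f A S z = f z"
  using someI_ex[OF assms] unfolding analytic_continuation_def by blast+

lemma hgf_eq_suminf:
  "hgf a b c w = (\<Sum>n. pochhammer a n * pochhammer b n * rGamma (c + of_nat n) * w ^ n / fact n)"
  by (simp add: eval_fps_def hgf_fps_def)

lemma hyp2F1_reg_props:
  "hyp2F1_reg a b c holomorphic_on slit_plane" "norm w < 1 \<Longrightarrow> hyp2F1_reg a b c w = hgf a b c w"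
  using analytic_continuation_works[OF hgf_continuation[of a b c, unfolded hgf_eq_suminf]]
  unfolding hyp2F1_reg_def hgf_eq_suminf by auto

lemma hyp2F1_props:
  assumes c: "c \<notin> \<int>\<^sub>\<le>\<^sub>0"
  shows "hyp2F1 a b c holomorphic_on slit_plane" "norm w < 1 \<Longrightarrow> hyp2F1 a b c w = Gamma c * hgf a b c w"
proof -
  have G: "Gamma c \<noteq> 0" using c by (simp add: Gamma_eq_zero_iff)
  have eq: "(\<Sum>n. pochhammer a n * pochhammer b n / pochhammer c n * w ^ n / fact n) = Gamma c * hgf a b c w"
    if "w \<in> ball 0 1" for w
  proof -
    have "ereal (norm w) < 1" using that by (simp add: one_ereal_def)
    then have "ereal (norm w) < fps_conv_radius (hgf_fps a b c)"
      using fps_conv_radius_hgf[of a b c] by order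
    from sums_mult[OF sums_eval_fps[OF this], of "Gamma c"]
    have "(\<lambda>n. Gamma c * (pochhammer a n * pochhammer b n * rGamma (c + of_nat n) * w ^ n / fact n)) sums (Gamma c * hgf a b c w)"
      by (simp add: hgf_fps_def)
    then show ?thesis
      unfolding hyp2F1_reg_coeff[OF c] using G by (simp add: sums_iff)
  qed
  obtain g where g: "g holomorphic_on slit_plane" "\<forall>w\<in>ball 0 1. g w = hgf a b c w"
    using hgf_continuation by blast
  have "\<exists>g. g holomorphic_on slit_plane \<and>
     (\<forall>w\<in>ball 0 1. g w = (\<Sum>n. pochhammer a n * pochhammer b n / pochhammer c n * w ^ n / fact n))"
    by (rule exI[of _ "\<lambda>w. Gamma c * g w"]) (use g eq in \<open>auto intro!: holomorphic_intros\<close>)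
  from analytic_continuation_works[OF this]
  show "hyp2F1 a b c holomorphic_on slit_plane" "norm w < 1 \<Longrightarrow> hyp2F1 a b c w = Gamma c * hgf a b c w"
    using eq unfolding hyp2F1_def by auto
qed

section \<open>The quadratic transformation\<close>

text \<open>As a function of \<open>t\<close>, the left-hand side is regular at 0 with value
  \<open>rGamma ((a + b + 1) / 2)\<close> and solves the equation of the right-hand side. The radius
  is merely small enough to keep the inner argument in the unit disc.\<close>

lemma hgf_quadratic:
  assumes \<gamma>: "(a + b + 1) / 2 \<notin> \<int>\<^sub>\<le>\<^sub>0" and t: "norm t < 1 / 20"
  shows "(1 - 2 * t) powr (- a) * hgf (a / 2) ((a + 1) / 2) ((a + b + 1) / 2) (1 - 1 / (1 - 2 * t)\<^sup>2)
    = hgf a b ((a + b + 1) / 2) t"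
proof -
  define \<gamma> where "\<gamma> = (a + b + 1) / 2"
  \<comment> \<open>Since \<open>p' = 2 * p^2\<close> and \<open>E' = 2 * a * p * E\<close>, the
    derivatives of \<open>f\<close> remain \<open>E\<close> times polynomials in \<open>p\<close>
    and the derivatives of \<open>G\<close>.\<close>
  define p where "p t = inverse (1 - 2 * t)" for t :: complex
  define E where "E t = (1 - 2 * t) powr (- a)" for t :: complex
  define G where "G = hgf (a / 2) ((a + 1) / 2) \<gamma>"
  define G' where "G' = eval_fps (fps_deriv (hgf_fps (a / 2) ((a + 1) / 2) \<gamma>))"
  define G'' where "G'' = eval_fps (fps_deriv (fps_deriv (hgf_fps (a / 2) ((a + 1) / 2) \<gamma>)))"
  define f where "f t = E t * G (1 - (p t)\<^sup>2)" for t
  define f' where "f' t = E t * (2 * a * p t * G (1 - (p t)\<^sup>2) - 4 * (p t) ^ 3 * G' (1 - (p t)\<^sup>2))" for t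
  define f'' where "f'' t = E t * (4 * a * (a + 1) * (p t)\<^sup>2 * G (1 - (p t)\<^sup>2)
     - (16 * a + 24) * (p t) ^ 4 * G' (1 - (p t)\<^sup>2) + 16 * (p t) ^ 6 * G'' (1 - (p t)\<^sup>2))" for t
  have solG: "hgf_solution (a / 2) ((a + 1) / 2) \<gamma> G G' G'' (ball 0 1)"
    unfolding G_def G'_def G''_def by (rule hgf_solution_hgf)
  have sol: "hgf_solution a b \<gamma> f f' f'' (ball 0 (1 / 20))"
    unfolding hgf_solution_def
  proof (intro ballI conjI)
    fix t :: complex assume "t \<in> ball 0 (1 / 20)"
    then have t: "norm t < 1 / 20" by simp
    define q where "q = 1 - 2 * t"
    \<comment> \<open>Used for \<open>|X| * |q|^2 = 4 * |t| * |1 - t| <= 21 / 100 < (9 / 10)^2 <=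
      |q|^2\<close>.\<close>
    have nq: "norm q \<ge> 9 / 10"
      using norm_triangle_ineq2[of 1 "2 * t"] t by (simp add: q_def norm_mult)
    have q0: "q \<noteq> 0" using nq by auto
    have "Re q > 0" using complex_Re_le_cmod[of t] t by (simp add: q_def)
    then have qR: "q \<notin> \<real>\<^sub>\<le>\<^sub>0" by (auto simp: complex_nonpos_Reals_iff)
    define P where "P = p t"
    have P: "P * q = 1" using q0 by (simp add: P_def p_def q_def[symmetric])
    have tq: "t = (1 - q) / 2" by (simp add: q_def)
    define X where "X = 1 - P\<^sup>2"
    have X1: "norm X < 1"
    proof -
      have "X * q\<^sup>2 = - (4 * t * (1 - t))"
      proof -
        have "X * q\<^sup>2 = q\<^sup>2 - (P * q)\<^sup>2" by (simp add: X_def algebra_simps power_mult_distrib)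
        then show ?thesis unfolding P by (simp add: q_def power2_eq_square algebra_simps)
      qed
      then have "norm X * norm q ^ 2 = 4 * norm t * norm (1 - t)"
        by (metis norm_minus_cancel norm_mult norm_numeral norm_power)
      also have "\<dots> \<le> 4 * (1 / 20) * (21 / 20)"
      proof (intro mult_mono)
        show "norm (1 - t) \<le> 21 / 20" using norm_triangle_ineq4[of 1 t] t by simp
      qed (use t in auto)
      finally have "norm X * norm q ^ 2 < (9 / 10) ^ 2" by (simp add: power2_eq_square)
      moreover have "(9 / 10) ^ 2 \<le> norm q ^ 2" using nq by (intro power_mono) auto
      ultimately have "norm X * norm q ^ 2 < 1 * norm q ^ 2" by linarith
      then show ?thesis by (rule mult_right_less_imp_less) simp
    qed
    have dG: "(G has_field_derivative G' X) (at X)" "(G' has_field_derivative G'' X) (at X)"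
      and ode: "X * (1 - X) * G'' X + (\<gamma> - (a / 2 + (a + 1) / 2 + 1) * X) * G' X - a / 2 * ((a + 1) / 2) * G X = 0"
      using solG X1 by (auto simp: hgf_solution_def)
    have dq: "((\<lambda>t. 1 - 2 * t) has_field_derivative - 2) (at t)"
      by (auto intro!: derivative_eq_intros)
    have dp: "(p has_field_derivative 2 * P\<^sup>2) (at t)"
      using DERIV_inverse_fun[OF dq] q0 unfolding p_def q_def[symmetric]
      by (simp add: P_def p_def q_def[symmetric] power2_eq_square)
    have dE: "(E has_field_derivative 2 * a * P * E t) (at t)"
    proof -
      have "q powr (- a + - 1) = q powr (- a) * q powr (- 1)" by (rule powr_add)
      also have "q powr (-1) = P" using q0 by (simp add: powr_minus P_def p_def q_def)
      finally have "(- a) * q powr (- a - 1) * (- 2) = 2 * a * P * q powr (- a)" by simp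
      from DERIV_cong[OF DERIV_chain2[OF has_field_derivative_powr[OF qR[unfolded q_def], of "- a"] dq] this[unfolded q_def]]
      show ?thesis by (simp only: E_def[abs_def])
    qed
    have dX: "((\<lambda>t. 1 - (p t)\<^sup>2) has_field_derivative - (4 * P ^ 3)) (at t)"
      by (rule DERIV_cong[OF DERIV_diff[OF DERIV_const DERIV_power[OF dp, of 2]]])
         (simp add: P_def[symmetric] eval_nat_numeral)
    have XE: "1 - (p t)\<^sup>2 = X" by (simp add: X_def P_def)
    have XP: "1 - P\<^sup>2 = X" by (simp add: X_def)
    have dGX: "((\<lambda>t. G (1 - (p t)\<^sup>2)) has_field_derivative G' X * - (4 * P ^ 3)) (at t)"
      by (rule DERIV_chain2[OF _ dX]) (simp add: XE dG)
    have dG'X: "((\<lambda>t. G' (1 - (p t)\<^sup>2)) has_field_derivative G'' X * - (4 * P ^ 3)) (at t)"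
      by (rule DERIV_chain2[OF _ dX]) (simp add: XE dG)
    have three: "(3 :: nat) - Suc 0 = 2" by simp
    have alg: "2 * a * Q * e * (2 * a * Q * g - 4 * Q ^ 3 * g')
        + (2 * a * (2 * Q\<^sup>2) * g + g' * - (4 * Q ^ 3) * (2 * a * Q)
           - (4 * (3 * (2 * Q\<^sup>2 * Q ^ 2)) * g' + g'' * - (4 * Q ^ 3) * (4 * Q ^ 3))) * e
      = e * (4 * a * (a + 1) * Q\<^sup>2 * g - (16 * a + 24) * Q ^ 4 * g' + 16 * Q ^ 6 * g'')" for Q e g g' g''
      by (simp add: algebra_simps eval_nat_numeral)
    show "(f has_field_derivative f' t) (at t)"
      unfolding f_def f'_def
      by (rule DERIV_cong[OF DERIV_mult[OF dE dGX]])
         (simp only: XP P_def[symmetric], simp add: algebra_simps)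
    show "(f' has_field_derivative f'' t) (at t)"
      unfolding f'_def f''_def
      by (rule DERIV_cong[OF DERIV_mult[OF dE DERIV_diff[OF DERIV_mult[OF DERIV_cmult[OF dp] dGX]
             DERIV_mult[OF DERIV_cmult[OF DERIV_power[OF dp]] dG'X]]]])
         (simp only: XP P_def[symmetric] of_nat_numeral three alg)
    define e where "e = E t"
    have F: "f t = e * G X" "f' t = e * P * (2 * a * G X - 4 * P\<^sup>2 * G' X)"
      "f'' t = e * P\<^sup>2 * (4 * a * (a + 1) * G X - (16 * a + 24) * P\<^sup>2 * G' X + 16 * P ^ 4 * G'' X)"
      by (simp_all only: f_def f'_def f''_def XP P_def[symmetric] e_def,
          simp_all add: algebra_simps eval_nat_numeral)
    have c1: "t * (1 - t) * P\<^sup>2 = (P\<^sup>2 - 1) / 4"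
    proof -
      have "t * (1 - t) = (1 - q\<^sup>2) / 4" unfolding tq by (simp add: power2_eq_square field_simps)
      then have "t * (1 - t) * P\<^sup>2 = (P\<^sup>2 - (P * q)\<^sup>2) / 4"
        by (simp only: power_mult_distrib) (simp add: algebra_simps)
      then show ?thesis by (simp add: P)
    qed
    have c2: "(\<gamma> - (a + b + 1) * t) * P = \<gamma>"
    proof -
      have "(\<gamma> - (a + b + 1) * t) = \<gamma> * q" by (simp add: \<gamma>_def q_def field_simps)
      then show ?thesis using P by (simp add: mult_ac)
    qed
    have "t * (1 - t) * f'' t + (\<gamma> - (a + b + 1) * t) * f' t - a * b * f t
       = e * ((t * (1 - t) * P\<^sup>2) * (4 * a * (a + 1) * G X - (16 * a + 24) * P\<^sup>2 * G' X + 16 * P ^ 4 * G'' X)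
          + ((\<gamma> - (a + b + 1) * t) * P) * (2 * a * G X - 4 * P\<^sup>2 * G' X) - a * b * G X)"
    proof -
      have "A * (e * P\<^sup>2 * K) + B * (e * P * L) - a * b * (e * g) = e * ((A * P\<^sup>2) * K + (B * P) * L - a * b * g)" for A B K L g
        by (simp add: algebra_simps)
      then show ?thesis unfolding F .
    qed
    \<comment> \<open>The Gauss operator on \<open>f\<close> is a multiple of the one on
      \<open>G\<close> at \<open>X\<close>; after \<open>1 - X = P^2\<close> this is a polynomial
      identity in \<open>P\<close>.\<close>
    also have "\<dots> = - 4 * P\<^sup>2 * e * (X * (1 - X) * G'' X + (\<gamma> - (a / 2 + (a + 1) / 2 + 1) * X) * G' X - a / 2 * ((a + 1) / 2) * G X)"
    proof -
      have "e * (((Q\<^sup>2 - 1) / 4) * (4 * a * (a + 1) * g - (16 * a + 24) * Q\<^sup>2 * g' + 16 * Q ^ 4 * g'')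
          + ((a + b + 1) / 2) * (2 * a * g - 4 * Q\<^sup>2 * g') - a * b * g)
        = - 4 * Q\<^sup>2 * e * ((1 - Q\<^sup>2) * (1 - (1 - Q\<^sup>2)) * g''
          + ((a + b + 1) / 2 - (a / 2 + (a + 1) / 2 + 1) * (1 - Q\<^sup>2)) * g' - a / 2 * ((a + 1) / 2) * g)" for Q g g' g''
        by (simp add: field_simps eval_nat_numeral)
      then show ?thesis unfolding c1 c2 unfolding XP[symmetric] \<gamma>_def .
    qed
    finally show "t * (1 - t) * f'' t + (\<gamma> - (a + b + 1) * t) * f' t - a * b * f t = 0"
      unfolding ode by simp
  qed
  have f0: "f 0 = rGamma \<gamma>" by (simp add: f_def E_def p_def G_def hgf_0)
  have "f t = f 0 * Gamma \<gamma> * hgf a b \<gamma> t"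
    using \<gamma> t by (intro hgf_solution_unique_unit_ball[OF sol]) (auto simp: \<gamma>_def)
  moreover have "rGamma \<gamma> * Gamma \<gamma> = 1"
    using \<gamma> by (simp add: \<gamma>_def Gamma_def rGamma_eq_zero_iff)
  ultimately have "f t = hgf a b \<gamma> t" unfolding f0 by (simp only: mult_1)
  moreover have "(p t)\<^sup>2 = 1 / (1 - 2 * t)\<^sup>2"
    unfolding p_def inverse_eq_divide by (rule power_one_over)
  ultimately show ?thesis by (simp only: f_def E_def G_def \<gamma>_def)
qed

text \<open>Legendre's duplication formula for reciprocals. At the poles of either factor both sides
  vanish, so no exceptions remain.\<close>

lemma rGamma_duplication:
  fixes x :: complex
  shows "rGamma (x / 2) * rGamma ((x + 1) / 2) = 2 powr (x - 1) / of_real (sqrt pi) * rGamma x"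
proof (cases "x / 2 \<in> \<int>\<^sub>\<le>\<^sub>0 \<or> (x + 1) / 2 \<in> \<int>\<^sub>\<le>\<^sub>0")
  case True
  then have "x \<in> \<int>\<^sub>\<le>\<^sub>0"
  proof
    assume "x / 2 \<in> \<int>\<^sub>\<le>\<^sub>0"
    then obtain n where "n \<le> 0" "x / 2 = of_int n" by (auto elim!: nonpos_Ints_cases)
    then have "x = of_int (2 * n)" "2 * n \<le> 0" by (auto simp: field_simps)
    then show ?thesis by (metis nonpos_Ints_of_int)
  next
    assume "(x + 1) / 2 \<in> \<int>\<^sub>\<le>\<^sub>0"
    then obtain n where "n \<le> 0" "(x + 1) / 2 = of_int n" by (auto elim!: nonpos_Ints_cases)
    then have "x = of_int (2 * n - 1)" "2 * n - 1 \<le> 0" by (auto simp: field_simps)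
    then show ?thesis by (metis nonpos_Ints_of_int)
  qed
  then have "rGamma x = 0" by (simp add: rGamma_eq_zero_iff)
  moreover have "rGamma (x / 2) * rGamma ((x + 1) / 2) = 0" using True by (auto simp: rGamma_eq_zero_iff)
  ultimately show ?thesis by simp
next
  case False
  have e: "x / 2 + 1 / 2 = (x + 1) / 2" by (simp add: field_simps)
  have "Gamma (x / 2) * Gamma ((x + 1) / 2) = exp ((1 - x) * of_real (ln 2)) * of_real (sqrt pi) * Gamma x"
    using Gamma_legendre_duplication[of "x / 2"] False unfolding e by simp
  then have "inverse (Gamma (x / 2) * Gamma ((x + 1) / 2)) = inverse (exp ((1 - x) * of_real (ln 2)) * of_real (sqrt pi) * Gamma x)"
    by simp
  moreover have "inverse (exp ((1 - x) * of_real (ln 2))) = (2 :: complex) powr (x - 1)"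
  proof -
    have L: "Ln 2 = complex_of_real (ln 2)" using Ln_of_real[of 2] by simp
    have "- ((1 - x) * complex_of_real (ln 2)) = (x - 1) * complex_of_real (ln 2)" by (simp add: algebra_simps)
    moreover have "(2 :: complex) powr (x - 1) = exp ((x - 1) * complex_of_real (ln 2))"
      unfolding powr_def L by (simp only: if_False rel_simps)
    ultimately show ?thesis by (simp only: exp_minus[symmetric])
  qed
  ultimately show ?thesis
    by (simp only: Gamma_def inverse_mult_distrib inverse_inverse_eq divide_inverse)
qed

section \<open>Branches of the logarithm in the half-planes\<close>

text \<open>The sign \<open>\<epsilon>\<close> selects the upper or the lower half-plane, so that
  both boundary values are obtained from one argument.\<close>

lemma Im_Ln_halfplane:
  assumes "\<epsilon> = 1 \<or> \<epsilon> = - 1" "\<epsilon> * Im z > 0"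
  shows "0 < \<epsilon> * Im (Ln z)" "\<epsilon> * Im (Ln z) < pi"
proof -
  have z: "z \<noteq> 0" using assms by auto
  have "0 < \<epsilon> * Im (Ln z) \<and> \<epsilon> * Im (Ln z) < pi"
    using assms(1)
  proof
    assume \<epsilon>: "\<epsilon> = 1"
    then have "Im z > 0" using assms(2) by simp
    from Im_Ln_pos_lt_imp[OF this] show ?thesis by (simp add: \<epsilon>)
  next
    assume \<epsilon>: "\<epsilon> = - 1"
    then have "\<not> 0 \<le> Im z" using assms(2) by simp
    then have "\<not> (0 \<le> Im (Ln z) \<and> Im (Ln z) \<le> pi)" unfolding Im_Ln_pos_le[OF z] .
    then have "Im (Ln z) < 0" using Im_Ln_le_pi[OF z] by linarith
    then show ?thesis using mpi_less_Im_Ln[OF z] by (simp add: \<epsilon>)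
  qed
  then show "0 < \<epsilon> * Im (Ln z)" "\<epsilon> * Im (Ln z) < pi" by blast+
qed

text \<open>Arguments of two points of the same half-plane differ by less than pi, so the difference
  of the logarithms is again principal.\<close>

lemma Ln_divide_halfplane:
  assumes \<epsilon>: "\<epsilon> = 1 \<or> \<epsilon> = - 1" and z: "\<epsilon> * Im z > 0" "\<epsilon> * Im w > 0"
  shows "Ln (z / w) = Ln z - Ln w"
proof (rule Ln_unique)
  have "z \<noteq> 0" "w \<noteq> 0" using z by auto
  then show "exp (Ln z - Ln w) = z / w" by (simp add: exp_diff)
  show "- pi < Im (Ln z - Ln w)" "Im (Ln z - Ln w) \<le> pi"
    using Im_Ln_halfplane[OF \<epsilon> z(1)] Im_Ln_halfplane[OF \<epsilon> z(2)] \<epsilon> by auto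
qed

text \<open>The factors \<open>1 - 1 / z\<close> and \<open>1 + 1 / z\<close> lie in opposite
  half-planes, so the sum of their logarithms needs no multiple of 2 pi i.\<close>

lemma Ln_one_minus_inverse_square:
  assumes \<epsilon>: "\<epsilon> = 1 \<or> \<epsilon> = - 1" and z: "\<epsilon> * Im z > 0"
  shows "Ln (1 - 1 / z\<^sup>2) = Ln (z - 1) + Ln (z + 1) - 2 * Ln z"
proof -
  have z0: "z \<noteq> 0" using z by auto
  have z1: "z - 1 \<noteq> 0" "z + 1 \<noteq> 0" using z by (auto simp: complex_eq_iff)
  have L: "Ln (1 - 1 / z) = Ln (z - 1) - Ln z" "Ln (1 + 1 / z) = Ln (z + 1) - Ln z"
    using Ln_divide_halfplane[OF \<epsilon>, of "z - 1" z] Ln_divide_halfplane[OF \<epsilon>, of "z + 1" z] z z0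
    by (simp_all add: diff_divide_distrib add_divide_distrib)
  have "Im (1 / z) = - Im z / (norm z)\<^sup>2"
    by (simp add: Im_divide cmod_power2)
  then have I: "\<epsilon> * Im (1 - 1 / z) > 0" "(- \<epsilon>) * Im (1 + 1 / z) > 0"
    using z z0 by (auto simp: zero_less_divide_iff)
  have \<epsilon>': "- \<epsilon> = 1 \<or> - \<epsilon> = - 1" using \<epsilon> by auto
  have "Ln (1 - 1 / z\<^sup>2) = Ln (1 - 1 / z) + Ln (1 + 1 / z)"
  proof (rule Ln_unique)
    have "exp (Ln (z - 1) - Ln z + (Ln (z + 1) - Ln z)) = (z - 1) / z * ((z + 1) / z)"
      using z0 z1 by (simp only: exp_add exp_diff exp_Ln not_False_eq_True)
    also have "\<dots> = 1 - 1 / z\<^sup>2" using z0 by (simp add: field_simps power2_eq_square)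
    finally show "exp (Ln (1 - 1 / z) + Ln (1 + 1 / z)) = 1 - 1 / z\<^sup>2" by (simp add: L)
    show "- pi < Im (Ln (1 - 1 / z) + Ln (1 + 1 / z))" "Im (Ln (1 - 1 / z) + Ln (1 + 1 / z)) \<le> pi"
      using Im_Ln_halfplane[OF \<epsilon> I(1)] Im_Ln_halfplane[OF \<epsilon>' I(2)] \<epsilon> by auto
  qed
  then show ?thesis by (simp add: L)
qed

lemma Ln_minus_halfplane:
  assumes \<epsilon>: "\<epsilon> = 1 \<or> \<epsilon> = - 1" and z: "\<epsilon> * Im z > 0"
  shows "Ln z = Ln (- z) + \<i> * of_real (\<epsilon> * pi)"
proof -
  have "z \<noteq> 0" using z by auto
  from Ln_minus[OF this] show ?thesis using \<epsilon> z by auto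
qed

text \<open>This is \<open>Gamma (1 + \<mu>)\<close> times the Ferrers function of the first kind of
  degree \<open>\<nu>\<close> and order \<open>- \<mu>\<close> at \<open>- z\<close>. The quotient
  power is split, so that the logarithms of \<open>z + 1\<close> and \<open>1 - z\<close> can be
  handled separately.\<close>

definition legendre_S :: "complex \<Rightarrow> complex \<Rightarrow> complex \<Rightarrow> complex" where
  "legendre_S \<nu> \<mu> z = (z + 1) powr (\<mu> / 2) * (1 - z) powr (- \<mu> / 2) * hyp2F1 (- \<nu>) (\<nu> + 1) (1 + \<mu>) ((1 + z) / 2)"

text \<open>The quadratic transformation with parameters \<open>\<nu> + \<mu> + 1\<close>,
  \<open>\<mu> - \<nu>\<close> and \<open>t = (1 + z) / 2\<close> applies, because
  \<open>1 - 2 * t = - z\<close>. Euler's transformation then yields the parameters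
  \<open>- \<nu>\<close>, \<open>\<nu> + 1\<close>.\<close>

lemma legendre_near_minus_1:
  assumes \<epsilon>: "\<epsilon> = 1 \<or> \<epsilon> = - 1" and z: "\<epsilon> * Im z > 0" and near: "norm (z + 1) < 1 / 10"
    and \<mu>: "1 + \<mu> \<notin> \<int>\<^sub>\<le>\<^sub>0"
  shows "(z + 1) powr (\<mu> / 2) * (z - 1) powr (\<mu> / 2) * z powr (- (\<nu> + \<mu> + 1)) *
      hgf ((\<nu> + \<mu> + 2) / 2) ((\<nu> + \<mu> + 1) / 2) (1 + \<mu>) (1 - 1 / z\<^sup>2)
    = exp (- (\<i> * of_real (\<epsilon> * pi) * (\<nu> + \<mu> / 2 + 1))) * 2 powr \<mu> * rGamma (1 + \<mu>) * legendre_S \<nu> \<mu> z"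
proof -
  define t where "t = (1 + z) / 2"
  have t: "norm t < 1 / 20" using near by (simp add: t_def norm_divide add.commute)
  have z0: "z \<noteq> 0" "- z \<noteq> 0" "z - 1 \<noteq> 0" "1 - z \<noteq> 0" using z by auto
  have zt: "1 - 2 * t = - z" "1 - t = (1 - z) / 2" by (simp_all add: t_def field_simps)
  have g: "(\<nu> + \<mu> + 1 + (\<mu> - \<nu>) + 1) / 2 = 1 + \<mu>" by (simp add: field_simps)
  have Q: "(- z) powr (- (\<nu> + \<mu> + 1)) * hgf ((\<nu> + \<mu> + 2) / 2) ((\<nu> + \<mu> + 1) / 2) (1 + \<mu>) (1 - 1 / z\<^sup>2)
     = hgf (\<nu> + \<mu> + 1) (\<mu> - \<nu>) (1 + \<mu>) t"
  proof -
    have e: "\<nu> + \<mu> + 1 + 1 = \<nu> + \<mu> + 2" by simp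
    have "hgf ((\<nu> + \<mu> + 2) / 2) ((\<nu> + \<mu> + 1) / 2) (1 + \<mu>) = hgf ((\<nu> + \<mu> + 1) / 2) ((\<nu> + \<mu> + 2) / 2) (1 + \<mu>)"
      by (simp only: hgf_fps_commute)
    then show ?thesis
      using hgf_quadratic[of "\<nu> + \<mu> + 1" "\<mu> - \<nu>" t] \<mu> t unfolding g zt e by simp
  qed
  have "hgf (\<nu> + \<mu> + 1) (\<mu> - \<nu>) (1 + \<mu>) t = (1 - t) powr (- \<mu>) * hgf (- \<nu>) (\<nu> + 1) (1 + \<mu>) t"
    using hgf_euler[OF \<mu>, of t "\<nu> + \<mu> + 1" "\<mu> - \<nu>"] t by (simp add: add_ac)
  also have "hgf (- \<nu>) (\<nu> + 1) (1 + \<mu>) t = rGamma (1 + \<mu>) * hyp2F1 (- \<nu>) (\<nu> + 1) (1 + \<mu>) t"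
    using hyp2F1_props(2)[OF \<mu>, of t] t \<mu> by (simp add: Gamma_def rGamma_eq_zero_iff)
  also have "(1 - t) powr (- \<mu>) = 2 powr \<mu> * (1 - z) powr (- \<mu>)"
  proof -
    have "Ln ((1 - z) / 2) = Ln (1 - z) - Ln 2"
      using Ln_divide_of_real[of 2 "1 - z"] Ln_of_real[of 2, symmetric] z0 by simp
    then have "(1 - t) powr (- \<mu>) = exp (- \<mu> * (Ln (1 - z) - Ln 2))"
      unfolding zt using z0 by (simp add: powr_def)
    also have "\<dots> = exp (\<mu> * Ln 2 + - \<mu> * Ln (1 - z))" by (simp add: algebra_simps)
    also have "\<dots> = 2 powr \<mu> * (1 - z) powr (- \<mu>)" using z0 by (simp only: exp_add) (simp add: powr_def)
    finally show ?thesis .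
  qed
  finally have main: "(- z) powr (- (\<nu> + \<mu> + 1)) * hgf ((\<nu> + \<mu> + 2) / 2) ((\<nu> + \<mu> + 1) / 2) (1 + \<mu>) (1 - 1 / z\<^sup>2)
     = 2 powr \<mu> * (1 - z) powr (- \<mu>) * (rGamma (1 + \<mu>) * hyp2F1 (- \<nu>) (\<nu> + 1) (1 + \<mu>) t)"
    using Q by simp
  define I where "I = \<i> * complex_of_real (\<epsilon> * pi)"
  \<comment> \<open>Passing from \<open>z\<close>, \<open>z - 1\<close> to \<open>- z\<close>,
    \<open>1 - z\<close> shifts each logarithm by \<open>I\<close>; the exponents add up to
    \<open>\<mu> / 2 - (\<nu> + \<mu> + 1) = - (\<nu> + \<mu> / 2 + 1)\<close>.\<close>
  have "(z - 1) powr (\<mu> / 2) * z powr (- (\<nu> + \<mu> + 1))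
     = exp (- (I * (\<nu> + \<mu> / 2 + 1))) * (1 - z) powr (\<mu> / 2) * (- z) powr (- (\<nu> + \<mu> + 1))"
  proof -
    have "Ln z = Ln (- z) + I" "Ln (z - 1) = Ln (1 - z) + I"
      using Ln_minus_halfplane[OF \<epsilon>, of z] Ln_minus_halfplane[OF \<epsilon>, of "z - 1"] z
      by (simp_all add: I_def)
    then show ?thesis
      using z0 by (simp add: powr_def exp_add[symmetric] algebra_simps)
  qed
  then have "(z + 1) powr (\<mu> / 2) * (z - 1) powr (\<mu> / 2) * z powr (- (\<nu> + \<mu> + 1)) *
      hgf ((\<nu> + \<mu> + 2) / 2) ((\<nu> + \<mu> + 1) / 2) (1 + \<mu>) (1 - 1 / z\<^sup>2)
    = (z + 1) powr (\<mu> / 2) * exp (- (I * (\<nu> + \<mu> / 2 + 1))) * (1 - z) powr (\<mu> / 2) *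
       ((- z) powr (- (\<nu> + \<mu> + 1)) * hgf ((\<nu> + \<mu> + 2) / 2) ((\<nu> + \<mu> + 1) / 2) (1 + \<mu>) (1 - 1 / z\<^sup>2))"
  proof -
    have "Z * A * B * h = Z * e * C * (D * h)" if "A * B = e * C * D" for Z A B h e C D :: complex
    proof -
      have "Z * A * B * h = Z * (A * B) * h" by (simp only: mult.assoc)
      then show ?thesis unfolding that by (simp only: mult.assoc)
    qed
    then show "(z - 1) powr (\<mu> / 2) * z powr (- (\<nu> + \<mu> + 1))
     = exp (- (I * (\<nu> + \<mu> / 2 + 1))) * (1 - z) powr (\<mu> / 2) * (- z) powr (- (\<nu> + \<mu> + 1)) \<Longrightarrow> ?thesis" .
  qed
  also have "\<dots> = exp (- (I * (\<nu> + \<mu> / 2 + 1))) * 2 powr \<mu> * rGamma (1 + \<mu>) *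
       ((z + 1) powr (\<mu> / 2) * ((1 - z) powr (\<mu> / 2) * (1 - z) powr (- \<mu>)) * hyp2F1 (- \<nu>) (\<nu> + 1) (1 + \<mu>) t)"
    unfolding main by (simp only: mult_ac)
  also have "(1 - z) powr (\<mu> / 2) * (1 - z) powr (- \<mu>) = (1 - z) powr (- \<mu> / 2)"
    by (simp add: powr_add[symmetric])
  finally show ?thesis by (simp add: legendre_S_def t_def I_def)
qed

section \<open>Boundary values of the Legendre function\<close>

lemma D1_iff: "x \<in> D1 \<longleftrightarrow> 1 - x \<notin> \<real>\<^sub>\<le>\<^sub>0 \<and> 1 + x \<notin> \<real>\<^sub>\<le>\<^sub>0"
proof -
  have "x \<in> D1 \<longleftrightarrow> x \<in> slit_plane \<and> x \<notin> complex_of_real ` {..-1}"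
    by (auto simp: D1_def slit_plane_def)
  moreover have "x \<in> complex_of_real ` {..-1} \<longleftrightarrow> 1 + x \<in> \<real>\<^sub>\<le>\<^sub>0"
  proof
    assume "1 + x \<in> \<real>\<^sub>\<le>\<^sub>0"
    then have "x = complex_of_real (Re x)" "Re x \<le> - 1"
      by (auto simp: complex_nonpos_Reals_iff complex_eq_iff)
    then show "x \<in> complex_of_real ` {..-1}" by force
  qed (auto simp: complex_nonpos_Reals_iff)
  ultimately show ?thesis by (simp add: slit_plane_iff)
qed

lemma open_D1: "open D1"
proof -
  have "D1 = (\<lambda>x. 1 - x) -` (- \<real>\<^sub>\<le>\<^sub>0) \<inter> (\<lambda>x. 1 + x) -` (- \<real>\<^sub>\<le>\<^sub>0)"
    by (auto simp: D1_iff)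
  moreover have "open ((\<lambda>x :: complex. 1 - x) -` (- \<real>\<^sub>\<le>\<^sub>0) \<inter> (\<lambda>x. 1 + x) -` (- \<real>\<^sub>\<le>\<^sub>0))"
    by (intro open_Int open_vimage continuous_intros) (simp_all add: open_Compl)
  ultimately show ?thesis by (simp only:)
qed

lemma D1_I: "Im x \<noteq> 0 \<or> (- 1 < Re x \<and> Re x < 1) \<Longrightarrow> x \<in> D1"
  by (auto simp: D1_iff complex_nonpos_Reals_iff)

lemma D1_D: "x \<in> D1 \<Longrightarrow> Im x \<noteq> 0 \<or> (- 1 < Re x \<and> Re x < 1)"
  by (auto simp: D1_iff complex_nonpos_Reals_iff)

lemma connected_D1: "connected D1"
proof (rule starlike_imp_connected)
  show "starlike D1"
    unfolding starlike_def
  proof (intro bexI[of _ 0] ballI subsetI)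
    fix x y :: complex assume x: "x \<in> D1" "y \<in> closed_segment 0 x"
    then obtain u where u: "0 \<le> u" "u \<le> 1" "y = of_real u * x"
      by (auto simp: in_segment scaleR_conv_of_real)
    show "y \<in> D1"
    proof (cases "Im x = 0 \<or> u = 0")
      case True
      have "\<bar>u * Re x\<bar> < 1"
      proof (cases "u = 0")
        case False
        then have "\<bar>Re x\<bar> < 1" using D1_D[OF x(1)] True by auto
        moreover have "\<bar>u * Re x\<bar> \<le> 1 * \<bar>Re x\<bar>"
          unfolding abs_mult using u by (intro mult_right_mono) auto
        ultimately show ?thesis by linarith
      qed simp
      then show ?thesis using u by (intro D1_I) auto
    next
      case False
      then show ?thesis using u by (intro D1_I) auto
    qed
  qed (auto intro: D1_I)
qed

text \<open>Makes the quotient powers of the final formula holomorphic on \<open>D1\<close>: a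
  nonpositive real quotient forces \<open>x\<close> to be real, and then outside (-1, 1).\<close>

lemma D1_quotient:
  assumes "x \<in> D1"
  shows "(1 - x) / (1 + x) \<notin> \<real>\<^sub>\<le>\<^sub>0" "1 + x \<noteq> 0" "1 - x \<noteq> 0"
proof -
  show nz: "1 + x \<noteq> 0" "1 - x \<noteq> 0" using assms by (auto simp: D1_iff)
  show "(1 - x) / (1 + x) \<notin> \<real>\<^sub>\<le>\<^sub>0"
  proof
    assume "(1 - x) / (1 + x) \<in> \<real>\<^sub>\<le>\<^sub>0"
    then obtain r where r: "r \<le> 0" "(1 - x) / (1 + x) = of_real r" by (auto elim!: nonpos_Reals_cases)
    then have e: "1 - x = of_real r * (1 + x)" using nz by (simp add: field_simps)
    have im: "- Im x = r * Im x" and re: "1 - Re x = r * (1 + Re x)"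
      using arg_cong[OF e, of Im] arg_cong[OF e, of Re] by simp_all
    have "r \<noteq> - 1" using re by auto
    then have "Im x = 0" using im by (metis mult_cancel_right mult_minus1)
    then have "- 1 < Re x" "Re x < 1" using D1_D[OF assms] by auto
    moreover have "r * (1 + Re x) \<le> 0" using r(1) \<open>- 1 < Re x\<close> by (intro mult_nonpos_nonneg) auto
    ultimately show False using re by linarith
  qed
qed

lemma D1_quotient':
  assumes "x \<in> D1"
  shows "(1 + x) / (1 - x) \<notin> \<real>\<^sub>\<le>\<^sub>0"
proof -
  have "- x \<in> D1" using assms by (simp add: D1_iff)
  from D1_quotient(1)[OF this] show ?thesis by simp
qed

lemma hyp2F1_holomorphic_D1:
  assumes "c \<notin> \<int>\<^sub>\<le>\<^sub>0"
  shows "(\<lambda>x. hyp2F1 a b c ((1 + x) / 2)) holomorphic_on D1"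
proof -
  have "hyp2F1 a b c \<circ> (\<lambda>x. (1 + x) / 2) holomorphic_on D1"
  proof (rule holomorphic_on_compose_gen[OF _ hyp2F1_props(1)[OF assms]])
    show "(\<lambda>x. (1 + x) / 2) ` D1 \<subseteq> slit_plane"
    proof safe
      fix x assume x: "x \<in> D1"
      have "1 - (1 + x) / 2 = (1 - x) / 2" by (simp add: field_simps)
      moreover have "(1 - x) / 2 \<notin> \<real>\<^sub>\<le>\<^sub>0" using x by (auto simp: D1_iff complex_nonpos_Reals_iff)
      ultimately show "(1 + x) / 2 \<in> slit_plane" by (simp only: slit_plane_iff not_False_eq_True)
    qed
  qed (intro holomorphic_intros, simp)
  then show ?thesis by (simp add: o_def)
qed

lemma legendre_S_holomorphic:
  assumes "1 + \<mu> \<notin> \<int>\<^sub>\<le>\<^sub>0"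
  shows "legendre_S \<nu> \<mu> holomorphic_on D1"
  unfolding legendre_S_def[abs_def]
  by (intro holomorphic_intros hyp2F1_holomorphic_D1 assms) (auto simp: D1_iff add.commute)

definition halfplane :: "real \<Rightarrow> complex set" where
  "halfplane \<epsilon> = {z. \<epsilon> * Im z > 0}"

lemma open_halfplane: "open (halfplane \<epsilon>)"
  unfolding halfplane_def by (intro open_Collect_less continuous_intros)

lemma connected_halfplane: "connected (halfplane \<epsilon>)"
proof (rule convex_connected, rule convexI)
  fix x y u v assume *: "x \<in> halfplane \<epsilon>" "y \<in> halfplane \<epsilon>" "0 \<le> u" "0 \<le> v" "u + v = (1::real)"
  have "0 < u * (\<epsilon> * Im x) + v * (\<epsilon> * Im y)"
  proof (cases "u = 0")
    case False
    then have "0 < u * (\<epsilon> * Im x)" "0 \<le> v * (\<epsilon> * Im y)" using * by (auto simp: halfplane_def)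
    then show ?thesis by linarith
  qed (use * in \<open>auto simp: halfplane_def\<close>)
  then show "u *\<^sub>R x + v *\<^sub>R y \<in> halfplane \<epsilon>" by (simp add: halfplane_def algebra_simps)
qed

text \<open>Makes \<open>legendre_Q\<close> holomorphic in the whole half-plane, including points
  with \<open>1 / z^2\<close> outside the disc of convergence. A value of at least 1 would make
  \<open>z\<close> real.\<close>

lemma halfplane_inverse_square:
  assumes z: "Im z \<noteq> 0"
  shows "1 / z\<^sup>2 \<in> slit_plane"
proof -
  have "1 / z\<^sup>2 \<notin> complex_of_real ` {1..}"
  proof
    assume "1 / z\<^sup>2 \<in> complex_of_real ` {1..}"
    then obtain r where r: "r \<ge> 1" "1 / z\<^sup>2 = of_real r" by auto
    have "z \<noteq> 0" using z by auto
    then have e: "of_real r * z\<^sup>2 = 1" using r(2) by (simp add: field_simps)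
    have "Im (of_real r * z\<^sup>2) = r * (2 * Re z * Im z)" "Re (of_real r * z\<^sup>2) = r * ((Re z)\<^sup>2 - (Im z)\<^sup>2)"
      by (simp_all add: power2_eq_square)
    then have "r * (2 * Re z * Im z) = 0" and re: "r * ((Re z)\<^sup>2 - (Im z)\<^sup>2) = 1" using e by simp_all
    then have "Re z = 0" using r(1) z by auto
    then have "r * (Im z)\<^sup>2 = - 1" using re by simp
    moreover have "r * (Im z)\<^sup>2 \<ge> 0" using r(1) by simp
    ultimately show False by linarith
  qed
  then show ?thesis by (simp add: slit_plane_def)
qed

lemma legendre_Q_holomorphic: "legendre_Q \<nu> \<mu> holomorphic_on halfplane \<epsilon>"
proof -
  have nR: "z \<notin> \<real>\<^sub>\<le>\<^sub>0" "z + 1 \<notin> \<real>\<^sub>\<le>\<^sub>0" "z - 1 \<notin> \<real>\<^sub>\<le>\<^sub>0" "z \<noteq> 0" "Im z \<noteq> 0" if "z \<in> halfplane \<epsilon>" for z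
    using that by (auto simp: halfplane_def complex_nonpos_Reals_iff)
  have "hyp2F1_reg a b c \<circ> (\<lambda>z. 1 / z\<^sup>2) holomorphic_on halfplane \<epsilon>" for a b c
    by (rule holomorphic_on_compose_gen[OF _ hyp2F1_reg_props(1)])
       (auto intro!: holomorphic_intros halfplane_inverse_square dest: nR)
  then have F: "(\<lambda>z. hyp2F1_reg a b c (1 / z\<^sup>2)) holomorphic_on halfplane \<epsilon>" for a b c
    by (simp add: o_def)
  show ?thesis
    unfolding legendre_Q_def[abs_def]
    by (intro holomorphic_intros F) (auto dest: nR)
qed

text \<open>For noninteger \<open>\<mu>\<close> this continues
  \<open>exp (- i pi \<mu>) * legendre_Q\<close> from the half-plane of sign
  \<open>\<epsilon>\<close> across (-1, 1): it is holomorphic on \<open>D1\<close>, so its values on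
  the cut are the boundary values.\<close>

definition legendre_boundary :: "real \<Rightarrow> complex \<Rightarrow> complex \<Rightarrow> complex \<Rightarrow> complex" where
  "legendre_boundary \<epsilon> \<nu> \<mu> z = 1 / 2 *
     (Gamma (- \<mu>) * (Gamma (\<nu> + \<mu> + 1) * rGamma (\<nu> - \<mu> + 1)) *
        exp (- (\<i> * of_real (\<epsilon> * pi) * (\<nu> + \<mu> / 2 + 1))) * legendre_S \<nu> \<mu> z
      + Gamma \<mu> * exp (- (\<i> * of_real (\<epsilon> * pi) * (\<nu> - \<mu> / 2 + 1))) * legendre_S \<nu> (- \<mu>) z)"

lemma Ints_not_nonpos:
  assumes "\<mu> \<notin> \<int>"
  shows "1 + \<mu> \<notin> \<int>\<^sub>\<le>\<^sub>0" "1 - \<mu> \<notin> \<int>\<^sub>\<le>\<^sub>0" "- \<mu> \<notin> \<int>" "\<mu> \<notin> \<int>\<^sub>\<le>\<^sub>0" "- \<mu> \<notin> \<int>\<^sub>\<le>\<^sub>0"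
proof -
  have "1 + \<mu> \<notin> \<int>" using assms by (metis Ints_1 Ints_diff add_diff_cancel_left')
  moreover have "1 - \<mu> \<notin> \<int>" using assms by (metis Ints_1 Ints_diff diff_diff_eq2 add_diff_cancel_left')
  moreover show "- \<mu> \<notin> \<int>" using assms by (simp add: minus_in_Ints_iff)
  ultimately show "1 + \<mu> \<notin> \<int>\<^sub>\<le>\<^sub>0" "1 - \<mu> \<notin> \<int>\<^sub>\<le>\<^sub>0" "\<mu> \<notin> \<int>\<^sub>\<le>\<^sub>0" "- \<mu> \<notin> \<int>\<^sub>\<le>\<^sub>0"
    using assms nonpos_Ints_subset_Ints by blast+
qed

lemma legendre_Q_near_minus_1:
  assumes \<epsilon>: "\<epsilon> = 1 \<or> \<epsilon> = - 1" and z: "z \<in> halfplane \<epsilon>" "norm (z + 1) < 1 / 10" "norm z > 1"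
    and \<mu>: "\<mu> \<notin> \<int>" and \<nu>: "\<nu> + \<mu> + 1 \<notin> \<int>\<^sub>\<le>\<^sub>0"
  shows "exp (- (\<i> * of_real pi * \<mu>)) * legendre_Q \<nu> \<mu> z = legendre_boundary \<epsilon> \<nu> \<mu> z"
proof -
  note \<mu>' = Ints_not_nonpos[OF \<mu>]
  have zI: "\<epsilon> * Im z > 0" using z by (simp add: halfplane_def)
  have z0: "z \<noteq> 0" using zI by auto
  define w where "w = 1 / z\<^sup>2"
  define a b c where "a = (\<nu> + \<mu> + 2) / 2" and "b = (\<nu> + \<mu> + 1) / 2" and "c = \<nu> + 3 / 2"
  have ca: "c - a = (\<nu> - \<mu> + 1) / 2" "c - b = (\<nu> - \<mu> + 2) / 2" "c - a - b = - \<mu>" "a + b - c + 1 = 1 + \<mu>"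
    by (simp_all add: a_def b_def c_def field_simps)
  \<comment> \<open>\<open>|z| > 1\<close> gives \<open>|w| < 1\<close>, and
    \<open>1 - w = (z - 1) * (z + 1) / z^2\<close> is below \<open>3 / 10\<close> in norm, with 3 as
    a crude bound for \<open>|z - 1|\<close>.\<close>
  have w: "w \<in> lens"
  proof -
    have nz: "norm z ^ 2 > 1" using z by (simp add: one_less_power)
    have "norm w < 1" using nz by (simp add: w_def norm_divide norm_power divide_less_eq)
    moreover have "norm (1 - w) < 1"
    proof -
      have "1 - w = (z - 1) * (z + 1) / z\<^sup>2" using z0 by (simp add: w_def field_simps power2_eq_square)
      then have "norm (1 - w) = norm (z - 1) * norm (z + 1) / norm z ^ 2"
        by (simp add: norm_divide norm_mult norm_power)
      also have "\<dots> < 1"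
      proof -
        have "norm (z - 1) \<le> norm (z + 1) + norm (2 :: complex)"
          using norm_triangle_ineq4[of "z + 1" 2] by (simp add: algebra_simps)
        then have "norm (z - 1) * norm (z + 1) \<le> 3 * (1 / 10)" using z by (intro mult_mono) auto
        then show ?thesis using nz by (simp add: divide_less_eq)
      qed
      finally show ?thesis .
    qed
    ultimately show ?thesis by (simp add: lens_def dist_norm)
  qed
  define Z where "Z = (z + 1) powr (\<mu> / 2) * (z - 1) powr (\<mu> / 2)"
  define W where "W = z powr (- (\<nu> + \<mu> + 1))"
  define E1 where "E1 = exp (- (\<i> * of_real (\<epsilon> * pi) * (\<nu> + \<mu> / 2 + 1)))"
  define E2 where "E2 = exp (- (\<i> * of_real (\<epsilon> * pi) * (\<nu> - \<mu> / 2 + 1)))"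
  have U1: "Z * W * hgf1 a b c w = E1 * 2 powr \<mu> * rGamma (1 + \<mu>) * legendre_S \<nu> \<mu> z"
    using legendre_near_minus_1[OF \<epsilon> zI z(2) \<mu>'(1), of \<nu>]
    unfolding hgf1_def ca(4) unfolding Z_def W_def E1_def w_def a_def b_def by (simp only:)
  \<comment> \<open>The factor \<open>(1 - w) powr (- \<mu>)\<close> of \<open>hgf2\<close> reverses
    the sign of \<open>\<mu>\<close> in the whole prefactor, so this is \<open>U1\<close> for
    \<open>- \<mu>\<close>.\<close>
  have U2: "Z * W * hgf2 a b c w = E2 * 2 powr (- \<mu>) * rGamma (1 - \<mu>) * legendre_S \<nu> (- \<mu>) z"
  proof -
    have nz: "1 - w \<noteq> 0" "z + 1 \<noteq> 0" "z - 1 \<noteq> 0" using lens_memD[OF w] zI by (auto simp: complex_eq_iff)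
    have "Z * W * (1 - w) powr (- \<mu>) = (z + 1) powr (- \<mu> / 2) * (z - 1) powr (- \<mu> / 2) * z powr (- (\<nu> + - \<mu> + 1))"
    proof -
      have "Ln (1 - w) = Ln (z - 1) + Ln (z + 1) - 2 * Ln z"
        unfolding w_def by (rule Ln_one_minus_inverse_square[OF \<epsilon> zI])
      then have "Z * W * (1 - w) powr (- \<mu>) = exp (\<mu> / 2 * Ln (z + 1) + \<mu> / 2 * Ln (z - 1) + - (\<nu> + \<mu> + 1) * Ln z + - \<mu> * (Ln (z - 1) + Ln (z + 1) - 2 * Ln z))"
        unfolding Z_def W_def powr_def using nz z0 by (simp only: exp_add if_False)
      also have "\<mu> / 2 * Ln (z + 1) + \<mu> / 2 * Ln (z - 1) + - (\<nu> + \<mu> + 1) * Ln z + - \<mu> * (Ln (z - 1) + Ln (z + 1) - 2 * Ln z)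
         = - \<mu> / 2 * Ln (z + 1) + - \<mu> / 2 * Ln (z - 1) + - (\<nu> + - \<mu> + 1) * Ln z"
        by (simp add: field_simps)
      finally show ?thesis unfolding powr_def using nz z0 by (simp only: exp_add if_False)
    qed
    moreover have "hgf (c - a) (c - b) (c - a - b + 1) (1 - w) = hgf ((\<nu> + - \<mu> + 2) / 2) ((\<nu> + - \<mu> + 1) / 2) (1 + - \<mu>) (1 - w)"
      unfolding ca(3) unfolding ca(1,2) by (subst hgf_fps_commute) simp
    ultimately have "Z * W * hgf2 a b c w = (z + 1) powr (- \<mu> / 2) * (z - 1) powr (- \<mu> / 2) * z powr (- (\<nu> + - \<mu> + 1)) *
        hgf ((\<nu> + - \<mu> + 2) / 2) ((\<nu> + - \<mu> + 1) / 2) (1 + - \<mu>) (1 - w)"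
      unfolding hgf2_def ca(3) by (simp only: mult.assoc[symmetric])
    also have "\<dots> = exp (- (\<i> * of_real (\<epsilon> * pi) * (\<nu> + - \<mu> / 2 + 1))) * 2 powr (- \<mu>) * rGamma (1 + - \<mu>) * legendre_S \<nu> (- \<mu>) z"
      unfolding w_def using legendre_near_minus_1[OF \<epsilon> zI z(2), of "- \<mu>" \<nu>] \<mu>'(2) by simp
    finally show ?thesis by (simp add: E2_def)
  qed
  define \<sigma> where "\<sigma> = sin (of_real pi * \<mu>) / complex_of_real pi"
  define R where "R = complex_of_real (sqrt pi)"
  have R0: "R \<noteq> 0" by (simp add: R_def)
  have \<sigma>0: "\<sigma> \<noteq> 0" using sin_pi_ne_0[OF \<mu>] by (simp add: \<sigma>_def)
  have "c - a - b \<notin> \<int>" unfolding ca(3) by (rule \<mu>'(3))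
  from hgf_connection[OF this w]
  have conn: "- \<sigma> * hgf a b c w = rGamma (c - a) * rGamma (c - b) * hgf1 a b c w - rGamma a * rGamma b * hgf2 a b c w"
    unfolding ca(3) by (simp add: \<sigma>_def)
  have d1: "rGamma (c - a) * rGamma (c - b) = 2 powr (\<nu> - \<mu>) / R * rGamma (\<nu> - \<mu> + 1)"
    using rGamma_duplication[of "\<nu> - \<mu> + 1"] unfolding ca(1,2) R_def by (simp add: add.assoc)
  have d2: "rGamma a * rGamma b = 2 powr (\<nu> + \<mu>) / R * rGamma (\<nu> + \<mu> + 1)"
    using rGamma_duplication[of "\<nu> + \<mu> + 1"] unfolding a_def b_def R_def by (simp add: add.assoc mult.commute)
  define \<Gamma>1 where "\<Gamma>1 = Gamma (\<nu> + \<mu> + 1)"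
  have \<Gamma>1: "\<Gamma>1 * rGamma (\<nu> + \<mu> + 1) = 1" using \<nu> by (simp add: \<Gamma>1_def Gamma_def rGamma_eq_zero_iff)
  have Q: "exp (- (\<i> * of_real pi * \<mu>)) * legendre_Q \<nu> \<mu> z = R * \<Gamma>1 * 2 powr (- (\<nu> + 1)) * (Z * W * hgf a b c w)"
  proof -
    have "hyp2F1_reg a b c w = hgf a b c w" using hyp2F1_reg_props(2) lens_memD(1)[OF w] by blast
    then have "legendre_Q \<nu> \<mu> z = R * exp (\<i> * of_real pi * \<mu>) * \<Gamma>1 * Z / (2 powr (\<nu> + 1) * z powr (\<nu> + \<mu> + 1)) * hgf a b c w"
      unfolding legendre_Q_def a_def b_def c_def w_def R_def \<Gamma>1_def Z_def by (simp only:)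
    then show ?thesis
      unfolding W_def powr_minus exp_minus by (simp add: field_simps)
  qed
  \<comment> \<open>The powers of 2 come from the normalization of Q, the duplication formula and
    Euler's factor at \<open>(1 - z) / 2\<close>; together they leave the \<open>1 / 2\<close> of
    \<open>legendre_boundary\<close>.\<close>
  have p: "2 powr (- (\<nu> + 1)) * 2 powr (\<nu> - \<mu>) * 2 powr \<mu> = (1 / 2 :: complex)"
       "2 powr (- (\<nu> + 1)) * 2 powr (\<nu> + \<mu>) * 2 powr (- \<mu>) = (1 / 2 :: complex)"
  proof -
    have "- (\<nu> + 1) + (\<nu> - \<mu>) + \<mu> = - 1" "- (\<nu> + 1) + (\<nu> + \<mu>) + - \<mu> = - 1" by simp_all
    moreover have "2 powr (- 1) = (1 / 2 :: complex)" by (simp add: powr_minus_divide)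
    ultimately show "2 powr (- (\<nu> + 1)) * 2 powr (\<nu> - \<mu>) * 2 powr \<mu> = (1 / 2 :: complex)"
       "2 powr (- (\<nu> + 1)) * 2 powr (\<nu> + \<mu>) * 2 powr (- \<mu>) = (1 / 2 :: complex)"
      by (simp_all only: powr_add[symmetric])
  qed
  have "- \<sigma> * (exp (- (\<i> * of_real pi * \<mu>)) * legendre_Q \<nu> \<mu> z)
      = R * \<Gamma>1 * 2 powr (- (\<nu> + 1)) * (Z * W * (- \<sigma> * hgf a b c w))"
    unfolding Q by (simp add: mult_ac)
  also have "\<dots> = R * \<Gamma>1 * 2 powr (- (\<nu> + 1)) * (2 powr (\<nu> - \<mu>) / R * rGamma (\<nu> - \<mu> + 1) * (Z * W * hgf1 a b c w)
      - 2 powr (\<nu> + \<mu>) / R * rGamma (\<nu> + \<mu> + 1) * (Z * W * hgf2 a b c w))"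
    unfolding conn d1 d2 by (simp add: algebra_simps)
  also have "\<dots> = (2 powr (- (\<nu> + 1)) * 2 powr (\<nu> - \<mu>) * 2 powr \<mu>) * (\<Gamma>1 * rGamma (\<nu> - \<mu> + 1) * E1 * rGamma (1 + \<mu>) * legendre_S \<nu> \<mu> z)
     - (2 powr (- (\<nu> + 1)) * 2 powr (\<nu> + \<mu>) * 2 powr (- \<mu>)) * (\<Gamma>1 * rGamma (\<nu> + \<mu> + 1)) * (E2 * rGamma (1 - \<mu>) * legendre_S \<nu> (- \<mu>) z)"
    unfolding U1 U2 using R0 by (simp add: right_diff_distrib mult_ac)
  also have "\<dots> = 1 / 2 * (\<Gamma>1 * rGamma (\<nu> - \<mu> + 1) * E1 * rGamma (1 + \<mu>) * legendre_S \<nu> \<mu> z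
     - E2 * rGamma (1 - \<mu>) * legendre_S \<nu> (- \<mu>) z)"
    unfolding p \<Gamma>1 by (simp add: algebra_simps)
  \<comment> \<open>The reflection formula exhibits \<open>\<sigma>\<close> in both terms; it is
    nonzero for noninteger \<open>\<mu>\<close> and cancels at the end.\<close>
  also have "rGamma (1 + \<mu>) = - \<sigma> * Gamma (- \<mu>)"
  proof -
    have "rGamma (- \<mu>) * rGamma (1 + \<mu>) = - \<sigma>" using rGamma_reflection_complex[of "- \<mu>"] by (simp add: \<sigma>_def)
    moreover have "rGamma (- \<mu>) * Gamma (- \<mu>) = 1" using \<mu>'(5) by (simp add: Gamma_def rGamma_eq_zero_iff)
    ultimately show ?thesis by (metis mult.commute mult.left_commute mult_1_right)
  qed
  also have "rGamma (1 - \<mu>) = \<sigma> * Gamma \<mu>"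
  proof -
    have "rGamma \<mu> * rGamma (1 - \<mu>) = \<sigma>" using rGamma_reflection_complex[of \<mu>] by (simp add: \<sigma>_def)
    moreover have "rGamma \<mu> * Gamma \<mu> = 1" using \<mu>'(4) by (simp add: Gamma_def rGamma_eq_zero_iff)
    ultimately show ?thesis by (metis mult.commute mult.left_commute mult_1_right)
  qed
  also have "1 / 2 * (\<Gamma>1 * rGamma (\<nu> - \<mu> + 1) * E1 * (- \<sigma> * Gamma (- \<mu>)) * legendre_S \<nu> \<mu> z - E2 * (\<sigma> * Gamma \<mu>) * legendre_S \<nu> (- \<mu>) z)
     = - \<sigma> * legendre_boundary \<epsilon> \<nu> \<mu> z"
    unfolding legendre_boundary_def E1_def[symmetric] E2_def[symmetric] \<Gamma>1_def[symmetric]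
    by (simp add: algebra_simps)
  finally show ?thesis using \<sigma>0 by simp
qed

text \<open>Both sides are holomorphic in the connected half-plane and agree on a nonempty open part
  of it near -1.\<close>

lemma legendre_Q_halfplane:
  assumes \<epsilon>: "\<epsilon> = 1 \<or> \<epsilon> = - 1" and z: "z \<in> halfplane \<epsilon>"
    and \<mu>: "\<mu> \<notin> \<int>" and \<nu>: "\<nu> + \<mu> + 1 \<notin> \<int>\<^sub>\<le>\<^sub>0"
  shows "exp (- (\<i> * of_real pi * \<mu>)) * legendre_Q \<nu> \<mu> z = legendre_boundary \<epsilon> \<nu> \<mu> z"
proof (rule analytic_continuation_open[where s = "halfplane \<epsilon> \<inter> (ball (- 1) (1 / 10) \<inter> {z. 1 < norm z})" and s' = "halfplane \<epsilon>"
      and f = "\<lambda>z. exp (- (\<i> * of_real pi * \<mu>)) * legendre_Q \<nu> \<mu> z" and g = "legendre_boundary \<epsilon> \<nu> \<mu>"])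
  note \<mu>' = Ints_not_nonpos[OF \<mu>]
  show "open (halfplane \<epsilon> \<inter> (ball (- 1) (1 / 10) \<inter> {z. 1 < norm z}))"
    by (intro open_Int open_halfplane open_ball open_Collect_less continuous_intros)
  have "sqrt (1 / 400) = 1 / 20" by (rule real_sqrt_unique) (auto simp: power2_eq_square)
  \<comment> \<open>At distance \<open>1 / 20\<close> from -1, and of squared norm
    \<open>1 + 1 / 400\<close>, hence outside the unit circle.\<close>
  then have "Complex (- 1) (\<epsilon> / 20) \<in> halfplane \<epsilon> \<inter> (ball (- 1) (1 / 10) \<inter> {z. 1 < norm z})"
    using \<epsilon> by (auto simp: halfplane_def dist_norm cmod_def power2_eq_square complex_eq_iff real_less_rsqrt intro!: real_less_lsqrt)
  then show "halfplane \<epsilon> \<inter> (ball (- 1) (1 / 10) \<inter> {z. 1 < norm z}) \<noteq> {}" by blast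
  have sub: "halfplane \<epsilon> \<subseteq> D1" by (auto simp: halfplane_def intro!: D1_I)
  show "(\<lambda>z. exp (- (\<i> * of_real pi * \<mu>)) * legendre_Q \<nu> \<mu> z) holomorphic_on halfplane \<epsilon>"
    by (intro holomorphic_intros legendre_Q_holomorphic)
  show "legendre_boundary \<epsilon> \<nu> \<mu> holomorphic_on halfplane \<epsilon>"
    unfolding legendre_boundary_def[abs_def]
    by (intro holomorphic_intros holomorphic_on_subset[OF legendre_S_holomorphic sub]) (use \<mu>' in auto)
  show "exp (- (\<i> * of_real pi * \<mu>)) * legendre_Q \<nu> \<mu> z = legendre_boundary \<epsilon> \<nu> \<mu> z"
    if "z \<in> halfplane \<epsilon> \<inter> (ball (- 1) (1 / 10) \<inter> {z. 1 < norm z})" for z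
    using that by (intro legendre_Q_near_minus_1 \<epsilon> \<mu> \<nu>) (auto simp: dist_norm norm_minus_commute add.commute)
qed (use open_halfplane connected_halfplane z in auto)

text \<open>\<open>legendre_Q\<close> coincides in the half-plane with a function continuous at
  \<open>x\<close>. \<open>Lim\<close> then has this value because \<open>x\<close> is a limit point
  of the half-plane.\<close>

lemma legendre_Q_limit:
  assumes \<epsilon>: "\<epsilon> = 1 \<or> \<epsilon> = - 1" and x: "x \<in> complex_of_real ` {-1<..<1}"
    and \<mu>: "\<mu> \<notin> \<int>" and \<nu>: "\<nu> + \<mu> + 1 \<notin> \<int>\<^sub>\<le>\<^sub>0"
  shows "exp (- (\<i> * of_real pi * \<mu>)) * Lim (at x within halfplane \<epsilon>) (legendre_Q \<nu> \<mu>) = legendre_boundary \<epsilon> \<nu> \<mu> x"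
proof -
  note \<mu>' = Ints_not_nonpos[OF \<mu>]
  let ?e = "exp (- (\<i> * of_real pi * \<mu>))"
  have xD: "x \<in> D1" using x by (auto intro!: D1_I)
  have "legendre_boundary \<epsilon> \<nu> \<mu> holomorphic_on D1"
    unfolding legendre_boundary_def[abs_def]
    by (intro holomorphic_intros legendre_S_holomorphic) (use \<mu>' in auto)
  then have "isCont (legendre_boundary \<epsilon> \<nu> \<mu>) x"
    using holomorphic_on_imp_continuous_on open_D1 xD continuous_on_eq_continuous_at by blast
  then have "(legendre_boundary \<epsilon> \<nu> \<mu> \<longlongrightarrow> legendre_boundary \<epsilon> \<nu> \<mu> x) (at x within halfplane \<epsilon>)"
    unfolding isCont_def by (rule tendsto_within_subset) simp
  then have "((\<lambda>z. legendre_boundary \<epsilon> \<nu> \<mu> z / ?e) \<longlongrightarrow> legendre_boundary \<epsilon> \<nu> \<mu> x / ?e) (at x within halfplane \<epsilon>)"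
    by (intro tendsto_divide tendsto_const) auto
  moreover have "eventually (\<lambda>z. legendre_boundary \<epsilon> \<nu> \<mu> z / ?e = legendre_Q \<nu> \<mu> z) (at x within halfplane \<epsilon>)"
    unfolding eventually_at_filter
  proof (intro always_eventually allI impI)
    fix z assume "z \<in> halfplane \<epsilon>"
    from legendre_Q_halfplane[OF \<epsilon> this \<mu> \<nu>, symmetric]
    show "legendre_boundary \<epsilon> \<nu> \<mu> z / ?e = legendre_Q \<nu> \<mu> z" by simp
  qed
  ultimately have lim: "(legendre_Q \<nu> \<mu> \<longlongrightarrow> legendre_boundary \<epsilon> \<nu> \<mu> x / ?e) (at x within halfplane \<epsilon>)"
    by (rule Lim_transform_eventually)
  have "x islimpt halfplane \<epsilon>"
    unfolding islimpt_approachable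
  proof (intro allI impI)
    fix e :: real assume e: "e > 0"
    have "Im x = 0" using x by auto
    then have "x + \<i> * of_real (\<epsilon> * (e / 2)) \<in> halfplane \<epsilon>" "dist (x + \<i> * of_real (\<epsilon> * (e / 2))) x < e"
      "x + \<i> * of_real (\<epsilon> * (e / 2)) \<noteq> x"
      using e \<epsilon> by (auto simp: halfplane_def dist_norm norm_mult)
    then show "\<exists>y\<in>halfplane \<epsilon>. y \<noteq> x \<and> dist y x < e" by blast
  qed
  then have "\<not> trivial_limit (at x within halfplane \<epsilon>)" by (simp add: trivial_limit_within)
  from tendsto_Lim[OF this lim] show ?thesis by simp
qed

text \<open>On the interval all three logarithms are real, so no branch has to be compared. This
  suffices, because the formula is continued from the interval to \<open>D1\<close>.\<close>

lemma powr_quotient_real: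
  assumes "x \<in> complex_of_real ` {-1<..<1}"
  shows "(x + 1) powr s * (1 - x) powr (- s) = ((1 + x) / (1 - x)) powr s"
proof -
  obtain t where t: "x = of_real t" "- 1 < t" "t < 1" using assms by auto
  have L: "Ln ((1 + x) / (1 - x)) = Ln (x + 1) - Ln (1 - x)"
  proof -
    have e: "(1 + x) / (1 - x) = of_real ((1 + t) / (1 - t))" "x + 1 = of_real (1 + t)" "1 - x = of_real (1 - t)"
      unfolding t(1) by (simp_all only: of_real_add of_real_diff of_real_1 of_real_divide add.commute)
    have L: "Ln (complex_of_real ((1 + t) / (1 - t))) = of_real (ln ((1 + t) / (1 - t)))"
      "Ln (complex_of_real (1 + t)) = of_real (ln (1 + t))" "Ln (complex_of_real (1 - t)) = of_real (ln (1 - t))"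
      by (rule Ln_of_real, use t in simp)+
    have D: "ln ((1 + t) / (1 - t)) = ln (1 + t) - ln (1 - t)" using t by (simp add: ln_div)
    show ?thesis unfolding e(1) unfolding e(2,3) L D by (rule of_real_diff)
  qed
  have nz: "(1 + x) / (1 - x) \<noteq> 0" "x + 1 \<noteq> 0" "1 - x \<noteq> 0"
  proof -
    have "x \<in> D1" using assms by (auto intro!: D1_I)
    then show "(1 + x) / (1 - x) \<noteq> 0" "x + 1 \<noteq> 0" "1 - x \<noteq> 0" using D1_quotient[of x] by (auto simp: add.commute)
  qed
  have "(x + 1) powr s * (1 - x) powr (- s) = exp (s * Ln (x + 1) + - s * Ln (1 - x))"
    unfolding powr_def using nz by (simp only: exp_add if_False)
  also have "s * Ln (x + 1) + - s * Ln (1 - x) = s * Ln ((1 + x) / (1 - x))"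
    unfolding L by (simp add: algebra_simps)
  finally show ?thesis unfolding powr_def using nz by (simp only: if_False)
qed

theorem theorem3p2:
  fixes x \<nu> \<mu> :: complex
  assumes "x \<in> D1"
    and "\<mu> \<notin> \<int>"
    and "\<nu> + \<mu> \<notin> {- of_nat n | n :: nat. n \<ge> 1}"
  shows "ferrers_Q \<nu> \<mu> x =
    - (1 / 2) *
      (cos (of_real pi * \<nu>) * Gamma \<mu> * ((1 - x) / (1 + x)) powr (\<mu> / 2)
         * hyp2F1 (- \<nu>) (\<nu> + 1) (1 - \<mu>) ((1 + x) / 2)
       + cos (of_real pi * (\<nu> + \<mu>)) * Gamma (- \<mu>)
         * (Gamma (\<nu> + \<mu> + 1) * rGamma (\<nu> - \<mu> + 1))
         * ((1 + x) / (1 - x)) powr (\<mu> / 2)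
         * hyp2F1 (- \<nu>) (\<nu> + 1) (1 + \<mu>) ((1 + x) / 2))"
proof -
  note \<mu> = \<open>\<mu> \<notin> \<int>\<close>
  note \<mu>' = Ints_not_nonpos[OF \<mu>]
  have \<nu>: "\<nu> + \<mu> + 1 \<notin> \<int>\<^sub>\<le>\<^sub>0"
  proof
    assume "\<nu> + \<mu> + 1 \<in> \<int>\<^sub>\<le>\<^sub>0"
    then obtain n :: nat where "\<nu> + \<mu> + 1 = - of_nat n" by (auto elim!: nonpos_Ints_cases')
    then have "\<nu> + \<mu> = - of_nat (Suc n)" by (simp add: algebra_simps eq_neg_iff_add_eq_0)
    with assms(3) show False by force
  qed
  \<comment> \<open>The right-hand side as a function: it serves both as witness that an extension
    of the cut formula exists and as the function to which \<open>ferrers_Q\<close> is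
    compared.\<close>
  define g where "g x = - (1 / 2) *
      (cos (of_real pi * \<nu>) * Gamma \<mu> * ((1 - x) / (1 + x)) powr (\<mu> / 2)
         * hyp2F1 (- \<nu>) (\<nu> + 1) (1 - \<mu>) ((1 + x) / 2)
       + cos (of_real pi * (\<nu> + \<mu>)) * Gamma (- \<mu>)
         * (Gamma (\<nu> + \<mu> + 1) * rGamma (\<nu> - \<mu> + 1))
         * ((1 + x) / (1 - x)) powr (\<mu> / 2)
         * hyp2F1 (- \<nu>) (\<nu> + 1) (1 + \<mu>) ((1 + x) / 2))" for x
  have hol: "g holomorphic_on D1"
    unfolding g_def[abs_def]
    by (intro holomorphic_intros hyp2F1_holomorphic_D1 \<mu>'(1,2)) (auto dest: D1_quotient D1_quotient')
  let ?I = "complex_of_real ` {-1<..<1}"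
  have cut: "g x = ferrers_Q_cut \<nu> \<mu> x" if x: "x \<in> ?I" for x
  proof -
    define e where "e = exp (- (\<i> * of_real pi * \<mu>))"
    define A where "A = Gamma (- \<mu>) * (Gamma (\<nu> + \<mu> + 1) * rGamma (\<nu> - \<mu> + 1)) * legendre_S \<nu> \<mu> x"
    define B where "B = Gamma \<mu> * legendre_S \<nu> (- \<mu>) x"
    \<comment> \<open>The quotient formula at \<open>- x\<close> gives the inverted quotient needed
      for \<open>- \<mu>\<close>.\<close>
    have xn: "- x \<in> ?I" using x by (auto simp: image_iff intro!: bexI[of _ "- Re x"])
    have S1: "legendre_S \<nu> \<mu> x = ((1 + x) / (1 - x)) powr (\<mu> / 2) * hyp2F1 (- \<nu>) (\<nu> + 1) (1 + \<mu>) ((1 + x) / 2)"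
      using powr_quotient_real[OF x, of "\<mu> / 2"] by (simp add: legendre_S_def)
    have S2: "legendre_S \<nu> (- \<mu>) x = ((1 - x) / (1 + x)) powr (\<mu> / 2) * hyp2F1 (- \<nu>) (\<nu> + 1) (1 - \<mu>) ((1 + x) / 2)"
      using powr_quotient_real[OF xn, of "\<mu> / 2"] by (simp add: legendre_S_def mult.commute add.commute)
    have up: "e * upper_limit (legendre_Q \<nu> \<mu>) x = legendre_boundary 1 \<nu> \<mu> x"
      using legendre_Q_limit[OF _ x \<mu> \<nu>, of 1] by (simp add: e_def upper_limit_def halfplane_def)
    have lo: "e * lower_limit (legendre_Q \<nu> \<mu>) x = legendre_boundary (- 1) \<nu> \<mu> x"
      using legendre_Q_limit[OF _ x \<mu> \<nu>, of "- 1"] by (simp add: e_def lower_limit_def halfplane_def)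
    \<comment> \<open>The weight in the definition of the Ferrers function turns the phases
      \<open>\<nu> + \<mu> / 2 + 1\<close> and \<open>\<nu> - \<mu> / 2 + 1\<close> into
      \<open>\<nu> + \<mu> + 1\<close> and \<open>\<nu> + 1\<close>. The lower half-plane gives the
      opposite phases, so each pair sums to a cosine.\<close>
    have b1: "exp (- (\<i> * of_real pi * \<mu> / 2)) * legendre_boundary 1 \<nu> \<mu> x
        = 1 / 2 * (A * exp (- (\<i> * (of_real pi * (\<nu> + \<mu> + 1)))) + B * exp (- (\<i> * (of_real pi * (\<nu> + 1)))))"
    proof -
      have "exp (- (\<i> * of_real pi * \<mu> / 2)) * exp (- (\<i> * of_real (1 * pi) * (\<nu> + \<mu> / 2 + 1))) = exp (- (\<i> * (of_real pi * (\<nu> + \<mu> + 1))))"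
        "exp (- (\<i> * of_real pi * \<mu> / 2)) * exp (- (\<i> * of_real (1 * pi) * (\<nu> - \<mu> / 2 + 1))) = exp (- (\<i> * (of_real pi * (\<nu> + 1))))"
        unfolding exp_add[symmetric] by (rule arg_cong[of _ _ exp], simp add: field_simps)+
      from this[symmetric] show ?thesis
        unfolding legendre_boundary_def A_def B_def by (simp only: distrib_left mult_ac)
    qed
    have b2: "exp (\<i> * of_real pi * \<mu> / 2) * legendre_boundary (- 1) \<nu> \<mu> x
        = 1 / 2 * (A * exp (\<i> * (of_real pi * (\<nu> + \<mu> + 1))) + B * exp (\<i> * (of_real pi * (\<nu> + 1))))"
    proof -
      have "exp (\<i> * of_real pi * \<mu> / 2) * exp (- (\<i> * of_real (- 1 * pi) * (\<nu> + \<mu> / 2 + 1))) = exp (\<i> * (of_real pi * (\<nu> + \<mu> + 1)))"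
        "exp (\<i> * of_real pi * \<mu> / 2) * exp (- (\<i> * of_real (- 1 * pi) * (\<nu> - \<mu> / 2 + 1))) = exp (\<i> * (of_real pi * (\<nu> + 1)))"
        unfolding exp_add[symmetric] by (rule arg_cong[of _ _ exp], simp add: field_simps)+
      from this[symmetric] show ?thesis
        unfolding legendre_boundary_def A_def B_def by (simp only: distrib_left mult_ac)
    qed
    \<comment> \<open>The summand 1 shifts the cosine by pi, which is the overall minus sign of the
      formula.\<close>
    have cosp: "exp (\<i> * (of_real pi * (y + 1))) + exp (- (\<i> * (of_real pi * (y + 1)))) = - 2 * cos (of_real pi * y)" for y :: complex
    proof -
      have "exp (\<i> * (of_real pi * (y + 1))) + exp (- (\<i> * (of_real pi * (y + 1)))) = 2 * cos (of_real pi * y + of_real pi)"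
        unfolding cos_exp_eq by (simp add: algebra_simps)
      then show ?thesis by (simp add: cos_add)
    qed
    have "ferrers_Q_cut \<nu> \<mu> x = 1 / 2 * (exp (- (\<i> * of_real pi * \<mu> / 2)) * (e * upper_limit (legendre_Q \<nu> \<mu>) x)
        + exp (\<i> * of_real pi * \<mu> / 2) * (e * lower_limit (legendre_Q \<nu> \<mu>) x))"
      unfolding ferrers_Q_cut_def e_def by (simp only: mult.assoc)
    also have "\<dots> = 1 / 4 * (A * (exp (\<i> * (of_real pi * (\<nu> + \<mu> + 1))) + exp (- (\<i> * (of_real pi * (\<nu> + \<mu> + 1)))))
         + B * (exp (\<i> * (of_real pi * (\<nu> + 1))) + exp (- (\<i> * (of_real pi * (\<nu> + 1))))))"
      unfolding up lo b1 b2 by (simp add: algebra_simps)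
    also have "\<dots> = g x"
      unfolding cosp g_def A_def B_def S1 S2 by (simp add: algebra_simps)
    finally show ?thesis by simp
  qed
  have ex: "\<exists>g. g holomorphic_on D1 \<and> (\<forall>z\<in>?I. g z = ferrers_Q_cut \<nu> \<mu> z)"
    using hol cut by blast
  note F = analytic_continuation_works[OF ex, folded ferrers_Q_def]
  \<comment> \<open>Identity theorem on the connected set \<open>D1\<close>: the difference vanishes
    on the interval, which accumulates at 0. So the choice made by \<open>SOME\<close> is irrelevant
    on \<open>D1\<close>.\<close>
  have "ferrers_Q \<nu> \<mu> x - g x = 0"
  proof (rule analytic_continuation[of "\<lambda>x. ferrers_Q \<nu> \<mu> x - g x" D1 ?I 0])
    show "0 islimpt ?I"
      unfolding islimpt_approachable
    proof (intro allI impI)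
      fix e :: real assume e: "e > 0"
      define d where "d = min (e / 2) (1 / 2)"
      have d: "0 < d" "d < e" "d < 1" using e by (auto simp: d_def min_def)
      then show "\<exists>y\<in>?I. y \<noteq> 0 \<and> dist y 0 < e"
        by (intro bexI[of _ "complex_of_real d"]) auto
    qed
    show "?I \<subseteq> D1" by (auto intro!: D1_I)
  qed (use hol F cut open_D1 connected_D1 assms(1) in \<open>auto intro!: holomorphic_intros D1_I\<close>)
  then have "ferrers_Q \<nu> \<mu> x = g x" by simp
  then show ?thesis by (simp only: g_def)
qed

end
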